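(* Consider the constrained stochastic linear bandit described in the context, and suppose that the following hold. Rewards: the contexts $c(t)$ are i.i.d. across rounds; $r(c,j)\in[0,1]$ and $\|\phi(c,j)\|\le1$ for all $c,j$; $\|\theta_*\|\le m$; and $\eta(t)$ is zero-mean 1-subGaussian conditioned on $\{\mathcal F_{t-1},A(t)\}$. Costs: $|W^{(k)}(c,j)|\le1$, and for given $c,j$ the costs $\{W^{(k)}(c,j)\}_{t=1}^T$ are i.i.d. samples across rounds (drawn afresh each round). Slater's condition with constant $\delta\in(0,1]$: there is $\mathbf x=(x_{c,j})$ with $x_{c,j}\ge0$, $\sum_jx_{c,j}=1$ for all $c$, and $\sum_{c,j}p_cw^{(k)}(c,j)x_{c,j}\le-\delta$ for all $k\in[K]$. Then the Pessimistic-Optimistic Algorithm (run with this $\delta$) satisfies, for every $\tau\in[T]$, $$\mathcal R(\tau)\le \frac{60K^{3}}{\delta^3}+\frac{4\sqrt6\,K^{0.75}\sqrt{\tau}}{\delta}+2+\sqrt{8d\tau\,\beta_\tau(T^{-1})\log\left(\frac{d+\tau}{d}\right)},$$ $$\mathcal V(\tau)\le K^{1.5}\left(\frac{48K^2}{\delta}\log\left(\frac{16}{\delta}\right)+\frac{24K^{1.5}}{\delta^2}+\frac{30K^{1.5}}{\delta}+8K-\sqrt{\tau}\right)^{+},$$ where $\sqrt{\beta_\tau(T^{-1})}=m+\sqrt{2\log T+d\log(1+\tau/d)}$.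
   Context: Notation: $[N]=\{1,\dots,N\}$, $(x)^+=[x]^+=\max(x,0)$, $\|\cdot\|$ is the Euclidean norm, $\|x\|_\Sigma=\sqrt{x^\dagger\Sigma x}$, $\dagger$ is transpose. Model. $T$ is the horizon, $\mathcal C$ a countable context set, $[J]$ the action set, $K$ the number of constraints, $\phi(c,j)\in\mathbb R^d$ a known feature vector for each $(c,j)\in\mathcal C\times[J]$, $\theta_*\in\mathbb R^d$ an unknown vector. In each round $t\in[T]$ a context $c(t)$ is drawn with $\mathbb P(c(t)=c)=p_c$; the learner observes $c(t)$ and the realized costs $W^{(k)}(c(t),j)$ of this round for all $k\in[K]$, $j\in[J]$, takes an action $A(t)\in[J]$, and receives $R(c(t),A(t))=r(c(t),A(t))+\eta(t)$, where $r(c,j)=\langle\theta_*,\phi(c,j)\rangle$. Write $X_j(t)=1$ if $A(t)=j$ and $X_j(t)=0$ otherwise. $w^{(k)}(c,j)=\mathbb E[W^{(k)}(c,j)]$. $\mathcal F_{t-1}=\{c(s),A(s),R(c(s),A(s)),W^{(k)}(c(s),A(s))\}_{s\in[t-1],k\in[K]}$. Baseline. $\mathbf x^*$ is an optimal solution of: maximize $\sum_{c,j}p_cr(c,j)x_{c,j}$ subject to $\sum_jx_{c,j}=1$, $x_{c,j}\ge0$ for all $c,j$, and $\sum_{c,j}p_cw^{(k)}(c,j)x_{c,j}\le0$ for all $k\in[K]$. Regret and violation: $\mathcal R(\tau)=\tau\sum_{c,j}p_cr(c,j)x^*_{c,j}-\mathbb E[\sum_{t=1}^\tau\sum_jR(c(t),j)X_j(t)]$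 and $\mathcal V(\tau)=\sum_{k\in[K]}\left(\mathbb E[\sum_{t=1}^\tau\sum_jW^{(k)}(c(t),j)X_j(t)]\right)^+$. Pessimistic-Optimistic Algorithm. Initialize $Q^{(k)}(1)=0$ for all $k$, $\Sigma_0=\mathbf I$, $\sqrt{\beta_1}=m+\sqrt{2\log T}$, $\mathcal B_1=\{\theta:\|\theta\|_{\Sigma_0}\le\sqrt{\beta_1}\}$. For $t=1,\dots,T$: (1) set $V_t=\delta K^{0.25}\sqrt{2t/3}$ and $\epsilon_t=K^{0.75}\sqrt{6/t}$; (2) for all $j$ set $\tilde r(c(t),j)=\max_{\theta\in\mathcal B_t}\langle\theta,\phi(c(t),j)\rangle$ and $\hat r(c(t),j)=\min\{1,\tilde r(c(t),j)\}$; (3) take an action $A(t)=j^*\in\arg\max_j\left\{\hat r(c(t),j)-\frac1{V_t}\sum_kW^{(k)}(c(t),j)Q^{(k)}(t)\right\}$ (ties broken arbitrarily); (4) for all $k$ set $Q^{(k)}(t+1)=\left[Q^{(k)}(t)+\sum_jW^{(k)}(c(t),j)X_j(t)+\epsilon_t\right]^+$; (5) set $\Sigma_t=\Sigma_{t-1}+\phi(c(t),j^* )\phi^\dagger(c(t),j^* )$, $\hat\theta_t=\Sigma_t^{-1}\sum_{s=1}^t\phi(c(s),A(s))R(c(s),A(s))$, $\sqrt{\beta_{t+1}}=m+\sqrt{2\log T+d\log\frac{d+t}{d}}$, $\mathcal B_{t+1}=\{\theta:\|\theta-\hat\theta_t\|_{\Sigma_t}\le\sqrt{\beta_{t+1}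}\}$.
   Formalization: The noise η(t) is assumed zero-mean 1-subGaussian given F_{t-1}, A(t) and also the current context c(t); each cost W(c,j) is independent of the same round's context, and each round's context and costs are jointly independent of F_{t-1}. Without these the bounds can fail. *)

theory Defs
  imports "HOL-Probability.Probability"
begin

text \<open>Contexts range over a countable set \<open>C\<close>, actions over \<open>{1..J}\<close>, constraints over \<open>{1..K}\<close>
  and rounds over \<open>{1..T}\<close>. In \<open>policy_avg\<close> all summands used below are bounded by \<open>p c * J\<close>,
  so that the unconditional sum over \<open>C\<close> exists.\<close>

definition is_policy :: "'c set \<Rightarrow> nat \<Rightarrow> ('c \<Rightarrow> nat \<Rightarrow> real) \<Rightarrow> bool" where
  "is_policy C J x \<longleftrightarrow> (\<forall>c\<in>C. (\<Sum>j\<in>{1..J}. x c j) = 1 \<and> (\<forall>j\<in>{1..J}. x c j \<ge> 0))"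

definition policy_avg ::
  "'c set \<Rightarrow> nat \<Rightarrow> ('c \<Rightarrow> real) \<Rightarrow> ('c \<Rightarrow> nat \<Rightarrow> real) \<Rightarrow> ('c \<Rightarrow> nat \<Rightarrow> real) \<Rightarrow> real" where
  "policy_avg C J p f x = (\<Sum>\<^sub>\<infinity>c\<in>C. \<Sum>j\<in>{1..J}. p c * f c j * x c j)"

definition feasible_policy ::
  "'c set \<Rightarrow> nat \<Rightarrow> nat \<Rightarrow> ('c \<Rightarrow> real) \<Rightarrow> (nat \<Rightarrow> 'c \<Rightarrow> nat \<Rightarrow> real) \<Rightarrow> ('c \<Rightarrow> nat \<Rightarrow> real) \<Rightarrow> bool" where
  "feasible_policy C J K p w x \<longleftrightarrow>
     is_policy C J x \<and> (\<forall>k\<in>{1..K}. policy_avg C J p (w k) x \<le> 0)"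

definition optimal_policy ::
  "'c set \<Rightarrow> nat \<Rightarrow> nat \<Rightarrow> ('c \<Rightarrow> real) \<Rightarrow> ('c \<Rightarrow> nat \<Rightarrow> real) \<Rightarrow> (nat \<Rightarrow> 'c \<Rightarrow> nat \<Rightarrow> real)
    \<Rightarrow> ('c \<Rightarrow> nat \<Rightarrow> real) \<Rightarrow> bool" where
  "optimal_policy C J K p r w x \<longleftrightarrow>
     is_arg_max (policy_avg C J p r) (feasible_policy C J K p w) x"

definition V_param :: "real \<Rightarrow> nat \<Rightarrow> nat \<Rightarrow> real" where
  "V_param \<delta> K t = \<delta> * real K powr (1/4) * sqrt (2 * real t / 3)"

definition eps_param :: "nat \<Rightarrow> nat \<Rightarrow> real" where
  "eps_param K t = real K powr (3/4) * sqrt (6 / real t)"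

text \<open>Virtual queue driven by the incurred costs \<open>g t\<close>. Rounds start at 1; index 0 is a dummy.\<close>

fun queue :: "nat \<Rightarrow> (nat \<Rightarrow> real) \<Rightarrow> nat \<Rightarrow> real" where
  "queue K g 0 = 0"
| "queue K g (Suc 0) = 0"
| "queue K g (Suc (Suc t)) = max 0 (queue K g (Suc t) + g (Suc t) + eps_param K (Suc t))"

text \<open>\<open>x t\<close> is the feature vector played in round \<open>t\<close> and \<open>y t\<close> the reward received.\<close>

primrec gram :: "(nat \<Rightarrow> real^'n) \<Rightarrow> nat \<Rightarrow> real^'n^'n" where
  "gram x 0 = mat 1"
| "gram x (Suc t) = gram x t + (\<chi> i j. x (Suc t) $ i * x (Suc t) $ j)"

definition theta_hat :: "(nat \<Rightarrow> real^'n) \<Rightarrow> (nat \<Rightarrow> real) \<Rightarrow> nat \<Rightarrow> real^'n" where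
  "theta_hat x y t = matrix_inv (gram x t) *v (\<Sum>s\<in>{1..t}. y s *\<^sub>R x s)"

definition wnorm :: "real^'n^'n \<Rightarrow> real^'n \<Rightarrow> real" where
  "wnorm S x = sqrt (x \<bullet> (S *v x))"

text \<open>Confidence sets, for \<open>t \<ge> 1\<close>. For \<open>t = 1\<close> the logarithm of the dimension ratio and the
  estimate \<open>theta_hat x y 0\<close> vanish, which gives the prescribed initial radius and set.\<close>

definition sqrt_beta :: "real \<Rightarrow> nat \<Rightarrow> nat \<Rightarrow> nat \<Rightarrow> real" where
  "sqrt_beta m T d t =
     m + sqrt (2 * ln (real T) + real d * ln ((real d + real (t - 1)) / real d))"

definition conf_set ::
  "real \<Rightarrow> nat \<Rightarrow> (nat \<Rightarrow> real^'n) \<Rightarrow> (nat \<Rightarrow> real) \<Rightarrow> nat \<Rightarrow> (real^'n) set" where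
  "conf_set m T x y t =
     {\<theta>. wnorm (gram x (t - 1)) (\<theta> - theta_hat x y (t - 1)) \<le> sqrt_beta m T CARD('n) t}"

text \<open>The confidence set is a nonempty compact ellipsoid, so the supremum is a maximum.\<close>

definition r_hat ::
  "real \<Rightarrow> nat \<Rightarrow> (nat \<Rightarrow> real^'n) \<Rightarrow> (nat \<Rightarrow> real) \<Rightarrow> nat \<Rightarrow> real^'n \<Rightarrow> real" where
  "r_hat m T x y t v = min 1 (SUP \<theta>\<in>conf_set m T x y t. \<theta> \<bullet> v)"

text \<open>The path has contexts \<open>c t\<close>, actions \<open>a t\<close>, received rewards \<open>y t\<close> and realized cost
  tables \<open>W t k c' j\<close>. The action is any maximizer, so ties are broken arbitrarily.\<close>

definition pess_opt_run ::
  "nat \<Rightarrow> nat \<Rightarrow> nat \<Rightarrow> real \<Rightarrow> real \<Rightarrow> ('c \<Rightarrow> nat \<Rightarrow> real^'n) \<Rightarrow>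
   (nat \<Rightarrow> 'c) \<Rightarrow> (nat \<Rightarrow> nat) \<Rightarrow> (nat \<Rightarrow> real) \<Rightarrow> (nat \<Rightarrow> nat \<Rightarrow> 'c \<Rightarrow> nat \<Rightarrow> real) \<Rightarrow> bool" where
  "pess_opt_run T J K m \<delta> \<phi> c a y W \<longleftrightarrow>
     (let x = (\<lambda>t. \<phi> (c t) (a t));
          Q = (\<lambda>k. queue K (\<lambda>t. \<Sum>j\<in>{1..J}. W t k (c t) j * of_bool (a t = j)))
      in \<forall>t\<in>{1..T}.
           is_arg_max
             (\<lambda>j. r_hat m T x y t (\<phi> (c t) j)
                  - 1 / V_param \<delta> K t * (\<Sum>k\<in>{1..K}. W t k (c t) j * Q k t))
             (\<lambda>j. j \<in> {1..J}) (a t))"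

abbreviation gen_sets :: "'o measure \<Rightarrow> ('o \<Rightarrow> 'b) \<Rightarrow> 'b measure \<Rightarrow> 'o set set" where
  "gen_sets M X N \<equiv> sets (vimage_algebra (space M) X N)"

text \<open>The sigma-algebra generated by the contexts, actions, received rewards and incurred costs of
  rounds \<open>1..n\<close>; \<open>R t j\<close> is the reward that action \<open>j\<close> yields in round \<open>t\<close>.\<close>

definition history ::
  "'o measure \<Rightarrow> 'c set \<Rightarrow> nat \<Rightarrow> nat \<Rightarrow> (nat \<Rightarrow> 'o \<Rightarrow> 'c) \<Rightarrow> (nat \<Rightarrow> 'o \<Rightarrow> nat) \<Rightarrow>
   (nat \<Rightarrow> nat \<Rightarrow> 'o \<Rightarrow> real) \<Rightarrow> (nat \<Rightarrow> nat \<Rightarrow> 'c \<Rightarrow> nat \<Rightarrow> 'o \<Rightarrow> real) \<Rightarrow> nat \<Rightarrow> 'o measure" where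
  "history M C J K ctx A R W n = sigma (space M)
     (\<Union>s\<in>{1..n}.
        gen_sets M (ctx s) (count_space C) \<union>
        gen_sets M (A s) (count_space {1..J}) \<union>
        gen_sets M (\<lambda>\<omega>. R s (A s \<omega>) \<omega>) borel \<union>
        (\<Union>k\<in>{1..K}. gen_sets M (\<lambda>\<omega>. W s k (ctx s \<omega>) (A s \<omega>) \<omega>) borel))"

text \<open>What is known when the reward of round \<open>t\<close> is realized: the history of the earlier rounds,
  the current context and the action taken in it. The current context has to be included: the
  action alone, as a number in \<open>{1..J}\<close>, does not determine the feature vector played, and noise
  that is centred only on average over contexts would bias the least-squares estimate.\<close>

definition pre_reward ::
  "'o measure \<Rightarrow> 'c set \<Rightarrow> nat \<Rightarrow> nat \<Rightarrow> (nat \<Rightarrow> 'o \<Rightarrow> 'c) \<Rightarrow> (nat \<Rightarrow> 'o \<Rightarrow> nat) \<Rightarrow>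
   (nat \<Rightarrow> nat \<Rightarrow> 'o \<Rightarrow> real) \<Rightarrow> (nat \<Rightarrow> nat \<Rightarrow> 'c \<Rightarrow> nat \<Rightarrow> 'o \<Rightarrow> real) \<Rightarrow> nat \<Rightarrow> 'o measure" where
  "pre_reward M C J K ctx A R W t = sigma (space M)
     (sets (history M C J K ctx A R W (t - 1)) \<union>
      gen_sets M (ctx t) (count_space C) \<union>
      gen_sets M (A t) (count_space {1..J}))"

text \<open>The sigma-algebra generated by the draw of round \<open>t\<close>: context and table of costs.\<close>

definition round_draw ::
  "'o measure \<Rightarrow> 'c set \<Rightarrow> nat \<Rightarrow> nat \<Rightarrow> (nat \<Rightarrow> 'o \<Rightarrow> 'c) \<Rightarrow>
   (nat \<Rightarrow> nat \<Rightarrow> 'c \<Rightarrow> nat \<Rightarrow> 'o \<Rightarrow> real) \<Rightarrow> nat \<Rightarrow> 'o measure" where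
  "round_draw M C J K ctx W t = sigma (space M)
     (gen_sets M (ctx t) (count_space C) \<union>
      (\<Union>k\<in>{1..K}. \<Union>c\<in>C. \<Union>j\<in>{1..J}. gen_sets M (W t k c j) borel))"

definition cond_zero_mean :: "'o measure \<Rightarrow> 'o measure \<Rightarrow> ('o \<Rightarrow> real) \<Rightarrow> bool" where
  "cond_zero_mean M G X \<longleftrightarrow> integrable M X \<and> (AE \<omega> in M. real_cond_exp M G X \<omega> = 0)"

definition cond_subgaussian :: "real \<Rightarrow> 'o measure \<Rightarrow> 'o measure \<Rightarrow> ('o \<Rightarrow> real) \<Rightarrow> bool" where
  "cond_subgaussian \<sigma> M G X \<longleftrightarrow>
     (\<forall>l. integrable M (\<lambda>\<omega>. exp (l * X \<omega>)) \<and>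
          (AE \<omega> in M. real_cond_exp M G (\<lambda>\<omega>. exp (l * X \<omega>)) \<omega> \<le> exp (l\<^sup>2 * \<sigma>\<^sup>2 / 2)))"

definition regret ::
  "'o measure \<Rightarrow> 'c set \<Rightarrow> nat \<Rightarrow> ('c \<Rightarrow> real) \<Rightarrow> ('c \<Rightarrow> nat \<Rightarrow> real) \<Rightarrow> (nat \<Rightarrow> 'o \<Rightarrow> nat) \<Rightarrow>
   (nat \<Rightarrow> nat \<Rightarrow> 'o \<Rightarrow> real) \<Rightarrow> ('c \<Rightarrow> nat \<Rightarrow> real) \<Rightarrow> nat \<Rightarrow> real" where
  "regret M C J p r A R xopt \<tau> =
     real \<tau> * policy_avg C J p r xopt
     - (\<integral>\<omega>. (\<Sum>t\<in>{1..\<tau>}. \<Sum>j\<in>{1..J}. R t j \<omega> * of_bool (A t \<omega> = j)) \<partial>M)"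

definition violation ::
  "'o measure \<Rightarrow> nat \<Rightarrow> nat \<Rightarrow> (nat \<Rightarrow> 'o \<Rightarrow> 'c) \<Rightarrow> (nat \<Rightarrow> 'o \<Rightarrow> nat) \<Rightarrow>
   (nat \<Rightarrow> nat \<Rightarrow> 'c \<Rightarrow> nat \<Rightarrow> 'o \<Rightarrow> real) \<Rightarrow> nat \<Rightarrow> real" where
  "violation M J K ctx A W \<tau> =
     (\<Sum>k\<in>{1..K}.
        max 0 (\<integral>\<omega>. (\<Sum>t\<in>{1..\<tau>}. \<Sum>j\<in>{1..J}. W t k (ctx t \<omega>) j \<omega> * of_bool (A t \<omega> = j)) \<partial>M))"

end

theory Submission
  imports Defs
begin

text \<open>Mixing the optimal policy with the Slater policy with weight \<open>min 1 (eps t / \<delta>)\<close> gives a policy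
  that satisfies the tightened constraints as soon as \<open>eps t \<le> \<delta>\<close>. Comparing the action taken with
  this policy and bounding the drift of the squared queue lengths controls the regret by
  \<open>sum eps t / \<delta>\<close>, terms \<open>K / V t\<close>, the contribution of the early rounds with \<open>eps t > \<delta>\<close>, in which
  the queues are bounded trivially, and the estimation error. The latter is bounded by the elliptical
  potential; when \<open>\<theta>star\<close> lies outside the confidence ellipsoid, the excess of its distance over the
  radius is at most \<open>1 / T\<close> times the self-normalized process \<open>exp (norm\<^sup>2 / 2) / sqrt det\<close>, a
  supermartingale with mean at most 1.

  For the violation, the pessimism \<open>sum eps t\<close> is compared with the expected queue length. By the
  maximal inequality all confidence sets are valid except on an event of probability \<open>1 / T\<close>; outside it the
  Euclidean norm of the queues has negative drift above a level proportional to \<open>V t / \<delta>\<close>, so that an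
  exponential moment bounds its mean. Both that level and \<open>sum eps t\<close> are of order \<open>sqrt t\<close>, the latter
  with the larger constant.\<close>

subsection \<open>Determinants of symmetric matrices\<close>

text \<open>The action of a round may depend on the cost table of that round, so the incurred costs
  have no tractable conditional mean. What is averaged instead is the cost of a fixed policy on the
  same table: the maximizing action is compared with it path by path, and the table is independent
  of the history, which determines the queues. Conditional expectations of costs never appear;
  expectations factorize against history-measurable weights. A failed confidence set would break the
  comparison, hence the excess is added to it as an error term. The regret only needs the mean of
  the excess; the exponential moment of the queue norm does not tolerate it, hence the restriction
  to a decreasing sequence of history-measurable events. The constants are tied by
  \<open>K / V t = eps t / (2 * \<delta>)\<close>: with \<open>a0 = sqrt 6 * K powr (3/4)\<close>
  the accumulated pessimism is close to \<open>2 * a0 * sqrt t\<close>, while the drift level is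
  only \<open>4 * V t / \<delta> = 8 * K / a0 * sqrt t\<close> up to a constant; the gap is at least
  \<open>sqrt K * sqrt t\<close>.\<close>

lemma selfadjoint_eigenvector:
  fixes f :: "'a::euclidean_space \<Rightarrow> 'a"
  assumes lin: "linear f" and sa: "\<And>x y. f x \<bullet> y = x \<bullet> f y"
    and S: "subspace S" "f ` S \<subseteq> S" "S \<noteq> {0}"
  obtains u l where "u \<in> S" "norm u = 1" "f u = l *\<^sub>R u"
proof -
  interpret linear f by (rule lin)
  let ?U = "S \<inter> sphere 0 1"
  have "compact ?U"
    using closed_subspace[OF S(1)] by (simp add: closed_Int_compact)
  moreover have "?U \<noteq> {}"
  proof -
    obtain x where x: "x \<in> S" "x \<noteq> 0"
      using S(1,3) subspace_0 by blast
    then have "x /\<^sub>R norm x \<in> ?U"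
      using S(1) by (simp add: subspace_scale)
    then show ?thesis by blast
  qed
  moreover have "continuous_on ?U (\<lambda>x. x \<bullet> f x)"
    using linear_continuous_on[of f] lin linear_linear
    by (intro continuous_on_inner continuous_on_id) (auto simp: linear_conv_bounded_linear)
  ultimately obtain u where u: "u \<in> ?U" and mx: "\<And>y. y \<in> ?U \<Longrightarrow> y \<bullet> f y \<le> u \<bullet> f u"
    using continuous_attains_sup[of ?U "\<lambda>x. x \<bullet> f x"] by blast
  define l where "l = u \<bullet> f u"
  have uS: "u \<in> S" and nu: "norm u = 1" using u by auto
  have bound: "y \<bullet> f y \<le> l * (y \<bullet> y)" if "y \<in> S" for y
  proof (cases "y = 0")
    case False
    have "y /\<^sub>R norm y \<in> ?U"
      using that False S(1) by (simp add: subspace_scale)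
    from mx[OF this] have "(y \<bullet> f y) / (norm y)\<^sup>2 \<le> l"
      by (simp add: scale l_def power2_eq_square field_simps)
    then show ?thesis
      using False by (simp add: field_simps power2_norm_eq_inner)
  qed (simp add: scale)
  define w where "w = f u - l *\<^sub>R u"
  have wS: "w \<in> S"
    unfolding w_def using S(1,2) uS by (intro subspace_diff subspace_scale) auto
  have uu: "u \<bullet> u = 1" using nu by (simp add: norm_eq_1)
  have uw: "u \<bullet> w = 0"
    by (simp add: w_def inner_diff_right uu l_def)
  have wf: "w \<bullet> f u = w \<bullet> w"
    using uw by (simp add: w_def inner_diff_right inner_commute)
  \<comment> \<open>Moving from the maximizer \<open>u\<close> along the residual \<open>w\<close>
    changes the quadratic form to first order by \<open>2 * s * (w \<bullet> w)\<close>, which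
    second-order terms must absorb for every \<open>s\<close>; a small positive \<open>s\<close>
    then forces \<open>w = 0\<close>.\<close>
  have quad: "2 * s * (w \<bullet> w) \<le> s\<^sup>2 * (l * (w \<bullet> w) - w \<bullet> f w)" for s :: real
  proof -
    have "u + s *\<^sub>R w \<in> S"
      using S(1) uS wS by (intro subspace_add subspace_scale)
    from bound[OF this]
    have "u \<bullet> f u + 2 * s * (w \<bullet> w) + s\<^sup>2 * (w \<bullet> f w) \<le> l * (1 + s\<^sup>2 * (w \<bullet> w))"
      using wf sa[of u w] uw uu
      by (simp add: add scale inner_add_left inner_add_right power2_eq_square algebra_simps inner_commute)
    then show ?thesis by (simp add: l_def algebra_simps)
  qed
  define c where "c = l * (w \<bullet> w) - w \<bullet> f w"
  have "w \<bullet> w = 0"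
  proof (rule ccontr)
    assume ne: "w \<bullet> w \<noteq> 0"
    then have pos: "w \<bullet> w > 0" by simp
    define s where "s = (w \<bullet> w) / (\<bar>c\<bar> + 1)"
    have s: "s > 0" using pos by (simp add: s_def)
    have "2 * (w \<bullet> w) \<le> s * c"
      using quad[of s] s by (simp add: c_def[symmetric] power2_eq_square)
    also have "\<dots> \<le> s * (\<bar>c\<bar> + 1)" using s by simp
    also have "\<dots> = w \<bullet> w" by (simp add: s_def)
    finally show False using pos by simp
  qed
  then have "f u = l *\<^sub>R u" by (simp add: w_def)
  with uS nu show thesis by (rule that)
qed

text \<open>Induction on the dimension: by self-adjointness the orthogonal complement of an
  eigenvector inside \<open>S\<close> is again invariant. This is why invariant subspaces are
  considered and not just the whole space.\<close>

lemma selfadjoint_orthonormal_eigenbasis: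
  fixes f :: "'a::euclidean_space \<Rightarrow> 'a"
  assumes lin: "linear f" and sa: "\<And>x y. f x \<bullet> y = x \<bullet> f y"
    and S: "subspace S" "f ` S \<subseteq> S"
  shows "\<exists>B. B \<subseteq> S \<and> finite B \<and> card B = dim S \<and> pairwise orthogonal B
           \<and> (\<forall>u\<in>B. norm u = 1 \<and> (\<exists>l. f u = l *\<^sub>R u))"
  using S
proof (induction "dim S" arbitrary: S rule: less_induct)
  case (less S)
  interpret linear f by (rule lin)
  show ?case
  proof (cases "S = {0}")
    case True
    then show ?thesis by (intro exI[of _ "{}"]) auto
  next
    case False
    obtain u l where u: "u \<in> S" "norm u = 1" "f u = l *\<^sub>R u"
      using selfadjoint_eigenvector[OF lin sa less.prems False] by metis
    define S' where "S' = {y \<in> S. \<forall>x \<in> span {u}. orthogonal x y}"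
    have dims: "dim S' + dim (span {u}) = dim S"
      unfolding S'_def using less.prems(1) u(1)
      by (intro dim_subspace_orthogonal_to_vectors) (auto simp: span_minimal)
    have "u \<noteq> 0" using u(2) by auto
    then have du: "dim (span {u}) = 1" by simp
    have S'_alt: "S' = {y \<in> S. u \<bullet> y = 0}"
      unfolding S'_def by (auto simp: orthogonal_def span_singleton)
    have sub: "subspace S'"
      unfolding S'_alt using less.prems(1)
      by (auto simp: subspace_def inner_add_right)
    have inv: "f ` S' \<subseteq> S'"
    proof
      fix y assume "y \<in> f ` S'"
      then obtain z where z: "z \<in> S" "u \<bullet> z = 0" "y = f z"
        by (auto simp: S'_alt)
      have "u \<bullet> f z = f u \<bullet> z" by (simp add: sa)
      then show "y \<in> S'"
        using z less.prems(2) by (auto simp: S'_alt u(3))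
    qed
    from less.hyps[OF _ sub inv] dims du
    obtain B where B: "B \<subseteq> S'" "finite B" "card B = dim S'" "pairwise orthogonal B"
      "\<forall>u\<in>B. norm u = 1 \<and> (\<exists>l. f u = l *\<^sub>R u)" by auto
    have "u \<notin> B"
      using B(1) u(2) by (auto simp: S'_alt norm_eq_1)
    then have "card (insert u B) = dim S" using B dims du by simp
    moreover have "pairwise orthogonal (insert u B)"
      using B(1,4) by (auto simp: pairwise_insert S'_alt orthogonal_def inner_commute)
    ultimately show ?thesis
      using B u by (intro exI[of _ "insert u B"]) (auto simp: S'_alt)
  qed
qed

lemma symmetric_matrix_diagonalization:
  fixes A :: "real^'n^'n"
  assumes "transpose A = A"
  obtains P l where "orthogonal_matrix P" "A ** P = P ** (\<chi> i j. if i = j then l i else 0)"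
proof -
  have sa: "(A *v x) \<bullet> y = x \<bullet> (A *v y)" for x y
    by (metis assms dot_lmul_matrix transpose_matrix_vector)
  have "\<exists>B. B \<subseteq> (UNIV :: (real^'n) set) \<and> finite B \<and> card B = dim (UNIV :: (real^'n) set)
          \<and> pairwise orthogonal B \<and> (\<forall>u\<in>B. norm u = 1 \<and> (\<exists>l. A *v u = l *\<^sub>R u))"
    by (rule selfadjoint_orthonormal_eigenbasis[OF _ sa]) auto
  then obtain B where B: "finite B" "card B = CARD('n)" "pairwise orthogonal B"
      "\<forall>u\<in>B. norm u = 1 \<and> (\<exists>l. A *v u = l *\<^sub>R u)"
    by (auto simp: dim_UNIV)
  obtain b where b: "bij_betw b (UNIV :: 'n set) B"
    using B by (metis finite_same_card_bij finite)
  then have bB: "b i \<in> B" for i by (auto simp: bij_betw_def)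
  have "\<forall>i. \<exists>l. A *v b i = l *\<^sub>R b i" using B(4) bB by blast
  then obtain l where l: "\<And>i. A *v b i = l i *\<^sub>R b i" by metis
  define P :: "real^'n^'n" where "P = (\<chi> i j. b j $ i)"
  have col: "column j P = b j" for j by (simp add: P_def column_def)
  have orth: "orthogonal_matrix P"
    unfolding orthogonal_matrix_orthonormal_columns col
  proof (intro conjI allI impI)
    show "norm (b i) = 1" for i using B(4) bB by blast
    show "orthogonal (b i) (b j)" if "i \<noteq> j" for i j
    proof -
      have "b i \<noteq> b j" using b that by (auto simp: bij_betw_def inj_on_def)
      then show ?thesis using B(3) bB by (auto simp: pairwise_def)
    qed
  qed
  have "(A ** P) $ i $ j = (P ** (\<chi> i j. if i = j then l i else 0)) $ i $ j" for i j
  proof -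
    have "(A ** P) $ i $ j = (A *v b j) $ i"
      by (simp add: matrix_matrix_mult_def matrix_vector_mult_def P_def)
    also have "\<dots> = l j * b j $ i" by (simp add: l)
    also have "\<dots> = (P ** (\<chi> i j. if i = j then l i else 0)) $ i $ j"
      by (simp add: matrix_matrix_mult_def P_def if_distrib[of "(*) _"] cong: if_cong)
    finally show ?thesis .
  qed
  then have "A ** P = P ** (\<chi> i j. if i = j then l i else 0)" by (simp add: vec_eq_iff)
  with orth show thesis by (rule that)
qed

text \<open>The inequality of arithmetic and geometric means for the eigenvalues, in the
  tangent-line form \<open>l / c \<le> exp (l / c - 1)\<close>. The free scale \<open>c\<close>
  avoids roots; if the trace is at most \<open>c * CARD('n)\<close>, the exponential factor is at
  most 1.\<close>

lemma det_le_exp_trace: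
  fixes A :: "real^'n^'n"
  assumes sym: "transpose A = A" and pd: "\<And>x. x \<bullet> (A *v x) \<ge> 0" and c: "c > 0"
  shows "det A \<le> c ^ CARD('n) * exp (trace A / c - CARD('n))"
proof -
  obtain P l where P: "orthogonal_matrix P"
      and eq: "A ** P = P ** (\<chi> i j. if i = j then l i else 0)"
    by (rule symmetric_matrix_diagonalization[OF sym])
  define D :: "real^'n^'n" where "D = (\<chi> i j. if i = j then l i else 0)"
  have PP: "transpose P ** P = mat 1" "P ** transpose P = mat 1"
    using P by (auto simp: orthogonal_matrix_def)
  have D: "D = transpose P ** (A ** P)"
    unfolding eq D_def[symmetric] by (simp only: matrix_mul_assoc PP matrix_mul_lid)
  have "det P * det P = 1" using PP(2) by (metis det_I det_mul det_transpose)
  then have detD: "det A = det D"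
    unfolding D by (simp add: det_mul det_transpose)
  have "trace D = trace ((A ** P) ** transpose P)"
    unfolding D by (rule trace_mul_sym)
  then have tr: "trace A = trace D"
    by (simp only: matrix_mul_assoc[symmetric] PP matrix_mul_rid)
  have l0: "l i \<ge> 0" for i
  proof -
    have "l i = axis i 1 \<bullet> (D *v axis i 1)"
      by (simp add: D_def matrix_vector_mult_basis column_def inner_axis' )
    also have "\<dots> = (P *v axis i 1) \<bullet> (A *v (P *v axis i 1))"
    proof -
      have "x \<bullet> (transpose P *v z) = (P *v x) \<bullet> z" for x z
        by (metis dot_lmul_matrix vector_transpose_matrix)
      then show ?thesis
        unfolding D by (simp only: matrix_vector_mul_assoc [symmetric])
    qed
    finally show ?thesis using pd by simp
  qed
  have "det D = (\<Prod>i\<in>UNIV. l i)"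
    unfolding D_def by (subst det_diagonal) auto
  also have "\<dots> \<le> (\<Prod>i\<in>(UNIV :: 'n set). c * exp (l i / c - 1))"
  proof (rule prod_mono)
    fix i :: 'n
    have "l i / c \<le> exp (l i / c - 1)" using exp_ge_add_one_self[of "l i / c - 1"] by simp
    then show "0 \<le> l i \<and> l i \<le> c * exp (l i / c - 1)" using l0 c by (simp add: field_simps)
  qed
  also have "\<dots> = c ^ CARD('n) * exp (\<Sum>i\<in>(UNIV :: 'n set). l i / c - 1)"
    by (simp add: prod.distrib exp_sum)
  also have "(\<Sum>i\<in>(UNIV :: 'n set). l i / c - 1) = trace A / c - CARD('n)"
  proof -
    have "trace A = (\<Sum>i\<in>(UNIV :: 'n set). l i)"
      unfolding tr by (simp add: trace_def D_def)
    then show ?thesis by (simp add: sum_subtractf sum_divide_distrib)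
  qed
  finally show ?thesis by (simp add: detD)
qed

text \<open>With \<open>E\<close> the identity whose \<open>k\<close>-th column is replaced by
  \<open>u\<close>, the matrix in question times \<open>E\<close> equals
  \<open>E ** transpose Y\<close>, where \<open>Y\<close> is again the identity with one column
  replaced. Both determinants come from Cramer's rule, and \<open>u $ k \<noteq> 0\<close> allows
  cancelling \<open>det E\<close>.\<close>

lemma det_identity_plus_outer:
  fixes u v :: "real^'n"
  shows "det (mat 1 + (\<chi> i j. u $ i * v $ j)) = 1 + u \<bullet> v"
proof (cases "u = 0")
  case True
  then have "mat 1 + (\<chi> i j. u $ i * v $ j) = (mat 1 :: real^'n^'n)" by (simp add: vec_eq_iff)
  then show ?thesis using True by simp
next
  case False
  then obtain k where k: "u $ k \<noteq> 0" by (auto simp: vec_eq_iff)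
  let ?X = "mat 1 + (\<chi> i j. u $ i * v $ j) :: real^'n^'n"
  define E :: "real^'n^'n" where "E = (\<chi> i j. if j = k then (mat 1 *v u) $ i else mat 1 $ i $ j)"
  define w where "w = v v* E"
  define Y :: "real^'n^'n" where "Y = (\<chi> i j. if j = k then (mat 1 *v (w + axis k 1)) $ i else mat 1 $ i $ j)"
  have dE: "det E = u $ k"
    unfolding E_def by (subst cramer_lemma) simp
  have dY: "det Y = 1 + w $ k"
    unfolding Y_def by (subst cramer_lemma) (simp add: axis_def)
  have wk: "w $ k = u \<bullet> v"
    by (simp add: w_def vector_matrix_mult_def E_def inner_vec_def mult.commute)
  have Euk: "E $ i $ k = u $ i" for i by (simp add: E_def)
  have "(?X ** E) $ i $ j = (E ** transpose Y) $ i $ j" for i j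
  proof -
    have "(?X ** E) $ i $ j = E $ i $ j + u $ i * w $ j"
    proof -
      have "(?X ** E) $ i $ j = (\<Sum>m\<in>UNIV. (if i = m then E $ m $ j else 0)) + (\<Sum>m\<in>UNIV. u $ i * (v $ m * E $ m $ j))"
        unfolding matrix_matrix_mult_def sum.distrib[symmetric]
        by (auto simp: mat_def algebra_simps intro!: sum.cong)
      also have "(\<Sum>m\<in>UNIV. u $ i * (v $ m * E $ m $ j)) = u $ i * w $ j"
        by (simp add: w_def vector_matrix_mult_def sum_distrib_left mult.commute)
      finally show ?thesis by simp
    qed
    also have "\<dots> = (\<Sum>m\<in>UNIV. E $ i $ m * (mat 1 $ m $ j + (if m = k then w $ j else 0)))"
    proof -
      have "(\<Sum>m\<in>UNIV. E $ i $ m * mat 1 $ m $ j) = E $ i $ j"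
        by (metis (no_types, lifting) matrix_matrix_mult_def matrix_mul_rid sum.cong vec_lambda_beta)
      moreover have "(\<Sum>m\<in>UNIV. E $ i $ m * (if m = k then w $ j else 0)) = u $ i * w $ j"
        by (simp add: if_distrib[of "(*) _"] Euk cong: if_cong)
      ultimately show ?thesis by (simp add: distrib_left sum.distrib)
    qed
    also have "\<dots> = (E ** transpose Y) $ i $ j"
    proof -
      have "transpose Y $ m $ j = mat 1 $ m $ j + (if m = k then w $ j else 0)" for m
        by (auto simp: transpose_def Y_def) (auto simp: mat_def axis_def)
      then show ?thesis by (simp add: matrix_matrix_mult_def)
    qed
    finally show ?thesis .
  qed
  then have "?X ** E = E ** transpose Y" by (simp add: vec_eq_iff)
  then have "det (?X ** E) = det (E ** transpose Y)" by (rule arg_cong)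
  then have "det ?X * det E = det E * det Y" by (simp only: det_mul det_transpose)
  then show ?thesis using dE dY wk k by simp
qed

subsection \<open>The regularized Gram matrix and ridge regression\<close>

lemma transpose_gram: "transpose (gram x t) = gram x t"
  by (induction t) (auto simp: transpose_def vec_eq_iff mat_def mult.commute)

lemma gram_Suc_mult: "gram x (Suc t) *v z = gram x t *v z + (x (Suc t) \<bullet> z) *\<^sub>R x (Suc t)"
  by (simp add: vec_eq_iff matrix_vector_mult_def inner_vec_def sum.distrib distrib_right
      sum_distrib_left sum_distrib_right algebra_simps)

lemma gram_mult: "gram x t *v z = z + (\<Sum>s\<in>{1..t}. (x s \<bullet> z) *\<^sub>R x s)"
  by (induction t) (simp_all add: gram_Suc_mult del: gram.simps(2))

lemma gram_quadratic_ge: "z \<bullet> z \<le> z \<bullet> (gram x t *v z)"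
  by (auto simp: gram_mult inner_add_right inner_sum_right inner_commute intro!: sum_nonneg)

lemma gram_symmetric: "(gram x t *v z) \<bullet> y = z \<bullet> (gram x t *v y)"
  by (metis transpose_gram dot_lmul_matrix transpose_matrix_vector)

lemma invertible_gram: "invertible (gram x t)"
proof -
  have "z = 0" if "gram x t *v z = 0" for z
    using gram_quadratic_ge[of z x t] that inner_ge_zero[of z] inner_eq_zero_iff[of z] by simp
  then show ?thesis
    by (simp add: invertible_left_inverse matrix_left_invertible_ker)
qed

lemma matrix_inv:
  assumes "invertible A"
  shows "matrix_inv A ** A = mat 1" "A ** matrix_inv A = mat 1"
  using assms someI_ex[of "\<lambda>A'. A ** A' = mat 1 \<and> A' ** A = mat 1"]
  by (auto simp: matrix_inv_def invertible_def)

text \<open>The inverse Gram matrix as a function. It is handled through linearity and the two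
  cancellation rules below, so that identities for it reduce to checking solutions of linear
  systems.\<close>

definition gram_solve :: "(nat \<Rightarrow> real^'n) \<Rightarrow> nat \<Rightarrow> real^'n \<Rightarrow> real^'n" where
  "gram_solve x t z = matrix_inv (gram x t) *v z"

lemma gram_gram_solve [simp]: "gram x t *v gram_solve x t z = z"
  using matrix_inv(2)[OF invertible_gram[of x t]]
  by (simp add: gram_solve_def matrix_vector_mul_assoc)

lemma gram_solve_gram [simp]: "gram_solve x t (gram x t *v z) = z"
  using matrix_inv(1)[OF invertible_gram[of x t]]
  by (simp add: gram_solve_def matrix_vector_mul_assoc)

lemma gram_solve_0 [simp]: "gram_solve x 0 z = z"
  using gram_gram_solve[of x 0 z] by simp

lemma gram_solve_add: "gram_solve x t (y + z) = gram_solve x t y + gram_solve x t z"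
  and gram_solve_scale: "gram_solve x t (c *\<^sub>R z) = c *\<^sub>R gram_solve x t z"
  and gram_solve_diff: "gram_solve x t (y - z) = gram_solve x t y - gram_solve x t z"
  by (simp_all add: gram_solve_def matrix_vector_right_distrib matrix_vector_mult_scaleR
      matrix_vector_mult_diff_distrib)

lemma gram_solve_symmetric: "gram_solve x t z \<bullet> y = z \<bullet> gram_solve x t y"
  using gram_symmetric[of x t "gram_solve x t z" "gram_solve x t y"] by simp

lemma gram_solve_quadratic_nonneg: "0 \<le> z \<bullet> gram_solve x t z"
  using order_trans[OF inner_ge_zero gram_quadratic_ge[of "gram_solve x t z" x t]]
  by (simp add: inner_commute)

text \<open>It suffices that the claimed vector solves the system with the updated matrix. The
  recursion drives both the one-step formula of the self-normalized process and the measurability of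
  the inverse.\<close>

lemma gram_solve_sherman_morrison:
  "gram_solve x (Suc t) z = gram_solve x t z -
     ((x (Suc t) \<bullet> gram_solve x t z) / (1 + x (Suc t) \<bullet> gram_solve x t (x (Suc t))))
       *\<^sub>R gram_solve x t (x (Suc t))"
proof -
  define v q k where "v = x (Suc t)" and "q = v \<bullet> gram_solve x t v"
    and "k = (v \<bullet> gram_solve x t z) / (1 + q)"
  have q: "q \<ge> 0" unfolding q_def by (rule gram_solve_quadratic_nonneg)
  have k: "v \<bullet> gram_solve x t z = k * (1 + q)" using q by (simp add: k_def)
  define y where "y = gram_solve x t z - k *\<^sub>R gram_solve x t v"
  have "gram x (Suc t) *v y = z"
    unfolding gram_Suc_mult v_def[symmetric] y_def
    by (simp add: matrix_vector_mult_diff_distrib matrix_vector_mult_scaleR inner_diff_right k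
        q_def[symmetric] algebra_simps)
  then show ?thesis
    using gram_solve_gram[of x "Suc t" y] by (simp add: y_def k_def q_def v_def)
qed

section \<open>The norm of the inverse Gram matrix and the elliptical potential\<close>

definition dual_norm :: "(nat \<Rightarrow> real^'n) \<Rightarrow> nat \<Rightarrow> real^'n \<Rightarrow> real" where
  "dual_norm x t z = sqrt (z \<bullet> gram_solve x t z)"

lemma dual_norm_nonneg [simp]: "0 \<le> dual_norm x t z"
  by (simp add: dual_norm_def gram_solve_quadratic_nonneg)

lemma dual_norm_square: "(dual_norm x t z)\<^sup>2 = z \<bullet> gram_solve x t z"
  by (simp add: dual_norm_def gram_solve_quadratic_nonneg)

lemma wnorm_gram_square: "(wnorm (gram x t) z)\<^sup>2 = z \<bullet> (gram x t *v z)"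
  using order_trans[OF inner_ge_zero gram_quadratic_ge[of z x t]]
  by (simp add: wnorm_def)

lemma wnorm_gram_nonneg [simp]: "0 \<le> wnorm (gram x t) z"
  using order_trans[OF inner_ge_zero gram_quadratic_ge[of z x t]]
  by (simp add: wnorm_def)

text \<open>Cauchy-Schwarz for a norm and its dual: the quadratic form at
  \<open>u - s *\<^sub>R gram_solve x t v\<close> is nonnegative for all \<open>s\<close>, and its
  discriminant gives the claim.\<close>

lemma inner_le_wnorm_dual_norm: "\<bar>u \<bullet> v\<bar> \<le> wnorm (gram x t) u * dual_norm x t v"
proof -
  define a b c where "a = u \<bullet> (gram x t *v u)" and "b = u \<bullet> v" and "c = v \<bullet> gram_solve x t v"
  have a: "a \<ge> 0" unfolding a_def by (metis wnorm_gram_square zero_le_power2)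
  have quad: "0 \<le> a - 2 * s * b + s\<^sup>2 * c" for s
  proof -
    define z where "z = u - s *\<^sub>R gram_solve x t v"
    have "0 \<le> z \<bullet> (gram x t *v z)" by (metis wnorm_gram_square zero_le_power2)
    also have "gram x t *v z = gram x t *v u - s *\<^sub>R v"
      by (simp add: z_def matrix_vector_mult_diff_distrib matrix_vector_mult_scaleR)
    also have "z \<bullet> (gram x t *v u - s *\<^sub>R v) = a - 2 * s * b + s\<^sup>2 * c"
      using gram_symmetric[of x t "gram_solve x t v" u]
      by (simp add: z_def a_def b_def c_def inner_diff_left inner_diff_right power2_eq_square
          inner_commute algebra_simps)
    finally show ?thesis .
  qed
  have c: "c \<ge> 0" unfolding c_def by (rule gram_solve_quadratic_nonneg)
  have "b\<^sup>2 \<le> a * c"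
  proof (cases "c = 0")
    case True
    have "b = 0"
    proof (rule ccontr)
      assume "b \<noteq> 0"
      then show False using quad[of "(a + 1) / (2 * b)"] True by simp
    qed
    then show ?thesis using True by simp
  next
    case False
    then show ?thesis using quad[of "b / c"] c
      by (simp add: power2_eq_square field_simps)
  qed
  then have "\<bar>b\<bar> \<le> sqrt (a * c)" by (simp add: real_le_rsqrt)
  then show ?thesis
    by (simp add: a_def b_def c_def wnorm_def dual_norm_def real_sqrt_mult)
qed

lemma dual_norm_add_le: "dual_norm x t (y + z) \<le> dual_norm x t y + dual_norm x t z"
proof (rule power2_le_imp_le)
  have "y \<bullet> gram_solve x t z \<le> \<bar>gram_solve x t y \<bullet> z\<bar>" by (simp add: gram_solve_symmetric)
  also have "\<dots> \<le> dual_norm x t y * dual_norm x t z"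
    using inner_le_wnorm_dual_norm[of "gram_solve x t y" z x t]
    by (simp add: wnorm_def dual_norm_def inner_commute)
  finally show "(dual_norm x t (y + z))\<^sup>2 \<le> (dual_norm x t y + dual_norm x t z)\<^sup>2"
    using gram_solve_symmetric[of x t y z]
    by (simp add: dual_norm_square power2_sum gram_solve_add inner_add_left inner_add_right inner_commute)
qed simp

lemma dual_norm_minus: "dual_norm x t (- z) = dual_norm x t z"
  using gram_solve_scale[of x t "-1" z] by (simp add: dual_norm_def)

text \<open>The Gram matrix dominates the identity, so its inverse is a contraction.\<close>

lemma dual_norm_le_norm: "dual_norm x t z \<le> norm z"
proof -
  define y where "y = gram_solve x t z"
  have 1: "y \<bullet> y \<le> y \<bullet> z"
    using gram_quadratic_ge[of y x t] by (simp add: y_def)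
  also have "\<dots> \<le> norm y * norm z" by (rule norm_cauchy_schwarz)
  finally have "norm y \<le> norm z"
    by (cases "y = 0") (auto simp: power2_norm_eq_inner[symmetric] power2_eq_square)
  then have "norm y * norm z \<le> norm z * norm z" by (simp add: mult_right_mono)
  moreover have "z \<bullet> y \<le> norm z * norm y" by (rule norm_cauchy_schwarz)
  ultimately have "z \<bullet> y \<le> (norm z)\<^sup>2" by (simp add: power2_eq_square mult.commute)
  then show ?thesis
    unfolding dual_norm_def y_def[symmetric] by (simp add: real_le_lsqrt)
qed

text \<open>Each update factors as the old matrix times the identity plus a rank-one matrix, to
  which \<open>det_identity_plus_outer\<close> applies.\<close>

lemma det_gram: "det (gram x t) = (\<Prod>s\<in>{1..t}. 1 + (dual_norm x (s - 1) (x s))\<^sup>2)"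
proof (induction t)
  case (Suc t)
  let ?v = "x (Suc t)"
  have "gram x t ** (mat 1 + (\<chi> i j. gram_solve x t ?v $ i * ?v $ j)) = gram x (Suc t)"
  proof -
    have "gram x t ** (\<chi> i j. gram_solve x t ?v $ i * ?v $ j)
        = (\<chi> i j. (gram x t *v gram_solve x t ?v) $ i * ?v $ j)"
      unfolding matrix_matrix_mult_def matrix_vector_mult_def
      by (simp add: vec_eq_iff sum_distrib_right mult.assoc)
    then show ?thesis by (simp add: matrix_add_ldistrib)
  qed
  then have "det (gram x (Suc t)) = det (gram x t) * (1 + gram_solve x t ?v \<bullet> ?v)"
    by (metis det_mul det_identity_plus_outer)
  then show ?case
    using Suc by (simp add: dual_norm_square inner_commute del: gram.simps)
qed simp

lemma trace_gram: "trace (gram (x :: nat \<Rightarrow> real^'n) t) = CARD('n) + (\<Sum>s\<in>{1..t}. (norm (x s))\<^sup>2)"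
proof (induction t)
  case (Suc t)
  have "trace (gram x (Suc t)) = trace (gram x t) + (norm (x (Suc t)))\<^sup>2"
    by (simp add: trace_def sum.distrib power2_norm_eq_inner inner_vec_def)
  with Suc show ?case by (simp del: gram.simps)
qed (simp add: trace_def mat_def)

lemma elliptical_potential:
  fixes x :: "nat \<Rightarrow> real^'n"
  assumes "\<And>s. s \<in> {1..t} \<Longrightarrow> norm (x s) \<le> 1"
  shows "(\<Prod>s\<in>{1..t}. 1 + (dual_norm x (s - 1) (x s))\<^sup>2)
           \<le> ((real CARD('n) + real t) / real CARD('n)) ^ CARD('n)"
proof -
  \<comment> \<open>The trace bound divided by the dimension, the scale at which the exponential
    factor of \<open>det_le_exp_trace\<close> is at most 1.\<close>
  define c where "c = (real CARD('n) + real t) / real CARD('n)"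
  have c: "c > 0" by (simp add: c_def add_pos_nonneg)
  have "det (gram x t) \<le> c ^ CARD('n) * exp (trace (gram x t) / c - CARD('n))"
    by (rule det_le_exp_trace[OF transpose_gram _ c]) (metis wnorm_gram_square zero_le_power2)
  also have "trace (gram x t) \<le> CARD('n) + real t"
  proof -
    have "(\<Sum>s\<in>{1..t}. (norm (x s))\<^sup>2) \<le> (\<Sum>s\<in>{1..t}. 1)"
      using assms by (intro sum_mono) (simp add: power_le_one)
    then show ?thesis by (simp add: trace_gram)
  qed
  then have "trace (gram x t) / c - CARD('n) \<le> 0"
    using c mult_left_mono[of "trace (gram x t)" "CARD('n) + real t" "real CARD('n)"]
    by (simp add: c_def field_simps)
  then have "c ^ CARD('n) * exp (trace (gram x t) / c - CARD('n)) \<le> c ^ CARD('n)"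
    using c by (simp add: mult_le_cancel_left1 zero_less_power)
  finally show ?thesis by (simp add: det_gram c_def)
qed

lemma sum_ln_potential:
  fixes x :: "nat \<Rightarrow> real^'n"
  assumes "\<And>s. s \<in> {1..t} \<Longrightarrow> norm (x s) \<le> 1"
  shows "(\<Sum>s\<in>{1..t}. ln (1 + (dual_norm x (s - 1) (x s))\<^sup>2))
           \<le> real CARD('n) * ln ((real CARD('n) + real t) / real CARD('n))"
proof -
  have pos: "0 < 1 + (dual_norm x (s - 1) (x s))\<^sup>2" for s by (simp add: add_pos_nonneg)
  have "(\<Sum>s\<in>{1..t}. ln (1 + (dual_norm x (s - 1) (x s))\<^sup>2))
      = ln (\<Prod>s\<in>{1..t}. 1 + (dual_norm x (s - 1) (x s))\<^sup>2)"
    using pos by (subst ln_prod) (auto simp: less_imp_neq[symmetric])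
  also have "\<dots> \<le> ln (((real CARD('n) + real t) / real CARD('n)) ^ CARD('n))"
    using elliptical_potential[of t x] assms pos
    by (subst ln_le_cancel_iff) (auto intro!: prod_pos zero_less_power divide_pos_pos add_pos_nonneg)
  finally show ?thesis
    by (simp add: ln_realpow add_pos_nonneg)
qed

section \<open>Error of the ridge estimate and optimism of the truncated index\<close>

lemma theta_hat_error:
  assumes y: "\<And>s. s \<in> {1..t} \<Longrightarrow> y s = \<theta> \<bullet> x s + n s"
  shows "wnorm (gram x t) (\<theta> - theta_hat x y t)
           \<le> dual_norm x t (\<Sum>s\<in>{1..t}. n s *\<^sub>R x s) + norm \<theta>"
proof -
  define S where "S = (\<Sum>s\<in>{1..t}. n s *\<^sub>R x s)"
  have "(\<Sum>s\<in>{1..t}. y s *\<^sub>R x s) = gram x t *v \<theta> - \<theta> + S"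
    using y by (simp add: gram_mult S_def scaleR_add_left sum.distrib inner_commute)
  \<comment> \<open>The term \<open>- \<theta>\<close> is the bias of the unit regularization; it
    accounts for the summand \<open>m\<close> in the radius.\<close>
  then have "theta_hat x y t = \<theta> + gram_solve x t (S - \<theta>)"
    unfolding theta_hat_def gram_solve_def[symmetric]
    by (simp add: gram_solve_add gram_solve_diff)
  then have "wnorm (gram x t) (\<theta> - theta_hat x y t) = dual_norm x t (S - \<theta>)"
    using matrix_vector_mult_scaleR[of "gram x t" "-1"]
    by (simp add: wnorm_def dual_norm_def inner_commute inner_diff_left inner_diff_right)
  also have "\<dots> \<le> dual_norm x t S + dual_norm x t \<theta>"
    using dual_norm_add_le[of x t S "- \<theta>"] by (simp add: dual_norm_minus)
  also have "\<dots> \<le> dual_norm x t S + norm \<theta>" by (simp add: dual_norm_le_norm)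
  finally show ?thesis by (simp add: S_def)
qed

text \<open>The amount by which \<theta> misses the confidence ellipsoid, measured in its own norm.
  It is a quantitative substitute for the event that the set is valid: with it the estimates for
  \<open>r_hat\<close> hold on every path.\<close>

definition conf_excess ::
  "real \<Rightarrow> nat \<Rightarrow> (nat \<Rightarrow> real^'n) \<Rightarrow> (nat \<Rightarrow> real) \<Rightarrow> real^'n \<Rightarrow> nat \<Rightarrow> real" where
  "conf_excess m T x y \<theta> t =
     max 0 (wnorm (gram x (t - 1)) (\<theta> - theta_hat x y (t - 1)) - sqrt_beta m T CARD('n) t)"

lemma
  fixes x :: "nat \<Rightarrow> real^'n"
  assumes \<beta>: "0 \<le> sqrt_beta m T CARD('n) t"
  shows r_hat_ge: "norm v \<le> 1 \<Longrightarrow> \<theta> \<bullet> v \<le> 1 \<Longrightarrow> \<theta> \<bullet> v - conf_excess m T x y \<theta> t \<le> r_hat m T x y t v"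
    and r_hat_le: "r_hat m T x y t v \<le> \<theta> \<bullet> v
         + (2 * sqrt_beta m T CARD('n) t + conf_excess m T x y \<theta> t) * dual_norm x (t - 1) v"
    and r_hat_le_1: "r_hat m T x y t v \<le> 1"
proof -
  define b e h Z where "b = sqrt_beta m T CARD('n) t" and "e = conf_excess m T x y \<theta> t"
    and "h = theta_hat x y (t - 1)" and "Z = wnorm (gram x (t - 1)) (\<theta> - h)"
  define C where "C = conf_set m T x y t"
  have C: "\<xi> \<in> C \<longleftrightarrow> wnorm (gram x (t - 1)) (\<xi> - h) \<le> b" for \<xi>
    by (simp add: C_def conf_set_def b_def h_def)
  have e: "e = max 0 (Z - b)" by (simp add: e_def conf_excess_def Z_def b_def h_def)
  have b: "b \<ge> 0" using \<beta> by (simp add: b_def)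
  have Z0: "Z \<ge> 0" by (simp add: Z_def)
  let ?D = "dual_norm x (t - 1) v"
  have "h \<in> C" using b by (simp add: C wnorm_def)
  have upper: "\<xi> \<bullet> v \<le> h \<bullet> v + b * ?D" if "\<xi> \<in> C" for \<xi>
  proof -
    have "\<xi> \<bullet> v - h \<bullet> v \<le> wnorm (gram x (t - 1)) (\<xi> - h) * ?D"
      using inner_le_wnorm_dual_norm[of "\<xi> - h" v x "t - 1"] by (simp add: inner_diff_left)
    also have "\<dots> \<le> b * ?D" using that by (intro mult_right_mono) (auto simp: C)
    finally show ?thesis by simp
  qed
  then have bdd: "bdd_above ((\<lambda>\<xi>. \<xi> \<bullet> v) ` C)" by (auto intro!: bdd_aboveI)
  have sup: "(SUP \<xi>\<in>C. \<xi> \<bullet> v) \<le> h \<bullet> v + b * ?D"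
    using \<open>h \<in> C\<close> upper by (intro cSUP_least) auto
  have "h \<bullet> v \<le> \<theta> \<bullet> v + Z * ?D"
    using inner_le_wnorm_dual_norm[of "\<theta> - h" v x "t - 1"] by (simp add: inner_diff_left Z_def)
  also have "\<dots> \<le> \<theta> \<bullet> v + (b + e) * ?D"
    by (intro add_left_mono mult_right_mono) (auto simp: e)
  finally show "r_hat m T x y t v \<le> \<theta> \<bullet> v + (2 * sqrt_beta m T CARD('n) t + conf_excess m T x y \<theta> t) * ?D"
    using sup unfolding r_hat_def C_def[symmetric] b_def[symmetric] e_def[symmetric]
    by (simp add: algebra_simps)
  show "r_hat m T x y t v \<le> 1" by (simp add: r_hat_def)
  show "\<theta> \<bullet> v - conf_excess m T x y \<theta> t \<le> r_hat m T x y t v" if v: "norm v \<le> 1" and r: "\<theta> \<bullet> v \<le> 1"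
  proof -
    have D1: "?D \<le> 1" using dual_norm_le_norm[of x "t - 1" v] v by linarith
    \<comment> \<open>The largest fraction of the segment from the center \<open>h\<close> to
      \<open>\<theta>\<close> that stays in the ellipsoid; its endpoint \<open>\<xi>\<close> is a
      member whose distance to \<open>\<theta>\<close> is exactly the excess
      \<open>e\<close>.\<close>
    define k where "k = (if Z \<le> b then 1 else b / Z)"
    have k: "0 \<le> k" "k \<le> 1" "k * Z \<le> b" "(1 - k) * Z = e"
      using b Z0 by (auto simp: k_def e field_simps)
    define \<xi> where "\<xi> = h + k *\<^sub>R (\<theta> - h)"
    have "wnorm (gram x (t - 1)) (\<xi> - h) = k * Z"
      using k by (simp add: \<xi>_def wnorm_def Z_def matrix_vector_mult_scaleR real_sqrt_mult)
    then have "\<xi> \<in> C" using k by (simp add: C)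
    then have 1: "\<xi> \<bullet> v \<le> (SUP \<xi>\<in>C. \<xi> \<bullet> v)" using bdd by (rule cSUP_upper)
    have "\<theta> \<bullet> v - \<xi> \<bullet> v = (1 - k) * ((\<theta> - h) \<bullet> v)"
      by (simp add: \<xi>_def inner_add_left inner_diff_left algebra_simps)
    also have "\<dots> \<le> (1 - k) * (Z * ?D)"
      using inner_le_wnorm_dual_norm[of "\<theta> - h" v x "t - 1"] k
      by (intro mult_left_mono) (auto simp: Z_def)
    also have "\<dots> = e * ?D" using k(4) by (simp add: mult.assoc[symmetric])
    also have "\<dots> \<le> e" using D1 by (simp add: e mult_left_le)
    finally have "\<theta> \<bullet> v - e \<le> (SUP \<xi>\<in>C. \<xi> \<bullet> v)" using 1 by simp
    moreover have "\<theta> \<bullet> v - e \<le> 1" using r by (simp add: e)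
    ultimately show ?thesis unfolding r_hat_def C_def[symmetric] e_def[symmetric] by simp
  qed
qed

subsection \<open>Conditionally subgaussian noise\<close>

text \<open>Completing the square turns the integrand into a multiple of the normal density with
  mean \<open>s / (1 - k)\<close> and variance \<open>1 / (1 - k)\<close>; the condition
  \<open>k < 1\<close> keeps that variance positive.\<close>

lemma nn_integral_std_normal_exp_quadratic:
  fixes u s k :: real
  assumes k: "k < 1"
  shows "(\<integral>\<^sup>+g. ennreal (std_normal_density g) * ennreal (exp (u + s * g + k * g\<^sup>2 / 2)) \<partial>lborel)
       = ennreal (exp (u + s\<^sup>2 / (2 * (1 - k))) / sqrt (1 - k))"
proof -
  define \<sigma> \<mu> c where "\<sigma> = 1 / sqrt (1 - k)" and "\<mu> = s / (1 - k)"
    and "c = exp (u + s\<^sup>2 / (2 * (1 - k))) / sqrt (1 - k)"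
  have \<sigma>: "\<sigma> > 0" "\<sigma>\<^sup>2 = 1 / (1 - k)" using k by (auto simp: \<sigma>_def power_divide)
  have c: "c \<ge> 0" using k by (simp add: c_def)
  have "std_normal_density g * exp (u + s * g + k * g\<^sup>2 / 2) = c * normal_density \<mu> \<sigma> g" for g
  proof -
    have "- g\<^sup>2 / 2 + (u + s * g + k * g\<^sup>2 / 2) = u + s\<^sup>2 / (2 * (1 - k)) + - (g - \<mu>)\<^sup>2 / (2 * \<sigma>\<^sup>2)"
    proof -
      have "- (g - s / h)\<^sup>2 / (2 * (1 / h)) = g * s - h * g\<^sup>2 / 2 - s\<^sup>2 / (2 * h)" if "h > 0" for h :: real
        using that by (simp add: power2_eq_square field_simps)
      from this[of "1 - k"] k show ?thesis
        unfolding \<sigma>(2) \<mu>_def by (simp add: algebra_simps add_divide_distrib diff_divide_distrib)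
    qed
    moreover have "sqrt (1 - k) * sqrt (2 * pi * \<sigma>\<^sup>2) = sqrt (2 * pi)"
      using k unfolding \<sigma>(2) real_sqrt_mult[symmetric] by simp
    ultimately show ?thesis
      using k unfolding normal_density_def c_def
      by (simp add: exp_add[symmetric] divide_simps mult_ac)
  qed
  then have "(\<integral>\<^sup>+g. ennreal (std_normal_density g) * ennreal (exp (u + s * g + k * g\<^sup>2 / 2)) \<partial>lborel)
      = (\<integral>\<^sup>+g. ennreal c * ennreal (normal_density \<mu> \<sigma> g) \<partial>lborel)"
    using c by (simp add: ennreal_mult''[symmetric])
  also have "\<dots> = ennreal c * (\<integral>\<^sup>+g. ennreal (normal_density \<mu> \<sigma> g) \<partial>lborel)"
    by (rule nn_integral_cmult) simp
  also have "(\<integral>\<^sup>+g. ennreal (normal_density \<mu> \<sigma> g) \<partial>lborel) = 1"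
    using \<sigma> by (subst nn_integral_eq_integral)
      (auto simp: integral_normal_density[of \<sigma> \<mu>])
  finally show ?thesis by (simp add: c_def)
qed

lemma (in prob_space) sigma_finite_subalgebraI:
  assumes "subalgebra M G"
  shows "sigma_finite_subalgebra M G"
  by (rule finite_measure_subalgebra_is_sigma_finite)
     (simp add: finite_measure_subalgebra_def finite_measure_subalgebra_axioms_def assms finite_measure_axioms)

context prob_space
begin

context
  fixes G :: "'a measure" and X :: "'a \<Rightarrow> real"
  assumes G: "subalgebra M G"
    and X_meas [measurable]: "X \<in> borel_measurable M"
    and X_subg: "cond_subgaussian 1 M G X"
begin

text \<open>The conditional bound is tested against an arbitrary weight \<open>Z\<close>. In this
  form, with integrals of nonnegative extended reals, no integrability has to be carried along when
  the multiplier \<open>l\<close> becomes random.\<close>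

lemma cond_subgaussian_const:
  assumes Z [measurable]: "Z \<in> borel_measurable G"
  shows "(\<integral>\<^sup>+\<omega>. Z \<omega> * ennreal (exp (l * X \<omega>)) \<partial>M) \<le> (\<integral>\<^sup>+\<omega>. Z \<omega> * ennreal (exp (l\<^sup>2 / 2)) \<partial>M)"
proof -
  interpret sigma_finite_subalgebra M G by (rule sigma_finite_subalgebraI[OF G])
  define g where "g = (\<lambda>\<omega>. exp (l * X \<omega>))"
  have g [measurable]: "g \<in> borel_measurable M" unfolding g_def by measurable
  have int: "integrable M g" and le: "AE \<omega> in M. real_cond_exp M G g \<omega> \<le> exp (l\<^sup>2 / 2)"
    using X_subg by (auto simp: cond_subgaussian_def g_def)
  have "(\<integral>\<^sup>+\<omega>. 1 * nn_cond_exp M G (\<lambda>\<omega>. ennreal (g \<omega>)) \<omega> \<partial>M) = (\<integral>\<^sup>+\<omega>. 1 * ennreal (g \<omega>) \<partial>M)"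
    by (rule nn_cond_exp_intg) auto
  also have "\<dots> \<noteq> \<infinity>"
    using int nn_integral_eq_integral[OF int] by (simp add: g_def)
  finally have fin: "AE \<omega> in M. nn_cond_exp M G (\<lambda>\<omega>. ennreal (g \<omega>)) \<omega> \<noteq> \<infinity>"
    by (intro nn_integral_PInf_AE) auto
  \<comment> \<open>The negative part of the exponential is zero, so \<open>real_cond_exp\<close> is
    the real value of a conditional expectation that is finite almost everywhere.\<close>
  have "AE \<omega> in M. (0::ennreal) = nn_cond_exp M G (\<lambda>_. 0) \<omega>"
    by (rule nn_cond_exp_F_meas) simp
  then have zero: "AE \<omega> in M. nn_cond_exp M G (\<lambda>\<omega>. ennreal (- g \<omega>)) \<omega> = 0"
    by (simp add: g_def ennreal_neg)
  have bound: "AE \<omega> in M. nn_cond_exp M G (\<lambda>\<omega>. ennreal (g \<omega>)) \<omega> \<le> ennreal (exp (l\<^sup>2 / 2))"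
    using le fin zero
  proof eventually_elim
    case (elim \<omega>)
    then show ?case
      by (simp add: real_cond_exp_def) (metis ennreal_enn2real ennreal_leI top.not_eq_extremum)
  qed
  have "(\<integral>\<^sup>+\<omega>. Z \<omega> * ennreal (g \<omega>) \<partial>M) = (\<integral>\<^sup>+\<omega>. Z \<omega> * nn_cond_exp M G (\<lambda>\<omega>. ennreal (g \<omega>)) \<omega> \<partial>M)"
    by (rule nn_cond_exp_intg[symmetric]) auto
  also have "\<dots> \<le> (\<integral>\<^sup>+\<omega>. Z \<omega> * ennreal (exp (l\<^sup>2 / 2)) \<partial>M)"
    using bound by (intro nn_integral_mono_AE) (auto elim!: eventually_mono intro: mult_left_mono)
  finally show ?thesis by (simp add: g_def)
qed

text \<open>On each level set of \<open>l\<close> the multiplier is constant, and the indicator of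
  the level set joins the weight.\<close>

lemma cond_subgaussian_simple:
  assumes Z [measurable]: "Z \<in> borel_measurable G" and l: "simple_function G l"
  shows "(\<integral>\<^sup>+\<omega>. Z \<omega> * ennreal (exp (l \<omega> * X \<omega>)) \<partial>M) \<le> (\<integral>\<^sup>+\<omega>. Z \<omega> * ennreal (exp ((l \<omega>)\<^sup>2 / 2)) \<partial>M)"
proof -
  have sp: "space G = space M" using G by (simp add: subalgebra_def)
  define V where "V = l ` space M"
  have V: "finite V" using l by (simp add: simple_function_def V_def sp)
  have l_meas [measurable]: "l \<in> borel_measurable G" by (rule borel_measurable_simple_function[OF l])
  have lM [measurable]: "l \<in> borel_measurable M" by (rule measurable_from_subalg[OF G l_meas])
  have ZM [measurable]: "Z \<in> borel_measurable M" by (rule measurable_from_subalg[OF G Z])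
  define I where "I v = (\<lambda>\<omega>. indicator {v} (l \<omega>) * Z \<omega>)" for v
  have [measurable]: "I v \<in> borel_measurable G" for v unfolding I_def by measurable
  have IM [measurable]: "I v \<in> borel_measurable M" for v unfolding I_def by measurable
  have split: "Z \<omega> * ennreal (h (l \<omega>) \<omega>) = (\<Sum>v\<in>V. I v \<omega> * ennreal (h v \<omega>))" if "\<omega> \<in> space M" for \<omega> h
  proof -
    have "(\<Sum>v\<in>V. I v \<omega> * ennreal (h v \<omega>)) = (\<Sum>v\<in>V. if v = l \<omega> then Z \<omega> * ennreal (h v \<omega>) else 0)"
      by (intro sum.cong) (auto simp: I_def)
    then show ?thesis using V that by (simp add: V_def)
  qed
  have "(\<integral>\<^sup>+\<omega>. Z \<omega> * ennreal (exp (l \<omega> * X \<omega>)) \<partial>M)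
      = (\<integral>\<^sup>+\<omega>. (\<Sum>v\<in>V. I v \<omega> * ennreal (exp (v * X \<omega>))) \<partial>M)"
    by (intro nn_integral_cong) (rule split)
  also have "\<dots> = (\<Sum>v\<in>V. \<integral>\<^sup>+\<omega>. I v \<omega> * ennreal (exp (v * X \<omega>)) \<partial>M)"
    by (intro nn_integral_sum) measurable
  also have "\<dots> \<le> (\<Sum>v\<in>V. \<integral>\<^sup>+\<omega>. I v \<omega> * ennreal (exp (v\<^sup>2 / 2)) \<partial>M)"
    by (intro sum_mono cond_subgaussian_const) measurable
  also have "\<dots> = (\<integral>\<^sup>+\<omega>. (\<Sum>v\<in>V. I v \<omega> * ennreal (exp (v\<^sup>2 / 2))) \<partial>M)"
    by (intro nn_integral_sum[symmetric]) measurable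
  also have "\<dots> = (\<integral>\<^sup>+\<omega>. Z \<omega> * ennreal (exp ((l \<omega>)\<^sup>2 / 2)) \<partial>M)"
    by (intro nn_integral_cong) (rule split[symmetric])
  finally show ?thesis .
qed

text \<open>Simple functions increasing to \<open>\<bar>l\<bar>\<close>, multiplied by the sign of
  \<open>l\<close>, converge to \<open>l\<close> and never exceed it in square. The right-hand side
  is thus bounded uniformly, and Fatou's lemma handles the left-hand side.\<close>

lemma cond_subgaussian_random:
  assumes Z [measurable]: "Z \<in> borel_measurable G" and l [measurable]: "l \<in> borel_measurable G"
  shows "(\<integral>\<^sup>+\<omega>. Z \<omega> * ennreal (exp (l \<omega> * X \<omega>)) \<partial>M) \<le> (\<integral>\<^sup>+\<omega>. Z \<omega> * ennreal (exp ((l \<omega>)\<^sup>2 / 2)) \<partial>M)"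
proof -
  have ZM [measurable]: "Z \<in> borel_measurable M" by (rule measurable_from_subalg[OF G Z])
  obtain f :: "nat \<Rightarrow> 'a \<Rightarrow> real" where f: "incseq f" "\<And>i. simple_function G (f i)"
      "\<And>\<omega>. bdd_above (range (\<lambda>i. f i \<omega>))" "\<And>i \<omega>. 0 \<le> f i \<omega>" "(\<lambda>\<omega>. \<bar>l \<omega>\<bar>) = (SUP i. f i)"
    using borel_measurable_implies_simple_function_sequence_real[of "\<lambda>\<omega>. \<bar>l \<omega>\<bar>" G] by auto
  have "simple_function G (\<lambda>\<omega>. sgn (l \<omega>))"
    by (rule simple_function_borel_measurable)
       (auto intro!: finite_subset[of _ "{-1, 0, 1}"] simp: sgn_if)
  then have simple: "simple_function G (\<lambda>\<omega>. sgn (l \<omega>) * f i \<omega>)" for i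
    using f(2) by (intro simple_function_mult)
  have sup: "(SUP i. f i \<omega>) = \<bar>l \<omega>\<bar>" for \<omega>
    using fun_cong[OF f(5), of \<omega>] by (simp add: image_comp comp_def)
  have lim: "(\<lambda>i. sgn (l \<omega>) * f i \<omega>) \<longlonglongrightarrow> l \<omega>" for \<omega>
  proof -
    have "(\<lambda>i. f i \<omega>) \<longlonglongrightarrow> (SUP i. f i \<omega>)"
      using f(1,3) by (intro LIMSEQ_incseq_SUP) (auto simp: incseq_def le_fun_def)
    then show ?thesis
      by (metis sup mult_sgn_abs tendsto_mult_left)
  qed
  have le: "(sgn (l \<omega>) * f i \<omega>)\<^sup>2 \<le> (l \<omega>)\<^sup>2" for i \<omega>
  proof -
    have "f i \<omega> \<le> (SUP i. f i \<omega>)" using f(3) by (rule cSUP_upper[OF UNIV_I])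
    then have "f i \<omega> \<le> \<bar>l \<omega>\<bar>" using sup by simp
    then have "\<bar>sgn (l \<omega>) * f i \<omega>\<bar> \<le> \<bar>l \<omega>\<bar>" using f(4)[of i \<omega>] by (auto simp: abs_mult abs_sgn_eq)
    then show ?thesis by (simp add: abs_le_square_iff)
  qed
  have "(\<integral>\<^sup>+\<omega>. Z \<omega> * ennreal (exp (l \<omega> * X \<omega>)) \<partial>M)
      = (\<integral>\<^sup>+\<omega>. liminf (\<lambda>i. Z \<omega> * ennreal (exp (sgn (l \<omega>) * f i \<omega> * X \<omega>))) \<partial>M)"
  proof (intro nn_integral_cong)
    fix \<omega>
    have "(\<lambda>i. ennreal (exp (sgn (l \<omega>) * f i \<omega> * X \<omega>))) \<longlonglongrightarrow> ennreal (exp (l \<omega> * X \<omega>))"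
      by (intro tendsto_ennrealI tendsto_intros lim)
    then have "(\<lambda>i. Z \<omega> * ennreal (exp (sgn (l \<omega>) * f i \<omega> * X \<omega>))) \<longlonglongrightarrow> Z \<omega> * ennreal (exp (l \<omega> * X \<omega>))"
      by (intro tendsto_mult_ennreal) auto
    then show "Z \<omega> * ennreal (exp (l \<omega> * X \<omega>)) = liminf (\<lambda>i. Z \<omega> * ennreal (exp (sgn (l \<omega>) * f i \<omega> * X \<omega>)))"
      by (intro lim_imp_Liminf[symmetric]) auto
  qed
  also have "\<dots> \<le> liminf (\<lambda>i. \<integral>\<^sup>+\<omega>. Z \<omega> * ennreal (exp (sgn (l \<omega>) * f i \<omega> * X \<omega>)) \<partial>M)"
  proof (rule nn_integral_liminf)
    fix i
    have [measurable]: "(\<lambda>\<omega>. sgn (l \<omega>) * f i \<omega>) \<in> borel_measurable M"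
      by (rule measurable_from_subalg[OF G borel_measurable_simple_function[OF simple]])
    show "(\<lambda>\<omega>. Z \<omega> * ennreal (exp (sgn (l \<omega>) * f i \<omega> * X \<omega>))) \<in> borel_measurable M" by measurable
  qed
  also have "\<dots> \<le> liminf (\<lambda>i. \<integral>\<^sup>+\<omega>. Z \<omega> * ennreal (exp ((l \<omega>)\<^sup>2 / 2)) \<partial>M)"
  proof (intro Liminf_mono always_eventually allI)
    fix i
    have "(\<integral>\<^sup>+\<omega>. Z \<omega> * ennreal (exp (sgn (l \<omega>) * f i \<omega> * X \<omega>)) \<partial>M)
        \<le> (\<integral>\<^sup>+\<omega>. Z \<omega> * ennreal (exp ((sgn (l \<omega>) * f i \<omega>)\<^sup>2 / 2)) \<partial>M)"
      by (rule cond_subgaussian_simple[OF Z simple])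
    also have "\<dots> \<le> (\<integral>\<^sup>+\<omega>. Z \<omega> * ennreal (exp ((l \<omega>)\<^sup>2 / 2)) \<partial>M)"
      using le by (intro nn_integral_mono mult_left_mono ennreal_leI) auto
    finally show "(\<integral>\<^sup>+\<omega>. Z \<omega> * ennreal (exp (sgn (l \<omega>) * f i \<omega> * X \<omega>)) \<partial>M)
        \<le> (\<integral>\<^sup>+\<omega>. Z \<omega> * ennreal (exp ((l \<omega>)\<^sup>2 / 2)) \<partial>M)" .
  qed
  also have "\<dots> = (\<integral>\<^sup>+\<omega>. Z \<omega> * ennreal (exp ((l \<omega>)\<^sup>2 / 2)) \<partial>M)" by (simp add: Liminf_const)
  finally show ?thesis .
qed

text \<open>A standard normal variable \<open>g\<close> linearizes the square: \<open>exp (c X\<^sup>2 / 2)\<close> is the mean of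
  \<open>exp (sqrt c * g * X)\<close> over \<open>g\<close>, to which the subgaussian bound applies for each \<open>g\<close>.\<close>

lemma cond_subgaussian_quadratic:
  assumes Z [measurable]: "Z \<in> borel_measurable G" and a [measurable]: "a \<in> borel_measurable G"
    and q [measurable]: "q \<in> borel_measurable G" and q0: "\<And>\<omega>. q \<omega> \<ge> 0"
  shows "(\<integral>\<^sup>+\<omega>. Z \<omega> * ennreal (exp ((2 * X \<omega> * a \<omega> + (X \<omega>)\<^sup>2 * q \<omega> - (a \<omega>)\<^sup>2) / (2 * (1 + q \<omega>)))
            / sqrt (1 + q \<omega>)) \<partial>M) \<le> (\<integral>\<^sup>+\<omega>. Z \<omega> \<partial>M)"
proof -
  have [measurable]: "Z \<in> borel_measurable M" "a \<in> borel_measurable M" "q \<in> borel_measurable M"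
    using Z a q by (auto intro: measurable_from_subalg[OF G])
  \<comment> \<open>Chosen so that \<open>k\<close> times
    \<open>exp (b * X + c * X\<^sup>2 / 2)\<close> is the factor in the claim; \<open>c < 1\<close>
    makes the Gaussian integral of the upper bound converge as well.\<close>
  define b c k where "b \<omega> = a \<omega> / (1 + q \<omega>)" and "c \<omega> = q \<omega> / (1 + q \<omega>)"
    and "k \<omega> = exp (- (a \<omega>)\<^sup>2 / (2 * (1 + q \<omega>))) / sqrt (1 + q \<omega>)" for \<omega>
  have [measurable]: "b \<in> borel_measurable G" "c \<in> borel_measurable G" "k \<in> borel_measurable G"
    unfolding b_def c_def k_def by measurable
  have [measurable]: "b \<in> borel_measurable M" "c \<in> borel_measurable M" "k \<in> borel_measurable M"
    unfolding b_def c_def k_def by measurable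
  have q1: "1 + q \<omega> > 0" for \<omega> using q0[of \<omega>] by linarith
  have k0: "k \<omega> \<ge> 0" and c0: "c \<omega> \<ge> 0" and c1: "c \<omega> < 1" for \<omega>
    using q0[of \<omega>] by (auto simp: k_def c_def)
  let ?\<phi> = "\<lambda>g. ennreal (std_normal_density g)"
  define l where "l g \<omega> = b \<omega> + sqrt (c \<omega>) * g" for g \<omega>
  have lG [measurable]: "l g \<in> borel_measurable G" for g unfolding l_def by measurable
  interpret P: pair_sigma_finite M lborel by standard
  have int1: "(\<integral>\<^sup>+g. ?\<phi> g * ennreal (exp (l g \<omega> * X \<omega>)) \<partial>lborel) = ennreal (exp (b \<omega> * X \<omega> + c \<omega> * (X \<omega>)\<^sup>2 / 2))" for \<omega>
    using nn_integral_std_normal_exp_quadratic[of 0 "b \<omega> * X \<omega>" "sqrt (c \<omega>) * X \<omega>"] c0[of \<omega>]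
    by (simp add: l_def power_mult_distrib algebra_simps)
  have int2: "(\<integral>\<^sup>+g. ?\<phi> g * ennreal (exp ((l g \<omega>)\<^sup>2 / 2)) \<partial>lborel)
      = ennreal (exp ((a \<omega>)\<^sup>2 / (2 * (1 + q \<omega>))) * sqrt (1 + q \<omega>))" for \<omega>
  proof -
    have c': "1 - c \<omega> = 1 / (1 + q \<omega>)" using q1[of \<omega>] by (simp add: c_def field_simps)
    have "(l g \<omega>)\<^sup>2 / 2 = (b \<omega>)\<^sup>2 / 2 + (b \<omega> * sqrt (c \<omega>)) * g + c \<omega> * g\<^sup>2 / 2" for g
      using c0[of \<omega>] by (simp add: l_def power2_eq_square algebra_simps add_divide_distrib)
    then have "(\<integral>\<^sup>+g. ?\<phi> g * ennreal (exp ((l g \<omega>)\<^sup>2 / 2)) \<partial>lborel)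
        = ennreal (exp ((b \<omega>)\<^sup>2 / 2 + (b \<omega> * sqrt (c \<omega>))\<^sup>2 / (2 * (1 - c \<omega>))) / sqrt (1 - c \<omega>))"
      using nn_integral_std_normal_exp_quadratic[OF c1[of \<omega>], of "(b \<omega>)\<^sup>2 / 2" "b \<omega> * sqrt (c \<omega>)"] by presburger
    also have "(b \<omega>)\<^sup>2 / 2 + (b \<omega> * sqrt (c \<omega>))\<^sup>2 / (2 * (1 - c \<omega>)) = (a \<omega>)\<^sup>2 / (2 * (1 + q \<omega>))"
      using q1[of \<omega>] c0[of \<omega>] unfolding c' power_mult_distrib
      by (simp add: b_def c_def power2_eq_square divide_simps) (simp add: algebra_simps)
    finally show ?thesis by (simp add: c' real_sqrt_divide)
  qed
  have "(\<integral>\<^sup>+\<omega>. Z \<omega> * ennreal (exp ((2 * X \<omega> * a \<omega> + (X \<omega>)\<^sup>2 * q \<omega> - (a \<omega>)\<^sup>2) / (2 * (1 + q \<omega>)))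
            / sqrt (1 + q \<omega>)) \<partial>M)
      = (\<integral>\<^sup>+\<omega>. \<integral>\<^sup>+g. Z \<omega> * ennreal (k \<omega>) * (?\<phi> g * ennreal (exp (l g \<omega> * X \<omega>))) \<partial>lborel \<partial>M)"
  proof (intro nn_integral_cong)
    fix \<omega>
    have e: "- (a \<omega>)\<^sup>2 / (2 * (1 + q \<omega>)) + (b \<omega> * X \<omega> + c \<omega> * (X \<omega>)\<^sup>2 / 2)
        = (2 * X \<omega> * a \<omega> + (X \<omega>)\<^sup>2 * q \<omega> - (a \<omega>)\<^sup>2) / (2 * (1 + q \<omega>))"
      using q1[of \<omega>] by (simp add: b_def c_def divide_simps) (simp add: algebra_simps)
    have "(\<integral>\<^sup>+g. Z \<omega> * ennreal (k \<omega>) * (?\<phi> g * ennreal (exp (l g \<omega> * X \<omega>))) \<partial>lborel)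
        = Z \<omega> * ennreal (k \<omega>) * ennreal (exp (b \<omega> * X \<omega> + c \<omega> * (X \<omega>)\<^sup>2 / 2))"
      unfolding l_def by (subst nn_integral_cmult) (simp_all add: int1[unfolded l_def])
    also have "\<dots> = Z \<omega> * ennreal (k \<omega> * exp (b \<omega> * X \<omega> + c \<omega> * (X \<omega>)\<^sup>2 / 2))"
      using k0 by (simp add: ennreal_mult'' mult.assoc)
    also have "k \<omega> * exp (b \<omega> * X \<omega> + c \<omega> * (X \<omega>)\<^sup>2 / 2)
        = exp ((2 * X \<omega> * a \<omega> + (X \<omega>)\<^sup>2 * q \<omega> - (a \<omega>)\<^sup>2) / (2 * (1 + q \<omega>))) / sqrt (1 + q \<omega>)"
      unfolding e[symmetric] exp_add by (simp add: k_def exp_add)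
    finally show "Z \<omega> * ennreal (exp ((2 * X \<omega> * a \<omega> + (X \<omega>)\<^sup>2 * q \<omega> - (a \<omega>)\<^sup>2) / (2 * (1 + q \<omega>)))
            / sqrt (1 + q \<omega>)) = (\<integral>\<^sup>+g. Z \<omega> * ennreal (k \<omega>) * (?\<phi> g * ennreal (exp (l g \<omega> * X \<omega>))) \<partial>lborel)"
      by simp
  qed
  also have "\<dots> = (\<integral>\<^sup>+g. \<integral>\<^sup>+\<omega>. Z \<omega> * ennreal (k \<omega>) * (?\<phi> g * ennreal (exp (l g \<omega> * X \<omega>))) \<partial>M \<partial>lborel)"
    unfolding l_def by (intro P.Fubini'[symmetric]) measurable
  also have "\<dots> \<le> (\<integral>\<^sup>+g. \<integral>\<^sup>+\<omega>. Z \<omega> * ennreal (k \<omega>) * (?\<phi> g * ennreal (exp ((l g \<omega>)\<^sup>2 / 2))) \<partial>M \<partial>lborel)"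
  proof (rule nn_integral_mono)
    fix g
    show "(\<integral>\<^sup>+\<omega>. Z \<omega> * ennreal (k \<omega>) * (?\<phi> g * ennreal (exp (l g \<omega> * X \<omega>))) \<partial>M)
        \<le> (\<integral>\<^sup>+\<omega>. Z \<omega> * ennreal (k \<omega>) * (?\<phi> g * ennreal (exp ((l g \<omega>)\<^sup>2 / 2))) \<partial>M)"
      using cond_subgaussian_random[of "\<lambda>\<omega>. Z \<omega> * ennreal (k \<omega>) * ?\<phi> g", OF _ lG]
      by (simp add: mult.assoc)
  qed
  also have "\<dots> = (\<integral>\<^sup>+\<omega>. \<integral>\<^sup>+g. Z \<omega> * ennreal (k \<omega>) * (?\<phi> g * ennreal (exp ((l g \<omega>)\<^sup>2 / 2))) \<partial>lborel \<partial>M)"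
    unfolding l_def by (intro P.Fubini') measurable
  also have "\<dots> = (\<integral>\<^sup>+\<omega>. Z \<omega> \<partial>M)"
  proof (intro nn_integral_cong)
    fix \<omega>
    have "(\<integral>\<^sup>+g. Z \<omega> * ennreal (k \<omega>) * (?\<phi> g * ennreal (exp ((l g \<omega>)\<^sup>2 / 2))) \<partial>lborel)
        = Z \<omega> * ennreal (k \<omega>) * ennreal (exp ((a \<omega>)\<^sup>2 / (2 * (1 + q \<omega>))) * sqrt (1 + q \<omega>))"
      unfolding l_def by (subst nn_integral_cmult) (simp_all add: int2[unfolded l_def])
    also have "\<dots> = Z \<omega> * ennreal (k \<omega> * (exp ((a \<omega>)\<^sup>2 / (2 * (1 + q \<omega>))) * sqrt (1 + q \<omega>)))"
      using k0 q1[of \<omega>] by (simp add: ennreal_mult'' mult.assoc)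
    \<comment> \<open>The prefactor \<open>k\<close> is the reciprocal of the second Gaussian
      integral, so the subgaussian bound gives back exactly the weight.\<close>
    also have "k \<omega> * (exp ((a \<omega>)\<^sup>2 / (2 * (1 + q \<omega>))) * sqrt (1 + q \<omega>)) = 1"
      using q1[of \<omega>] by (simp add: k_def exp_minus)
    finally show "(\<integral>\<^sup>+g. Z \<omega> * ennreal (k \<omega>) * (?\<phi> g * ennreal (exp ((l g \<omega>)\<^sup>2 / 2))) \<partial>lborel) = Z \<omega>" by simp
  qed
  finally show ?thesis .
qed

end

end

subsection \<open>The self-normalized process\<close>

text \<open>By \<open>det_gram\<close> the product is the determinant of the Gram matrix, so this is
  the closed form of the exponential process of the noise averaged over a standard normal parameter
  (method of mixtures). The product form makes its one-step ratio explicit.\<close>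

definition sn_process :: "(nat \<Rightarrow> real^'n) \<Rightarrow> (nat \<Rightarrow> real) \<Rightarrow> nat \<Rightarrow> real" where
  "sn_process x n t = exp ((dual_norm x t (\<Sum>s\<in>{1..t}. n s *\<^sub>R x s))\<^sup>2 / 2)
     / sqrt (\<Prod>s\<in>{1..t}. 1 + (dual_norm x (s - 1) (x s))\<^sup>2)"

lemma sn_process_pos: "0 < sn_process x n t"
  unfolding sn_process_def by (intro divide_pos_pos) (auto intro!: prod_pos add_pos_nonneg)

lemma sn_process_0 [simp]: "sn_process x n 0 = 1"
  by (simp add: sn_process_def dual_norm_def)

text \<open>Sherman-Morrison updates the squared dual norm of the noise sum; the resulting one-step
  factor is the one in \<open>cond_subgaussian_quadratic\<close>.\<close>

lemma sn_process_Suc: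
  fixes x :: "nat \<Rightarrow> real^'n" and n :: "nat \<Rightarrow> real" and t :: nat
  defines "S \<equiv> \<lambda>t. \<Sum>s\<in>{1..t}. n s *\<^sub>R x s"
  defines "a \<equiv> x (Suc t) \<bullet> gram_solve x t (S t)" and "q \<equiv> (dual_norm x t (x (Suc t)))\<^sup>2"
  shows "sn_process x n (Suc t) = sn_process x n t *
     (exp ((2 * n (Suc t) * a + (n (Suc t))\<^sup>2 * q - a\<^sup>2) / (2 * (1 + q))) / sqrt (1 + q))"
proof -
  define v e where "v = x (Suc t)" and "e = n (Suc t)"
  have q: "v \<bullet> gram_solve x t v = q" "q \<ge> 0"
    unfolding q_def by (simp add: dual_norm_square v_def, rule zero_le_power2)
  have a: "v \<bullet> gram_solve x t (S t) = a" "S t \<bullet> gram_solve x t v = a"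
    using gram_solve_symmetric[of x t v "S t"] by (auto simp: a_def v_def inner_commute)
  have S: "S (Suc t) = S t + e *\<^sub>R v" by (simp add: S_def e_def v_def)
  have "(dual_norm x (Suc t) (S (Suc t)))\<^sup>2
      = S (Suc t) \<bullet> gram_solve x t (S (Suc t)) - (v \<bullet> gram_solve x t (S (Suc t)))\<^sup>2 / (1 + q)"
    unfolding dual_norm_square gram_solve_sherman_morrison[of x t "S (Suc t)"] v_def[symmetric] q
    using gram_solve_symmetric[of x t v "S (Suc t)"]
    by (simp add: inner_diff_right power2_eq_square inner_commute)
  also have "\<dots> = (dual_norm x t (S t))\<^sup>2 + (2 * e * a + e\<^sup>2 * q) - (a + e * q)\<^sup>2 / (1 + q)"
    unfolding S dual_norm_square
    by (simp add: gram_solve_add gram_solve_scale inner_add_left inner_add_right q a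
        power2_eq_square algebra_simps)
  also have "\<dots> = (dual_norm x t (S t))\<^sup>2 + (2 * e * a + e\<^sup>2 * q - a\<^sup>2) / (1 + q)"
    using q(2) by (simp add: field_simps power2_eq_square)
  finally have main: "(dual_norm x (Suc t) (S (Suc t)))\<^sup>2 / 2
      = (dual_norm x t (S t))\<^sup>2 / 2 + (2 * e * a + e\<^sup>2 * q - a\<^sup>2) / (2 * (1 + q))"
    by (simp only: add_divide_distrib divide_divide_eq_left mult.commute[of "1 + q" 2])
  have "(\<Prod>s\<in>{1..Suc t}. 1 + (dual_norm x (s - 1) (x s))\<^sup>2)
      = (\<Prod>s\<in>{1..t}. 1 + (dual_norm x (s - 1) (x s))\<^sup>2) * (1 + q)"
    by (simp add: q_def)
  moreover have "(\<Sum>s\<in>{1..u}. n s *\<^sub>R x s) = S u" for u by (simp add: S_def)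
  ultimately show ?thesis
    unfolding sn_process_def main e_def[symmetric]
    by (simp only: main exp_add real_sqrt_mult times_divide_times_eq)
qed

text \<open>The radius satisfies \<open>exp (b\<^sup>2 / 2) = T * sqrt (r ^ CARD('n))\<close>, and
  by the elliptical potential the last factor dominates the root of the determinant. So the process
  is at least \<open>T * exp ((Y\<^sup>2 - b\<^sup>2) / 2)\<close>, which exceeds \<open>T\<close>
  as soon as \<open>Y > b\<close>. Round \<open>t\<close> uses the data of the first
  \<open>t - 1\<close> rounds.\<close>

lemma conf_excess_le:
  fixes x :: "nat \<Rightarrow> real^'n"
  assumes T: "T \<ge> 1" and t: "t \<ge> 1" and x: "\<And>s. s \<in> {1..t-1} \<Longrightarrow> norm (x s) \<le> 1"
    and y: "\<And>s. s \<in> {1..t-1} \<Longrightarrow> y s = \<theta> \<bullet> x s + n s" and \<theta>: "norm \<theta> \<le> m"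
  shows "conf_excess m T x y \<theta> t \<le> sn_process x n (t - 1) / real T"
    and "conf_excess m T x y \<theta> t > 0 \<Longrightarrow> sn_process x n (t - 1) > real T"
proof -
  let ?d = "real CARD('n)" and ?P = "\<Prod>s\<in>{1..t-1}. 1 + (dual_norm x (s - 1) (x s))\<^sup>2"
  define r where "r = (?d + real (t - 1)) / ?d"
  define b where "b = sqrt (2 * ln (real T) + ?d * ln r)"
  define Y where "Y = dual_norm x (t - 1) (\<Sum>s\<in>{1..t-1}. n s *\<^sub>R x s)"
  have r: "r \<ge> 1" by (simp add: r_def field_simps)
  have b0: "b \<ge> 0" and b2: "b\<^sup>2 = 2 * ln (real T) + ?d * ln r"
    using T r by (auto simp: b_def)
  have P: "0 < ?P" by (intro prod_pos) (auto intro: add_pos_nonneg)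
  have "?P \<le> r ^ CARD('n)"
    unfolding r_def by (rule elliptical_potential) (use x in auto)
  then have sP: "sqrt ?P \<le> sqrt (r ^ CARD('n))" by simp
  have "exp (b\<^sup>2 / 2) = real T * sqrt (r ^ CARD('n))"
  proof -
    have "exp (?d * ln r / 2) = sqrt (r ^ CARD('n))"
    proof (rule real_sqrt_unique[symmetric])
      show "(exp (?d * ln r / 2))\<^sup>2 = r ^ CARD('n)"
        using r by (simp add: power2_eq_square exp_add[symmetric])
          (simp add: powr_def powr_realpow[symmetric] mult.commute)
    qed simp
    then show ?thesis using T by (simp add: b2 add_divide_distrib exp_add)
  qed
  then have "real T * exp ((Y\<^sup>2 - b\<^sup>2) / 2) = exp (Y\<^sup>2 / 2) / sqrt (r ^ CARD('n))"
    using T r by (simp add: diff_divide_distrib exp_diff)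
  also have "\<dots> \<le> exp (Y\<^sup>2 / 2) / sqrt ?P"
    using sP P r by (intro divide_left_mono) (auto intro!: mult_pos_pos)
  finally have W: "real T * exp ((Y\<^sup>2 - b\<^sup>2) / 2) \<le> sn_process x n (t - 1)"
    by (simp add: sn_process_def Y_def)
  have "wnorm (gram x (t - 1)) (\<theta> - theta_hat x y (t - 1)) \<le> Y + norm \<theta>"
    unfolding Y_def by (rule theta_hat_error) (use y in auto)
  then have ex: "conf_excess m T x y \<theta> t \<le> max 0 (Y - b)"
    using \<theta> by (auto simp: conf_excess_def sqrt_beta_def b_def r_def)
  have sq: "(Y - b)\<^sup>2 \<le> Y\<^sup>2 - b\<^sup>2" if "Y > b"
    using that b0 mult_left_mono[of b Y b] by (simp add: power2_eq_square algebra_simps)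
  show "conf_excess m T x y \<theta> t \<le> sn_process x n (t - 1) / real T"
  proof (cases "Y > b")
    case True
    \<comment> \<open>This converts the linear excess \<open>Y - b\<close> into a quadratic
      exponent, so that a bound on the mean of the process suffices and no tail has to be
      integrated.\<close>
    have "z \<le> 1 + z\<^sup>2 / 2" for z :: real
      using zero_le_power2[of "z - 1"] by (simp add: power2_eq_square algebra_simps)
    then have "Y - b \<le> 1 + (Y - b)\<^sup>2 / 2" .
    also have "\<dots> \<le> 1 + (Y\<^sup>2 - b\<^sup>2) / 2" using sq[OF True] by simp
    also have "\<dots> \<le> exp ((Y\<^sup>2 - b\<^sup>2) / 2)" by (rule exp_ge_add_one_self)
    also have "\<dots> \<le> sn_process x n (t - 1) / real T"
      using W T by (simp add: field_simps)
    finally show ?thesis using ex True by simp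
  next
    case False
    then have "conf_excess m T x y \<theta> t \<le> 0" using ex by simp
    also have "0 \<le> sn_process x n (t - 1) / real T"
      using sn_process_pos[of x n "t - 1"] by simp
    finally show ?thesis .
  qed
  show "sn_process x n (t - 1) > real T" if "conf_excess m T x y \<theta> t > 0"
  proof -
    have Yb: "Y > b" using that ex by (auto simp: max_def split: if_splits)
    then have "0 < (Y - b)\<^sup>2" by simp
    then have "0 < (Y\<^sup>2 - b\<^sup>2) / 2" using order_less_le_trans[OF _ sq[OF Yb]] by fastforce
    then have "1 < exp ((Y\<^sup>2 - b\<^sup>2) / 2)" by (simp only: one_less_exp_iff)
    then have "real T * 1 < real T * exp ((Y\<^sup>2 - b\<^sup>2) / 2)" using T by (intro mult_strict_left_mono) auto
    then show ?thesis using W by simp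
  qed
qed

text \<open>Induction along the Sherman-Morrison recursion: only inner products, quotients and
  linear combinations of measurable vectors occur.\<close>

lemma measurable_gram_solve:
  fixes x :: "nat \<Rightarrow> 'a \<Rightarrow> real^'n"
  assumes "\<And>s. s \<in> {1..t} \<Longrightarrow> x s \<in> borel_measurable N" and "z \<in> borel_measurable N"
  shows "(\<lambda>\<omega>. gram_solve (\<lambda>s. x s \<omega>) t (z \<omega>)) \<in> borel_measurable N"
  using assms
proof (induction t arbitrary: z)
  case (Suc t)
  have IH: "(\<lambda>\<omega>. gram_solve (\<lambda>s. x s \<omega>) t (z \<omega>)) \<in> borel_measurable N"
    if "z \<in> borel_measurable N" for z
    using Suc.IH[OF _ that] Suc.prems(1) by simp
  have v [measurable]: "x (Suc t) \<in> borel_measurable N" using Suc.prems(1)[of "Suc t"] by simp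
  have [measurable]: "(\<lambda>\<omega>. gram_solve (\<lambda>s. x s \<omega>) t (z \<omega>)) \<in> borel_measurable N"
    "(\<lambda>\<omega>. gram_solve (\<lambda>s. x s \<omega>) t (x (Suc t) \<omega>)) \<in> borel_measurable N"
    by (rule IH[OF Suc.prems(2)], rule IH[OF v])
  show ?case unfolding gram_solve_sherman_morrison by measurable
qed simp

lemma measurable_dual_norm:
  fixes x :: "nat \<Rightarrow> 'a \<Rightarrow> real^'n"
  assumes "\<And>s. s \<in> {1..t} \<Longrightarrow> x s \<in> borel_measurable N" and z [measurable]: "z \<in> borel_measurable N"
  shows "(\<lambda>\<omega>. dual_norm (\<lambda>s. x s \<omega>) t (z \<omega>)) \<in> borel_measurable N"
proof -
  have [measurable]: "(\<lambda>\<omega>. gram_solve (\<lambda>s. x s \<omega>) t (z \<omega>)) \<in> borel_measurable N"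
    by (rule measurable_gram_solve[OF assms])
  show ?thesis unfolding dual_norm_def by measurable
qed

lemma measurable_sn_process:
  fixes x :: "nat \<Rightarrow> 'a \<Rightarrow> real^'n"
  assumes x [measurable]: "\<And>s. s \<in> {1..t} \<Longrightarrow> x s \<in> borel_measurable N"
    and n [measurable]: "\<And>s. s \<in> {1..t} \<Longrightarrow> n s \<in> borel_measurable N"
  shows "(\<lambda>\<omega>. sn_process (\<lambda>s. x s \<omega>) (\<lambda>s. n s \<omega>) t) \<in> borel_measurable N"
proof -
  have [measurable]: "(\<lambda>\<omega>. \<Sum>s\<in>{1..t}. n s \<omega> *\<^sub>R x s \<omega>) \<in> borel_measurable N"
    by (intro borel_measurable_sum borel_measurable_scaleR) (use assms in auto)
  have [measurable]: "(\<lambda>\<omega>. dual_norm (\<lambda>s. x s \<omega>) t (\<Sum>s\<in>{1..t}. n s \<omega> *\<^sub>R x s \<omega>)) \<in> borel_measurable N"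
    by (rule measurable_dual_norm) (use x in auto)
  have "(\<lambda>\<omega>. dual_norm (\<lambda>s. x s \<omega>) (s - 1) (x s \<omega>)) \<in> borel_measurable N" if "s \<in> {1..t}" for s
    by (rule measurable_dual_norm) (use x that in auto)
  then have [measurable]: "(\<lambda>\<omega>. \<Prod>s\<in>{1..t}. 1 + (dual_norm (\<lambda>s. x s \<omega>) (s - 1) (x s \<omega>))\<^sup>2) \<in> borel_measurable N"
    by (intro borel_measurable_prod borel_measurable_add borel_measurable_power) auto
  show ?thesis unfolding sn_process_def by measurable
qed

text \<open>The weight \<open>Z\<close> replaces conditional expectation: it will be 1 for the mean
  and the indicator of a past event for the maximal inequality.\<close>

lemma (in prob_space) sn_process_supermartingale:
  fixes x :: "nat \<Rightarrow> 'a \<Rightarrow> real^'n"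
  assumes G: "subalgebra M G"
    and x: "\<And>s. s \<in> {1..Suc t} \<Longrightarrow> x s \<in> borel_measurable G"
    and n: "\<And>s. s \<in> {1..t} \<Longrightarrow> n s \<in> borel_measurable G"
    and noise: "n (Suc t) \<in> borel_measurable M" "cond_subgaussian 1 M G (n (Suc t))"
    and Z [measurable]: "Z \<in> borel_measurable G"
  shows "(\<integral>\<^sup>+\<omega>. Z \<omega> * ennreal (sn_process (\<lambda>s. x s \<omega>) (\<lambda>s. n s \<omega>) (Suc t)) \<partial>M)
       \<le> (\<integral>\<^sup>+\<omega>. Z \<omega> * ennreal (sn_process (\<lambda>s. x s \<omega>) (\<lambda>s. n s \<omega>) t) \<partial>M)"
proof -
  define a q w where "a \<omega> = x (Suc t) \<omega> \<bullet> gram_solve (\<lambda>s. x s \<omega>) t (\<Sum>s\<in>{1..t}. n s \<omega> *\<^sub>R x s \<omega>)"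
    and "q \<omega> = (dual_norm (\<lambda>s. x s \<omega>) t (x (Suc t) \<omega>))\<^sup>2"
    and "w \<omega> = sn_process (\<lambda>s. x s \<omega>) (\<lambda>s. n s \<omega>) t" for \<omega>
  have x' [measurable]: "x (Suc t) \<in> borel_measurable G" using x[of "Suc t"] by simp
  have S: "(\<lambda>\<omega>. \<Sum>s\<in>{1..t}. n s \<omega> *\<^sub>R x s \<omega>) \<in> borel_measurable G"
    by (intro borel_measurable_sum borel_measurable_scaleR) (use x n in auto)
  have [measurable]: "(\<lambda>\<omega>. gram_solve (\<lambda>s. x s \<omega>) t (\<Sum>s\<in>{1..t}. n s \<omega> *\<^sub>R x s \<omega>)) \<in> borel_measurable G"
    by (rule measurable_gram_solve[OF _ S]) (use x in auto)
  have a [measurable]: "a \<in> borel_measurable G" unfolding a_def by measurable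
  have [measurable]: "(\<lambda>\<omega>. dual_norm (\<lambda>s. x s \<omega>) t (x (Suc t) \<omega>)) \<in> borel_measurable G"
    by (rule measurable_dual_norm) (use x in auto)
  have q [measurable]: "q \<in> borel_measurable G" unfolding q_def by measurable
  have w [measurable]: "w \<in> borel_measurable G"
    unfolding w_def by (rule measurable_sn_process) (use x n in auto)
  have w0: "w \<omega> \<ge> 0" for \<omega> by (simp add: w_def sn_process_pos less_imp_le)
  have "Z \<omega> * ennreal (sn_process (\<lambda>s. x s \<omega>) (\<lambda>s. n s \<omega>) (Suc t)) =
      (Z \<omega> * ennreal (w \<omega>)) * ennreal (exp ((2 * n (Suc t) \<omega> * a \<omega> + (n (Suc t) \<omega>)\<^sup>2 * q \<omega> - (a \<omega>)\<^sup>2)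
        / (2 * (1 + q \<omega>))) / sqrt (1 + q \<omega>))" for \<omega>
    unfolding sn_process_Suc a_def[symmetric] q_def[symmetric] w_def[symmetric]
    by (simp only: ennreal_mult'[OF w0] mult.assoc)
  then have "(\<integral>\<^sup>+\<omega>. Z \<omega> * ennreal (sn_process (\<lambda>s. x s \<omega>) (\<lambda>s. n s \<omega>) (Suc t)) \<partial>M) =
     (\<integral>\<^sup>+\<omega>. (Z \<omega> * ennreal (w \<omega>)) * ennreal (exp ((2 * n (Suc t) \<omega> * a \<omega> + (n (Suc t) \<omega>)\<^sup>2 * q \<omega> - (a \<omega>)\<^sup>2)
        / (2 * (1 + q \<omega>))) / sqrt (1 + q \<omega>)) \<partial>M)" by simp
  also have "\<dots> \<le> (\<integral>\<^sup>+\<omega>. Z \<omega> * ennreal (w \<omega>) \<partial>M)"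
    by (rule cond_subgaussian_quadratic[OF G noise]) (auto simp: q_def)
  finally show ?thesis by (simp add: w_def)
qed

subsection \<open>Independence and countable contexts\<close>

lemma (in prob_space) indep_set_integral_mult:
  fixes X Y :: "'a \<Rightarrow> real"
  assumes ind: "indep_set (sets F) (sets G)" and sp: "space F = space M" "space G = space M"
    and X: "X \<in> borel_measurable F" "integrable M X" and Y: "Y \<in> borel_measurable G" "integrable M Y"
  shows "(\<integral>\<omega>. X \<omega> * Y \<omega> \<partial>M) = (\<integral>\<omega>. X \<omega> \<partial>M) * (\<integral>\<omega>. Y \<omega> \<partial>M)"
proof (rule indep_var_lebesgue_integral)
  have 1: "sigma_sets (space M) {X -` A \<inter> space M |A. A \<in> sets borel} \<subseteq> sets F"
  proof -
    have "{X -` A \<inter> space M |A. A \<in> sets borel} \<subseteq> sets F"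
      using X(1) sp(1) by (auto simp: measurable_def)
    then show ?thesis using sets.sigma_sets_subset[of _ F] sp(1) by simp
  qed
  have 2: "sigma_sets (space M) {Y -` A \<inter> space M |A. A \<in> sets borel} \<subseteq> sets G"
  proof -
    have "{Y -` A \<inter> space M |A. A \<in> sets borel} \<subseteq> sets G"
      using Y(1) sp(2) by (auto simp: measurable_def)
    then show ?thesis using sets.sigma_sets_subset[of _ G] sp(2) by simp
  qed
  show "indep_var borel X borel Y"
    unfolding indep_var_eq
  proof (intro conjI)
    show "random_variable borel X" "random_variable borel Y"
      using X(2) Y(2) by (simp_all add: borel_measurable_integrable)
    have F: "sets F \<subseteq> events" and G: "sets G \<subseteq> events"
      and FG: "\<And>a b. a \<in> sets F \<Longrightarrow> b \<in> sets G \<Longrightarrow> prob (a \<inter> b) = prob a * prob b"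
      using ind unfolding indep_sets2_eq by blast+
    show "indep_set (sigma_sets (space M) {X -` A \<inter> space M |A. A \<in> sets borel})
            (sigma_sets (space M) {Y -` A \<inter> space M |A. A \<in> sets borel})"
      unfolding indep_sets2_eq using 1 2 F G by (intro conjI ballI FG) blast+
  qed
qed (use X Y in auto)

lemma gen_sets_subset:
  assumes "X \<in> measurable M N"
  shows "gen_sets M X N \<subseteq> sets M"
  using assms measurable_space[OF assms] measurable_sets[OF assms]
  by (subst sets_vimage_algebra2) auto

lemma measurable_of_gen_sets:
  assumes "X \<in> space M \<rightarrow> space N" "gen_sets M X N \<subseteq> sets F" "space F = space M"
  shows "X \<in> measurable F N"
proof (rule measurableI)
  show "X \<omega> \<in> space N" if "\<omega> \<in> space F" for \<omega> using assms that by auto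
  show "X -` A \<inter> space F \<in> sets F" if "A \<in> sets N" for A
    using assms(2,3) that unfolding sets_vimage_algebra2[OF assms(1)] by auto
qed

text \<open>Passes through the counting measure, where countable additivity is available, to the
  unconditional sums in which policy averages are defined.\<close>

lemma (in prob_space) has_sum_prob_eq_countable:
  assumes X: "X \<in> measurable M (count_space C)" and C: "countable C"
  shows "((\<lambda>c. prob {\<omega> \<in> space M. X \<omega> = c}) has_sum 1) C"
proof -
  have nn: "(\<integral>\<^sup>+c. emeasure M {\<omega> \<in> space M. X \<omega> = c} \<partial>count_space C) = emeasure M (\<Union>c\<in>C. {\<omega> \<in> space M. X \<omega> = c})"
    using X C by (intro emeasure_UN_countable[symmetric])
      (auto simp: disjoint_family_on_def intro: measurable_count_space_extend)
  also have "(\<Union>c\<in>C. {\<omega> \<in> space M. X \<omega> = c}) = space M"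
    using X by (auto simp: measurable_def)
  finally have nn1: "(\<integral>\<^sup>+c. ennreal (prob {\<omega> \<in> space M. X \<omega> = c}) \<partial>count_space C) = 1"
    by (simp add: emeasure_eq_measure[symmetric] emeasure_space_1)
  then have "has_bochner_integral (count_space C) (\<lambda>c. prob {\<omega> \<in> space M. X \<omega> = c}) 1"
    by (intro has_bochner_integral_nn_integral) auto
  then have abs: "Infinite_Set_Sum.abs_summable_on (\<lambda>c. prob {\<omega> \<in> space M. X \<omega> = c}) C"
    and sum: "infsetsum (\<lambda>c. prob {\<omega> \<in> space M. X \<omega> = c}) C = 1"
    by (auto simp: Infinite_Set_Sum.abs_summable_on_def infsetsum_def has_bochner_integral_iff)
  have "(\<lambda>c. prob {\<omega> \<in> space M. X \<omega> = c}) summable_on C"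
    using abs unfolding abs_summable_equivalent[symmetric] by (rule abs_summable_summable)
  then show ?thesis
    using has_sum_infsum infsetsum_infsum[OF abs] sum by metis
qed

text \<open>\<open>f c\<close> may itself be random, as a cost table is. Restricting to a finite set
  \<open>F\<close> of contexts leaves an error of at most \<open>B\<close> times the probability of
  a context outside \<open>F\<close>, which vanishes along the finite subsets of
  \<open>C\<close>.\<close>

lemma (in prob_space) has_sum_integral_countable:
  fixes f :: "'c \<Rightarrow> 'a \<Rightarrow> real"
  assumes X: "X \<in> measurable M (count_space C)" and C: "countable C"
    and f: "\<And>c. c \<in> C \<Longrightarrow> f c \<in> borel_measurable M"
    and B: "\<And>c \<omega>. c \<in> C \<Longrightarrow> \<omega> \<in> space M \<Longrightarrow> \<bar>f c \<omega>\<bar> \<le> B"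
  shows "((\<lambda>c. \<integral>\<omega>. indicator {\<omega>. X \<omega> = c} \<omega> * f c \<omega> \<partial>M) has_sum (\<integral>\<omega>. f (X \<omega>) \<omega> \<partial>M)) C"
proof -
  let ?p = "\<lambda>c. prob {\<omega> \<in> space M. X \<omega> = c}"
  have XC: "X \<omega> \<in> C" if "\<omega> \<in> space M" for \<omega> using X that by (auto simp: measurable_def)
  have ev: "{\<omega> \<in> space M. X \<omega> = c} \<in> events" for c
  proof (cases "c \<in> C")
    case True
    have "X -` {c} \<inter> space M \<in> events" using X True by (intro measurable_sets) auto
    then show ?thesis by (simp add: vimage_def Int_def conj_commute)
  next
    case False
    then have "{\<omega> \<in> space M. X \<omega> = c} = {}" using XC by auto
    then show ?thesis by (simp only: sets.empty_sets)
  qed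
  have ind: "(\<lambda>\<omega>. indicator {\<omega>. X \<omega> = c} \<omega> :: real) \<in> borel_measurable M" for c
    using ev[of c] by (subst measurable_cong[where g = "indicator {\<omega> \<in> space M. X \<omega> = c}"])
      (auto simp: indicator_def)
  have fX: "(\<lambda>\<omega>. f (X \<omega>) \<omega>) \<in> borel_measurable M"
    by (rule measurable_compose_countable'[OF f X C])
  obtain \<omega>0 where "\<omega>0 \<in> space M" using not_empty by blast
  then have B0: "0 \<le> B" using order_trans[OF abs_ge_zero B[OF XC]] by blast
  have int_c: "integrable M (\<lambda>\<omega>. indicator {\<omega>. X \<omega> = c} \<omega> * f c \<omega>)" if "c \<in> C" for c
    by (rule integrable_const_bound[of _ B])
       (use B[OF that] f[OF that] ind[of c] B0 in \<open>auto simp: indicator_def\<close>)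
  have int_f: "integrable M (\<lambda>\<omega>. f (X \<omega>) \<omega>)"
    by (rule integrable_const_bound[of _ B]) (use B XC fX in auto)
  have p: "(?p has_sum 1) C" by (rule has_sum_prob_eq_countable[OF X C])
  have bound: "norm ((\<Sum>c\<in>F. \<integral>\<omega>. indicator {\<omega>. X \<omega> = c} \<omega> * f c \<omega> \<partial>M) - (\<integral>\<omega>. f (X \<omega>) \<omega> \<partial>M))
      \<le> B * (1 - sum ?p F)" if F: "finite F" "F \<subseteq> C" for F
  proof -
    have s: "(\<Sum>c\<in>F. indicator {\<omega>. X \<omega> = c} \<omega> * f c \<omega>) = (if X \<omega> \<in> F then f (X \<omega>) \<omega> else 0)" for \<omega>
    proof -
      have "(\<Sum>c\<in>F. indicator {\<omega>. X \<omega> = c} \<omega> * f c \<omega>) = (\<Sum>c\<in>F. if X \<omega> = c then f c \<omega> else 0)"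
        by (intro sum.cong) (auto simp: indicator_def)
      then show ?thesis using F by simp
    qed
    have pF: "prob {\<omega> \<in> space M. X \<omega> \<notin> F} = 1 - sum ?p F"
    proof -
      have "sum ?p F = prob (\<Union>c\<in>F. {\<omega> \<in> space M. X \<omega> = c})"
        using ev F by (intro finite_measure_finite_Union[symmetric]) (auto simp: disjoint_family_on_def)
      also have "1 - \<dots> = prob (space M - (\<Union>c\<in>F. {\<omega> \<in> space M. X \<omega> = c}))"
        using ev F by (intro prob_compl[symmetric]) auto
      also have "space M - (\<Union>c\<in>F. {\<omega> \<in> space M. X \<omega> = c}) = {\<omega> \<in> space M. X \<omega> \<notin> F}" by auto
      finally show ?thesis by simp
    qed
    have evF: "{\<omega> \<in> space M. X \<omega> \<notin> F} \<in> events"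
    proof -
      have "space M - (\<Union>c\<in>F. {\<omega> \<in> space M. X \<omega> = c}) \<in> events" using ev F by auto
      also have "space M - (\<Union>c\<in>F. {\<omega> \<in> space M. X \<omega> = c}) = {\<omega> \<in> space M. X \<omega> \<notin> F}" by auto
      finally show ?thesis .
    qed
    have "(\<Sum>c\<in>F. \<integral>\<omega>. indicator {\<omega>. X \<omega> = c} \<omega> * f c \<omega> \<partial>M) - (\<integral>\<omega>. f (X \<omega>) \<omega> \<partial>M)
        = (\<integral>\<omega>. (\<Sum>c\<in>F. indicator {\<omega>. X \<omega> = c} \<omega> * f c \<omega>) - f (X \<omega>) \<omega> \<partial>M)"
    proof -
      have "integrable M (\<lambda>\<omega>. \<Sum>c\<in>F. indicator {\<omega>. X \<omega> = c} \<omega> * f c \<omega>)"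
        by (rule Bochner_Integration.integrable_sum) (use int_c F in blast)
      moreover have "(\<integral>\<omega>. (\<Sum>c\<in>F. indicator {\<omega>. X \<omega> = c} \<omega> * f c \<omega>) \<partial>M)
          = (\<Sum>c\<in>F. \<integral>\<omega>. indicator {\<omega>. X \<omega> = c} \<omega> * f c \<omega> \<partial>M)"
        by (rule Bochner_Integration.integral_sum) (use int_c F in blast)
      ultimately show ?thesis using int_f by (simp only: Bochner_Integration.integral_diff)
    qed
    also have "norm \<dots> \<le> (\<integral>\<omega>. B * indicator {\<omega> \<in> space M. X \<omega> \<notin> F} \<omega> \<partial>M)"
    proof (rule order_trans[OF integral_norm_bound integral_mono'])
      show "integrable M (\<lambda>\<omega>. B * indicator {\<omega> \<in> space M. X \<omega> \<notin> F} \<omega>)"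
        using evF by (intro integrable_mult_right integrable_real_indicator) (auto simp: less_top[symmetric])
      show "norm ((\<Sum>c\<in>F. indicator {\<omega>. X \<omega> = c} \<omega> * f c \<omega>) - f (X \<omega>) \<omega>)
          \<le> B * indicator {\<omega> \<in> space M. X \<omega> \<notin> F} \<omega>" if "\<omega> \<in> space M" for \<omega>
        unfolding s using B[OF XC[OF that] that] that by (auto simp: indicator_def)
    qed (simp add: B0)
    also have "\<dots> = B * (1 - sum ?p F)" using evF by (simp add: pF)
    finally show ?thesis .
  qed
  show ?thesis
    unfolding has_sum_def
  proof (rule Lim_transform)
    show "((\<lambda>F. \<integral>\<omega>. f (X \<omega>) \<omega> \<partial>M) \<longlongrightarrow> (\<integral>\<omega>. f (X \<omega>) \<omega> \<partial>M)) (finite_subsets_at_top C)" by simp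
    have "((\<lambda>F. B * (1 - sum ?p F)) \<longlongrightarrow> B * (1 - 1)) (finite_subsets_at_top C)"
      using p unfolding has_sum_def by (intro tendsto_intros)
    then have "((\<lambda>F. B * (1 - sum ?p F)) \<longlongrightarrow> 0) (finite_subsets_at_top C)" by simp
    then show "((\<lambda>F. (\<Sum>c\<in>F. \<integral>\<omega>. indicator {\<omega>. X \<omega> = c} \<omega> * f c \<omega> \<partial>M) - (\<integral>\<omega>. f (X \<omega>) \<omega> \<partial>M)) \<longlongrightarrow> 0) (finite_subsets_at_top C)"
      by (rule Lim_null_comparison[rotated])
         (use bound in \<open>auto intro!: eventually_finite_subsets_at_top_weakI\<close>)
  qed
qed

subsection \<open>Runs of the algorithm\<close>

text \<open>The parameter \<open>d\<close> stands for \<open>CARD('n)\<close>: an abbreviation of type \<open>nat \<Rightarrow> real\<close> could not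
  mention the type \<open>'n\<close>.\<close>

locale pess_opt_bandit = prob_space M
  for M :: "'o measure" +
  fixes T J K :: nat
    and C :: "'c set"
    and p :: "'c \<Rightarrow> real"
    and \<phi> :: "'c \<Rightarrow> nat \<Rightarrow> real^'n"
    and \<theta>star :: "real^'n"
    and m \<delta> :: real
    and d :: nat
    and ctx :: "nat \<Rightarrow> 'o \<Rightarrow> 'c"
    and A :: "nat \<Rightarrow> 'o \<Rightarrow> nat"
    and W :: "nat \<Rightarrow> nat \<Rightarrow> 'c \<Rightarrow> nat \<Rightarrow> 'o \<Rightarrow> real"
    and \<eta> :: "nat \<Rightarrow> 'o \<Rightarrow> real"
    and w :: "nat \<Rightarrow> 'c \<Rightarrow> nat \<Rightarrow> real"
    and r :: "'c \<Rightarrow> nat \<Rightarrow> real"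
    and R :: "nat \<Rightarrow> nat \<Rightarrow> 'o \<Rightarrow> real"
  assumes d_eq: "d = CARD('n)"
    and r_eq: "\<And>c j. r c j = \<theta>star \<bullet> \<phi> c j"
    and R_eq: "\<And>t j \<omega>. R t j \<omega> = r (ctx t \<omega>) j + \<eta> t \<omega>"
    and w_eq: "\<And>k c j. w k c j = (\<integral>\<omega>. W 1 k c j \<omega> \<partial>M)"
    and countable_C: "countable C"
    and K_pos: "K \<ge> 1"
    and T_pos: "T \<ge> 1"
    and ctx_meas: "\<And>t. t \<in> {1..T} \<Longrightarrow> ctx t \<in> measurable M (count_space C)"
    and A_meas: "\<And>t. t \<in> {1..T} \<Longrightarrow> A t \<in> measurable M (count_space {1..J})"
    and W_meas: "\<And>t k c j. t \<in> {1..T} \<Longrightarrow> k \<in> {1..K} \<Longrightarrow> c \<in> C \<Longrightarrow> j \<in> {1..J} \<Longrightarrow>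
        W t k c j \<in> borel_measurable M"
    and \<eta>_meas: "\<And>t. t \<in> {1..T} \<Longrightarrow> \<eta> t \<in> borel_measurable M"
    and ctx_law: "\<And>t c. t \<in> {1..T} \<Longrightarrow> c \<in> C \<Longrightarrow> measure M {\<omega>\<in>space M. ctx t \<omega> = c} = p c"
    and r_range: "\<And>c j. c \<in> C \<Longrightarrow> j \<in> {1..J} \<Longrightarrow> r c j \<in> {0..1}"
    and \<phi>_bound: "\<And>c j. c \<in> C \<Longrightarrow> j \<in> {1..J} \<Longrightarrow> norm (\<phi> c j) \<le> 1"
    and \<theta>_bound: "norm \<theta>star \<le> m"
    and \<eta>_zero_mean: "\<And>t. t \<in> {1..T} \<Longrightarrow>
        cond_zero_mean M (pre_reward M C J K ctx A R W t) (\<eta> t)"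
    and \<eta>_subgaussian: "\<And>t. t \<in> {1..T} \<Longrightarrow>
        cond_subgaussian 1 M (pre_reward M C J K ctx A R W t) (\<eta> t)"
    and W_bound: "\<And>t k c j \<omega>. t \<in> {1..T} \<Longrightarrow> k \<in> {1..K} \<Longrightarrow> c \<in> C \<Longrightarrow> j \<in> {1..J} \<Longrightarrow>
        \<omega> \<in> space M \<Longrightarrow> \<bar>W t k c j \<omega>\<bar> \<le> 1"
    and W_ident: "\<And>t k c j. t \<in> {1..T} \<Longrightarrow> k \<in> {1..K} \<Longrightarrow> c \<in> C \<Longrightarrow> j \<in> {1..J} \<Longrightarrow>
        distr M borel (W t k c j) = distr M borel (W 1 k c j)"
    and fresh: "\<And>t. t \<in> {1..T} \<Longrightarrow>
        indep_set (sets (round_draw M C J K ctx W t)) (sets (history M C J K ctx A R W (t - 1)))"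
    and W_ctx_indep: "\<And>t k c j. t \<in> {1..T} \<Longrightarrow> k \<in> {1..K} \<Longrightarrow> c \<in> C \<Longrightarrow> j \<in> {1..J} \<Longrightarrow>
        indep_set (gen_sets M (ctx t) (count_space C)) (gen_sets M (W t k c j) borel)"
    and \<delta>_range: "0 < \<delta>" "\<delta> \<le> 1"
    and algorithm: "\<And>\<omega>. \<omega> \<in> space M \<Longrightarrow>
        pess_opt_run T J K m \<delta> \<phi> (\<lambda>t. ctx t \<omega>) (\<lambda>t. A t \<omega>) (\<lambda>t. R t (A t \<omega>) \<omega>)
          (\<lambda>t k c j. W t k c j \<omega>)"
begin

abbreviation H :: "nat \<Rightarrow> 'o measure" where
  "H \<equiv> history M C J K ctx A R W"

abbreviation PR :: "nat \<Rightarrow> 'o measure" where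
  "PR \<equiv> pre_reward M C J K ctx A R W"

definition feat :: "nat \<Rightarrow> 'o \<Rightarrow> real^'n" where
  "feat t \<omega> = \<phi> (ctx t \<omega>) (A t \<omega>)"

definition rew :: "nat \<Rightarrow> 'o \<Rightarrow> real" where
  "rew t \<omega> = R t (A t \<omega>) \<omega>"

definition cost :: "nat \<Rightarrow> nat \<Rightarrow> 'o \<Rightarrow> real" where
  "cost k t \<omega> = W t k (ctx t \<omega>) (A t \<omega>) \<omega>"

definition Q :: "nat \<Rightarrow> nat \<Rightarrow> 'o \<Rightarrow> real" where
  "Q k t \<omega> = queue K (\<lambda>t. \<Sum>j\<in>{1..J}. W t k (ctx t \<omega>) j \<omega> * of_bool (A t \<omega> = j)) t"

abbreviation V :: "nat \<Rightarrow> real" where "V \<equiv> V_param \<delta> K"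
abbreviation eps :: "nat \<Rightarrow> real" where "eps \<equiv> eps_param K"

section \<open>Pathwise bounds along a run\<close>

lemma ctx_in: "t \<in> {1..T} \<Longrightarrow> \<omega> \<in> space M \<Longrightarrow> ctx t \<omega> \<in> C"
  using measurable_space[OF ctx_meas] by auto

lemma A_in: "t \<in> {1..T} \<Longrightarrow> \<omega> \<in> space M \<Longrightarrow> A t \<omega> \<in> {1..J}"
  using measurable_space[OF A_meas] by auto

lemma m_nonneg: "0 \<le> m"
  using \<theta>_bound norm_ge_zero order_trans by blast

lemma V_pos: "t \<ge> 1 \<Longrightarrow> V t > 0"
  using K_pos \<delta>_range by (simp add: V_param_def)

lemma eps_nonneg: "eps t \<ge> 0"
  by (simp add: eps_param_def)

lemma sum_action:
  assumes "t \<in> {1..T}" "\<omega> \<in> space M"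
  shows "(\<Sum>j\<in>{1..J}. f j * of_bool (A t \<omega> = j)) = (f (A t \<omega>) :: real)"
  using A_in[OF assms] by (simp add: of_bool_def if_distrib cong: if_cong)

lemma cost_bound: "k \<in> {1..K} \<Longrightarrow> t \<in> {1..T} \<Longrightarrow> \<omega> \<in> space M \<Longrightarrow> \<bar>cost k t \<omega>\<bar> \<le> 1"
  unfolding cost_def using ctx_in A_in by (intro W_bound) auto

lemma feat_norm: "t \<in> {1..T} \<Longrightarrow> \<omega> \<in> space M \<Longrightarrow> norm (feat t \<omega>) \<le> 1"
  unfolding feat_def using ctx_in A_in by (intro \<phi>_bound) auto

lemma rew_eq: "rew t \<omega> = \<theta>star \<bullet> feat t \<omega> + \<eta> t \<omega>"
  by (simp add: rew_def feat_def R_eq r_eq)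

lemma mean_reward_range:
  assumes "t \<in> {1..T}" "\<omega> \<in> space M"
  shows "\<theta>star \<bullet> feat t \<omega> \<in> {0..1}"
  using r_range[OF ctx_in[OF assms] A_in[OF assms]] by (simp add: feat_def r_eq)

lemma Q_1 [simp]: "Q k (Suc 0) \<omega> = 0"
  by (simp add: Q_def)

lemma Q_Suc:
  assumes "t \<in> {1..T}" "\<omega> \<in> space M"
  shows "Q k (Suc t) \<omega> = max 0 (Q k t \<omega> + cost k t \<omega> + eps t)"
proof -
  obtain u where u: "t = Suc u" using assms by (cases t) auto
  show ?thesis
    unfolding Q_def u queue.simps(3) sum_action[OF assms[unfolded u]] cost_def by simp
qed

lemma Q_nonneg: "0 \<le> Q k t \<omega>"
proof -
  have "0 \<le> queue K g t" for g by (cases "(K, g, t)" rule: queue.cases) auto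
  then show ?thesis by (simp add: Q_def)
qed

lemma Q_le:
  assumes "k \<in> {1..K}" "\<omega> \<in> space M" "t \<le> T"
  shows "Q k (Suc t) \<omega> \<le> (\<Sum>s\<in>{1..t}. 1 + eps s)"
  using assms(3)
proof (induction t)
  case (Suc t)
  have t: "Suc t \<in> {1..T}" using Suc.prems by auto
  have "Q k (Suc t) \<omega> \<le> (\<Sum>s\<in>{1..t}. 1 + eps s)" using Suc by simp
  moreover have "0 \<le> (\<Sum>s\<in>{1..t}. 1 + eps s)" using eps_nonneg by (intro sum_nonneg) (simp add: add_nonneg_nonneg)
  ultimately show ?case
    using Q_Suc[OF t assms(2), of k] cost_bound[OF assms(1) t assms(2)] eps_nonneg[of "Suc t"]
    by simp
qed simp

text \<open>Obtained by omitting the positive parts in the recursion. Read backwards, a bound on the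
  queue limits the incurred costs, with the accumulated pessimism subtracted.\<close>

lemma Q_ge:
  assumes "k \<in> {1..K}" "\<omega> \<in> space M" "t \<le> T"
  shows "(\<Sum>s\<in>{1..t}. cost k s \<omega> + eps s) \<le> Q k (Suc t) \<omega>"
  using assms(3)
proof (induction t)
  case (Suc t)
  have t: "Suc t \<in> {1..T}" using Suc.prems by auto
  show ?case
    using Q_Suc[OF t assms(2), of k] Suc by simp
qed simp

lemma Q_change_le:
  assumes "k \<in> {1..K}" "t \<in> {1..T}" "\<omega> \<in> space M"
  shows "\<bar>Q k (Suc t) \<omega> - Q k t \<omega>\<bar> \<le> 1 + eps t"
    and "(Q k (Suc t) \<omega>)\<^sup>2 \<le> (Q k t \<omega>)\<^sup>2 + 2 * Q k t \<omega> * (cost k t \<omega> + eps t) + (1 + eps t)\<^sup>2"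
proof -
  let ?c = "cost k t \<omega> + eps t"
  have c: "\<bar>?c\<bar> \<le> 1 + eps t"
    using cost_bound[OF assms] eps_nonneg[of t] by (auto simp: abs_le_iff)
  show "\<bar>Q k (Suc t) \<omega> - Q k t \<omega>\<bar> \<le> 1 + eps t"
    unfolding Q_Suc[OF assms(2,3)] using c Q_nonneg[of k t \<omega>] by (auto simp: max_def)
  have "(Q k (Suc t) \<omega>)\<^sup>2 \<le> (Q k t \<omega> + ?c)\<^sup>2"
    unfolding Q_Suc[OF assms(2,3)] by (auto simp: max_def add.assoc)
  also have "\<dots> = (Q k t \<omega>)\<^sup>2 + 2 * Q k t \<omega> * ?c + ?c\<^sup>2" by (simp add: power2_sum)
  also have "?c\<^sup>2 \<le> (1 + eps t)\<^sup>2" using c by (metis abs_ge_zero power2_abs power_mono)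
  finally show "(Q k (Suc t) \<omega>)\<^sup>2 \<le> (Q k t \<omega>)\<^sup>2 + 2 * Q k t \<omega> * (cost k t \<omega> + eps t) + (1 + eps t)\<^sup>2"
    by simp
qed

definition excess :: "nat \<Rightarrow> 'o \<Rightarrow> real" where
  "excess t \<omega> = conf_excess m T (\<lambda>s. feat s \<omega>) (\<lambda>s. rew s \<omega>) \<theta>star t"

abbreviation radius :: "nat \<Rightarrow> real" where
  "radius \<equiv> sqrt_beta m T d"

abbreviation width :: "nat \<Rightarrow> 'o \<Rightarrow> real" where
  "width t \<omega> \<equiv> dual_norm (\<lambda>s. feat s \<omega>) (t - 1) (feat t \<omega>)"

lemma excess_nonneg: "0 \<le> excess t \<omega>"
  by (simp add: excess_def conf_excess_def)

lemma radius_nonneg: "0 \<le> radius t"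
proof -
  have "1 \<le> (real d + real (t - 1)) / real d" by (simp add: d_eq field_simps)
  then show ?thesis
    using m_nonneg T_pos unfolding sqrt_beta_def
    by (intro add_nonneg_nonneg real_sqrt_ge_zero mult_nonneg_nonneg ln_ge_zero) auto
qed

lemma width_le_1: "t \<in> {1..T} \<Longrightarrow> \<omega> \<in> space M \<Longrightarrow> width t \<omega> \<le> 1"
  using dual_norm_le_norm[of "\<lambda>s. feat s \<omega>" "t - 1" "feat t \<omega>"] feat_norm[of t \<omega>] by linarith

text \<open>\<open>r_hat\<close> enters the analysis only through this pathwise inequality, so that the measurability
  of its supremum never matters.\<close>

lemma optimism:
  assumes t: "t \<in> {1..T}" and \<omega>: "\<omega> \<in> space M" and x: "is_policy C J x"
  shows "(\<Sum>k\<in>{1..K}. cost k t \<omega> * Q k t \<omega>) / V t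
      \<le> min 1 (\<theta>star \<bullet> feat t \<omega> + 2 * radius t * width t \<omega> + excess t \<omega>) + excess t \<omega>
        - (\<Sum>j\<in>{1..J}. x (ctx t \<omega>) j * r (ctx t \<omega>) j)
        + (\<Sum>k\<in>{1..K}. (\<Sum>j\<in>{1..J}. x (ctx t \<omega>) j * W t k (ctx t \<omega>) j \<omega>) * Q k t \<omega>) / V t"
proof -
  define c where "c = ctx t \<omega>"
  have c: "c \<in> C" using ctx_in[OF t \<omega>] by (simp add: c_def)
  have x0: "\<And>j. j \<in> {1..J} \<Longrightarrow> x c j \<ge> 0" and x1: "(\<Sum>j\<in>{1..J}. x c j) = 1"
    using x c by (auto simp: is_policy_def)
  define h where "h j = r_hat m T (\<lambda>s. feat s \<omega>) (\<lambda>s. rew s \<omega>) t (\<phi> c j)" for j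
  have arg: "is_arg_max (\<lambda>j. h j - 1 / V t * (\<Sum>k\<in>{1..K}. W t k c j \<omega> * Q k t \<omega>)) (\<lambda>j. j \<in> {1..J}) (A t \<omega>)"
    using algorithm[OF \<omega>] t
    unfolding pess_opt_run_def Let_def h_def c_def feat_def rew_def Q_def by blast
  define g where "g j = (\<Sum>k\<in>{1..K}. W t k c j \<omega> * Q k t \<omega>) / V t" for j
  have best: "h j - g j \<le> h (A t \<omega>) - g (A t \<omega>)" if "j \<in> {1..J}" for j
    using arg that by (auto simp: is_arg_max_def g_def not_less)
  have rad: "0 \<le> radius t" by (rule radius_nonneg)
  have low: "r c j - excess t \<omega> \<le> h j" if "j \<in> {1..J}" for j
    using r_hat_ge[OF rad[unfolded d_eq] \<phi>_bound[OF c that]] r_range[OF c that]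
    by (simp add: h_def r_eq excess_def)
  \<comment> \<open>Both arguments of the minimum are kept for later: the estimate by the width
    serves the regret, while the constant 1 serves the drift of the queue norm and keeps the
    confidence width out of its level.\<close>
  have up: "h (A t \<omega>) \<le> min 1 (\<theta>star \<bullet> feat t \<omega> + 2 * radius t * width t \<omega> + excess t \<omega>)"
  proof -
    have "h (A t \<omega>) \<le> \<theta>star \<bullet> feat t \<omega> + (2 * radius t + excess t \<omega>) * width t \<omega>"
      using r_hat_le[OF rad[unfolded d_eq], of "\<lambda>s. feat s \<omega>" "\<lambda>s. rew s \<omega>" "feat t \<omega>" \<theta>star]
      by (simp add: h_def feat_def excess_def c_def d_eq)
    also have "\<dots> \<le> \<theta>star \<bullet> feat t \<omega> + 2 * radius t * width t \<omega> + excess t \<omega>"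
      using width_le_1[OF t \<omega>] excess_nonneg[of t \<omega>] mult_left_mono[of "width t \<omega>" 1 "excess t \<omega>"]
      by (simp add: algebra_simps)
    finally show ?thesis using r_hat_le_1[OF rad[unfolded d_eq]] by (simp add: h_def)
  qed
  have "g (A t \<omega>) = (\<Sum>j\<in>{1..J}. x c j * g (A t \<omega>))"
    unfolding sum_distrib_right[symmetric] x1 by simp
  \<comment> \<open>The maximizer beats every action, hence also their average with the weights of
    the policy at the current context.\<close>
  also have "\<dots> \<le> (\<Sum>j\<in>{1..J}. x c j * (h (A t \<omega>) + excess t \<omega> - r c j + g j))"
  proof (intro sum_mono mult_left_mono x0)
    fix j assume j: "j \<in> {1..J}"
    show "g (A t \<omega>) \<le> h (A t \<omega>) + excess t \<omega> - r c j + g j"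
      using best[OF j] low[OF j] by linarith
  qed
  also have "\<dots> = h (A t \<omega>) + excess t \<omega> - (\<Sum>j\<in>{1..J}. x c j * r c j) + (\<Sum>j\<in>{1..J}. x c j * g j)"
  proof -
    have "(\<Sum>j\<in>{1..J}. x c j * (h (A t \<omega>) + excess t \<omega> - r c j + g j))
        = (\<Sum>j\<in>{1..J}. x c j) * (h (A t \<omega>) + excess t \<omega>) - (\<Sum>j\<in>{1..J}. x c j * r c j) + (\<Sum>j\<in>{1..J}. x c j * g j)"
      by (simp add: algebra_simps sum.distrib sum_subtractf sum_distrib_left sum_distrib_right)
    then show ?thesis unfolding x1 by simp
  qed
  also have "(\<Sum>j\<in>{1..J}. x c j * g j) = (\<Sum>k\<in>{1..K}. (\<Sum>j\<in>{1..J}. x c j * W t k c j \<omega>) * Q k t \<omega>) / V t"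
    unfolding g_def sum_divide_distrib sum_distrib_left sum_distrib_right
    by (subst sum.swap) (simp add: mult.assoc)
  also have "h (A t \<omega>) + excess t \<omega> - (\<Sum>j\<in>{1..J}. x c j * r c j)
        + (\<Sum>k\<in>{1..K}. (\<Sum>j\<in>{1..J}. x c j * W t k c j \<omega>) * Q k t \<omega>) / V t
      \<le> min 1 (\<theta>star \<bullet> feat t \<omega> + 2 * radius t * width t \<omega> + excess t \<omega>) + excess t \<omega>
        - (\<Sum>j\<in>{1..J}. x c j * r c j)
        + (\<Sum>k\<in>{1..K}. (\<Sum>j\<in>{1..J}. x c j * W t k c j \<omega>) * Q k t \<omega>) / V t"
    by (intro add_right_mono diff_right_mono up)
  finally show ?thesis
    unfolding g_def cost_def c_def .
qed

subsubsection \<open>Measurability\<close>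

text \<open>Contexts and actions are countable, so a table entry with random indices is measurable
  once every fixed entry is.\<close>

lemma cost_meas:
  assumes t: "t \<in> {1..T}" and k: "k \<in> {1..K}"
  shows "cost k t \<in> borel_measurable M"
  unfolding cost_def
proof (rule measurable_compose_countable'[OF _ ctx_meas[OF t] countable_C])
  show "(\<lambda>\<omega>. W t k c (A t \<omega>) \<omega>) \<in> borel_measurable M" if "c \<in> C" for c
    by (rule measurable_compose_countable'[OF _ A_meas[OF t]]) (use W_meas[OF t k that] in auto)
qed

lemma feat_meas:
  assumes "ctx t \<in> measurable N (count_space C)" "A t \<in> measurable N (count_space {1..J})"
  shows "feat t \<in> borel_measurable N"
  unfolding feat_def
proof (rule measurable_compose_countable'[OF _ assms(1) countable_C])
  show "(\<lambda>\<omega>. \<phi> c (A t \<omega>)) \<in> borel_measurable N" for c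
    by (rule measurable_compose_countable'[OF _ assms(2)]) auto
qed

lemma rew_meas: "t \<in> {1..T} \<Longrightarrow> rew t \<in> borel_measurable M"
  unfolding rew_eq using feat_meas[OF ctx_meas A_meas] \<eta>_meas
  by (intro borel_measurable_add borel_measurable_inner) auto

text \<open>\<open>sigma\<close> has the intended space and sets only for generators inside the
  power set of the space. Showing that they are events gives this and the subalgebra property at
  once.\<close>

lemma history_generator:
  assumes "n \<le> T"
  shows "(\<Union>s\<in>{1..n}. gen_sets M (ctx s) (count_space C) \<union> gen_sets M (A s) (count_space {1..J}) \<union>
      gen_sets M (\<lambda>\<omega>. R s (A s \<omega>) \<omega>) borel \<union>
      (\<Union>k\<in>{1..K}. gen_sets M (\<lambda>\<omega>. W s k (ctx s \<omega>) (A s \<omega>) \<omega>) borel)) \<subseteq> sets M"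
proof (intro UN_least Un_least)
  fix s assume "s \<in> {1..n}"
  then have s: "s \<in> {1..T}" using assms by auto
  show "gen_sets M (ctx s) (count_space C) \<subseteq> sets M" by (rule gen_sets_subset[OF ctx_meas[OF s]])
  show "gen_sets M (A s) (count_space {1..J}) \<subseteq> sets M" by (rule gen_sets_subset[OF A_meas[OF s]])
  show "gen_sets M (\<lambda>\<omega>. R s (A s \<omega>) \<omega>) borel \<subseteq> sets M"
    by (rule gen_sets_subset[OF rew_meas[OF s, unfolded rew_def]])
  show "gen_sets M (\<lambda>\<omega>. W s k (ctx s \<omega>) (A s \<omega>) \<omega>) borel \<subseteq> sets M" if "k \<in> {1..K}" for k
    by (rule gen_sets_subset[OF cost_meas[OF s that, unfolded cost_def]])
qed

lemma space_H: "n \<le> T \<Longrightarrow> space (H n) = space M"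
  using history_generator[of n] sets.space_closed[of M]
  unfolding history_def by (intro space_measure_of) blast

lemma sets_H:
  assumes "n \<le> T"
  shows "sets (H n) = sigma_sets (space M) (\<Union>s\<in>{1..n}.
      gen_sets M (ctx s) (count_space C) \<union> gen_sets M (A s) (count_space {1..J}) \<union>
      gen_sets M (\<lambda>\<omega>. R s (A s \<omega>) \<omega>) borel \<union>
      (\<Union>k\<in>{1..K}. gen_sets M (\<lambda>\<omega>. W s k (ctx s \<omega>) (A s \<omega>) \<omega>) borel))"
  using history_generator[OF assms] sets.space_closed[of M]
  unfolding history_def by (intro sets_measure_of) blast

lemma subalgebra_H: "n \<le> T \<Longrightarrow> subalgebra M (H n)"
  unfolding subalgebra_def
  using space_H sets_H sets.sigma_sets_subset[OF history_generator] by simp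

lemma
  assumes s: "s \<in> {1..n}" and n: "n \<le> T"
  shows ctx_H: "ctx s \<in> measurable (H n) (count_space C)"
    and A_H: "A s \<in> measurable (H n) (count_space {1..J})"
    and rew_H: "rew s \<in> borel_measurable (H n)"
    and cost_H: "k \<in> {1..K} \<Longrightarrow> cost k s \<in> borel_measurable (H n)"
proof -
  have sT: "s \<in> {1..T}" using s n by auto
  let ?G = "\<lambda>s. gen_sets M (ctx s) (count_space C) \<union> gen_sets M (A s) (count_space {1..J}) \<union>
      gen_sets M (\<lambda>\<omega>. R s (A s \<omega>) \<omega>) borel \<union>
      (\<Union>k\<in>{1..K}. gen_sets M (\<lambda>\<omega>. W s k (ctx s \<omega>) (A s \<omega>) \<omega>) borel)"
  have "?G s \<subseteq> (\<Union>s\<in>{1..n}. ?G s)" by (rule UN_upper[OF s])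
  also have "\<dots> \<subseteq> sets (H n)" unfolding sets_H[OF n] by (rule sigma_sets_superset_generator)
  finally have G: "?G s \<subseteq> sets (H n)" .
  show "ctx s \<in> measurable (H n) (count_space C)"
    by (rule measurable_of_gen_sets[OF _ _ space_H[OF n]]) (use G ctx_in[OF sT] in auto)
  show "A s \<in> measurable (H n) (count_space {1..J})"
    by (rule measurable_of_gen_sets[OF _ _ space_H[OF n]]) (use G A_in[OF sT] in auto)
  show "rew s \<in> borel_measurable (H n)"
    unfolding rew_def by (rule measurable_of_gen_sets[OF _ _ space_H[OF n]]) (use G in auto)
  show "cost k s \<in> borel_measurable (H n)" if "k \<in> {1..K}"
    unfolding cost_def
  proof (rule measurable_of_gen_sets[OF _ _ space_H[OF n]])
    show "gen_sets M (\<lambda>\<omega>. W s k (ctx s \<omega>) (A s \<omega>) \<omega>) borel \<subseteq> sets (H n)" using G that by blast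
  qed auto
qed

lemma feat_H: "s \<in> {1..n} \<Longrightarrow> n \<le> T \<Longrightarrow> feat s \<in> borel_measurable (H n)"
  by (rule feat_meas[OF ctx_H A_H])

text \<open>The noise is not itself observed, but it is the observed reward minus the mean reward of
  the observed feature vector.\<close>

lemma noise_H:
  assumes "s \<in> {1..n}" "n \<le> T"
  shows "\<eta> s \<in> borel_measurable (H n)"
proof -
  have "(\<lambda>\<omega>. rew s \<omega> - \<theta>star \<bullet> feat s \<omega>) \<in> borel_measurable (H n)"
    using rew_H[OF assms] feat_H[OF assms] by (intro borel_measurable_diff borel_measurable_inner) auto
  then show ?thesis by (simp add: rew_eq)
qed

text \<open>Predictability: the queue used in round \<open>n + 1\<close> is determined by the costs
  of the first \<open>n\<close> rounds, which makes it independent of the draw of that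
  round.\<close>

lemma Q_H:
  assumes k: "k \<in> {1..K}" and "n \<le> T"
  shows "Q k (Suc n) \<in> borel_measurable (H n)"
proof -
  have "Q k (Suc i) \<in> borel_measurable (H n)" if "i \<le> n" for i
    using that
  proof (induction i)
    case 0
    have "Q k (Suc 0) = (\<lambda>\<omega>. 0)" by (rule ext) simp
    then show ?case by simp
  next
    case (Suc i)
    have "cost k (Suc i) \<in> borel_measurable (H n)"
      using Suc.prems k assms(2) by (intro cost_H) auto
    moreover have "Q k (Suc i) \<in> borel_measurable (H n)" using Suc by simp
    ultimately have "(\<lambda>\<omega>. max 0 (Q k (Suc i) \<omega> + cost k (Suc i) \<omega> + eps (Suc i))) \<in> borel_measurable (H n)"
      by measurable
    then show ?case
      by (subst measurable_cong[OF Q_Suc]) (use Suc.prems assms(2) in \<open>auto simp: space_H\<close>)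
  qed
  then show ?thesis by simp
qed

lemma pre_reward_generator:
  assumes t: "t \<in> {1..T}"
  shows "sets (H (t - 1)) \<union> gen_sets M (ctx t) (count_space C) \<union> gen_sets M (A t) (count_space {1..J}) \<subseteq> sets M"
proof (intro Un_least)
  have "t - 1 \<le> T" using t by auto
  then show "sets (H (t - 1)) \<subseteq> sets M" using subalgebra_H unfolding subalgebra_def by blast
qed (rule gen_sets_subset[OF ctx_meas[OF t]], rule gen_sets_subset[OF A_meas[OF t]])

lemma space_PR: "t \<in> {1..T} \<Longrightarrow> space (PR t) = space M"
  using pre_reward_generator[of t] sets.space_closed[of M]
  unfolding pre_reward_def by (intro space_measure_of) blast

lemma sets_PR:
  assumes "t \<in> {1..T}"
  shows "sets (PR t) = sigma_sets (space M) (sets (H (t - 1)) \<union> gen_sets M (ctx t) (count_space C)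
    \<union> gen_sets M (A t) (count_space {1..J}))"
  using pre_reward_generator[OF assms] sets.space_closed[of M]
  unfolding pre_reward_def by (intro sets_measure_of) blast

lemma subalgebra_PR:
  assumes t: "t \<in> {1..T}"
  shows "subalgebra M (PR t)"
  unfolding subalgebra_def space_PR[OF t] sets_PR[OF t]
  by (intro conjI refl sets.sigma_sets_subset pre_reward_generator t)

lemma subalgebra_PR_H:
  assumes t: "t \<in> {1..T}"
  shows "subalgebra (PR t) (H (t - 1))"
proof -
  have "t - 1 \<le> T" using t by auto
  moreover have "sets (H (t - 1)) \<subseteq> sets (PR t)"
    unfolding sets_PR[OF t] by (intro subsetI sigma_sets.Basic UnI1)
  ultimately show ?thesis unfolding subalgebra_def by (simp only: space_PR[OF t] space_H simp_thms)
qed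

lemma feat_PR:
  assumes t: "t \<in> {1..T}"
  shows "feat t \<in> borel_measurable (PR t)"
proof (rule feat_meas)
  have 1: "gen_sets M (ctx t) (count_space C) \<subseteq> sets (PR t)"
    unfolding sets_PR[OF t] by (rule subsetI, rule sigma_sets.Basic, rule UnI1, rule UnI2)
  have 2: "gen_sets M (A t) (count_space {1..J}) \<subseteq> sets (PR t)"
    unfolding sets_PR[OF t] by (rule subsetI, rule sigma_sets.Basic, rule UnI2)
  show "ctx t \<in> measurable (PR t) (count_space C)"
    by (rule measurable_of_gen_sets[OF _ 1 space_PR[OF t]]) (use ctx_in[OF t] in auto)
  show "A t \<in> measurable (PR t) (count_space {1..J})"
    by (rule measurable_of_gen_sets[OF _ 2 space_PR[OF t]]) (use A_in[OF t] in auto)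
qed

lemma width_meas: "t \<in> {1..T} \<Longrightarrow> width t \<in> borel_measurable M"
  by (intro measurable_dual_norm feat_meas ctx_meas A_meas) auto

lemma noise_integral:
  assumes t: "t \<in> {1..T}"
  shows "integrable M (\<eta> t)" "(\<integral>\<omega>. \<eta> t \<omega> \<partial>M) = 0"
proof -
  interpret sigma_finite_subalgebra M "PR t"
    by (rule sigma_finite_subalgebraI[OF subalgebra_PR[OF t]])
  show int: "integrable M (\<eta> t)" using \<eta>_zero_mean[OF t] by (simp add: cond_zero_mean_def)
  have "(\<integral>\<omega>. \<eta> t \<omega> \<partial>M) = (\<integral>\<omega>. real_cond_exp M (PR t) (\<eta> t) \<omega> \<partial>M)"
    using real_cond_exp_int(2)[OF int] by simp
  also have "\<dots> = 0"
    using \<eta>_zero_mean[OF t] by (intro integral_eq_zero_AE) (simp add: cond_zero_mean_def)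
  finally show "(\<integral>\<omega>. \<eta> t \<omega> \<partial>M) = 0" .
qed

subsubsection \<open>Fresh draws\<close>

lemma policy_nonneg:
  assumes "is_policy C J x" "c \<in> C" "j \<in> {1..J}"
  shows "0 \<le> x c j"
  using assms by (auto simp: is_policy_def)

lemma round_draw_generator:
  assumes t: "t \<in> {1..T}"
  shows "gen_sets M (ctx t) (count_space C) \<union>
      (\<Union>k\<in>{1..K}. \<Union>c\<in>C. \<Union>j\<in>{1..J}. gen_sets M (W t k c j) borel) \<subseteq> sets M"
  using gen_sets_subset[OF ctx_meas[OF t]] gen_sets_subset[OF W_meas[OF t]]
  by (intro Un_least UN_least) auto

lemma round_draw_meas:
  assumes t: "t \<in> {1..T}"
  shows "space (round_draw M C J K ctx W t) = space M"
    and "ctx t \<in> measurable (round_draw M C J K ctx W t) (count_space C)"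
    and "k \<in> {1..K} \<Longrightarrow> c \<in> C \<Longrightarrow> j \<in> {1..J} \<Longrightarrow> W t k c j \<in> borel_measurable (round_draw M C J K ctx W t)"
proof -
  let ?D = "round_draw M C J K ctx W t"
  let ?G = "gen_sets M (ctx t) (count_space C) \<union>
      (\<Union>k\<in>{1..K}. \<Union>c\<in>C. \<Union>j\<in>{1..J}. gen_sets M (W t k c j) borel)"
  have G: "?G \<subseteq> Pow (space M)" using round_draw_generator[OF t] sets.space_closed[of M] by blast
  show sp: "space ?D = space M" unfolding round_draw_def by (rule space_measure_of[OF G])
  have "sets ?D = sigma_sets (space M) ?G" unfolding round_draw_def by (rule sets_measure_of[OF G])
  then have sub: "?G \<subseteq> sets ?D" by (simp add: sigma_sets_superset_generator)
  show "ctx t \<in> measurable ?D (count_space C)"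
    by (rule measurable_of_gen_sets[OF _ _ sp]) (use sub ctx_in[OF t] in auto)
  show "W t k c j \<in> borel_measurable ?D" if "k \<in> {1..K}" "c \<in> C" "j \<in> {1..J}"
  proof (rule measurable_of_gen_sets[OF _ _ sp])
    show "gen_sets M (W t k c j) borel \<subseteq> sets ?D" using sub that by blast
  qed auto
qed

text \<open>The cost of a stationary randomized policy in round \<open>t\<close> with its
  randomization averaged out. Unlike the incurred cost, it is a function of the draw of the round
  alone.\<close>

definition policy_cost :: "('c \<Rightarrow> nat \<Rightarrow> real) \<Rightarrow> nat \<Rightarrow> nat \<Rightarrow> 'o \<Rightarrow> real" where
  "policy_cost x k t \<omega> = (\<Sum>j\<in>{1..J}. x (ctx t \<omega>) j * W t k (ctx t \<omega>) j \<omega>)"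

definition policy_reward :: "('c \<Rightarrow> nat \<Rightarrow> real) \<Rightarrow> nat \<Rightarrow> 'o \<Rightarrow> real" where
  "policy_reward x t \<omega> = (\<Sum>j\<in>{1..J}. x (ctx t \<omega>) j * r (ctx t \<omega>) j)"

lemma sum_policy_bound:
  assumes x: "is_policy C J x" and c: "c \<in> C" and f: "\<And>j. j \<in> {1..J} \<Longrightarrow> \<bar>f j\<bar> \<le> (1::real)"
  shows "\<bar>\<Sum>j\<in>{1..J}. x c j * f j\<bar> \<le> 1"
proof -
  have "\<bar>\<Sum>j\<in>{1..J}. x c j * f j\<bar> \<le> (\<Sum>j\<in>{1..J}. \<bar>x c j * f j\<bar>)" by (rule sum_abs)
  also have "\<dots> \<le> (\<Sum>j\<in>{1..J}. x c j)"
  proof (rule sum_mono)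
    fix j assume j: "j \<in> {1..J}"
    show "\<bar>x c j * f j\<bar> \<le> x c j"
      using policy_nonneg[OF x c j] mult_left_mono[OF f[OF j], of "x c j"] by (simp add: abs_mult)
  qed
  also have "\<dots> = 1" using x c by (auto simp: is_policy_def)
  finally show ?thesis .
qed

lemma policy_cost_bound:
  assumes "is_policy C J x" "k \<in> {1..K}" "t \<in> {1..T}" "\<omega> \<in> space M"
  shows "\<bar>policy_cost x k t \<omega>\<bar> \<le> 1"
  unfolding policy_cost_def
  using assms ctx_in by (intro sum_policy_bound W_bound) auto

lemma policy_cost_round_draw:
  assumes "k \<in> {1..K}" "t \<in> {1..T}"
  shows "policy_cost x k t \<in> borel_measurable (round_draw M C J K ctx W t)"
  unfolding policy_cost_def
  by (rule measurable_compose_countable'[OF _ round_draw_meas(2)[OF assms(2)] countable_C])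
     (intro borel_measurable_sum borel_measurable_times borel_measurable_const round_draw_meas(3) assms, auto)

lemma policy_cost_meas:
  assumes "k \<in> {1..K}" "t \<in> {1..T}"
  shows "policy_cost x k t \<in> borel_measurable M"
  unfolding policy_cost_def
  by (rule measurable_compose_countable'[OF _ ctx_meas[OF assms(2)] countable_C])
     (intro borel_measurable_sum borel_measurable_times borel_measurable_const W_meas assms, auto)

lemma policy_cost_integrable:
  assumes "is_policy C J x" "k \<in> {1..K}" "t \<in> {1..T}"
  shows "integrable M (policy_cost x k t)"
  by (rule integrable_const_bound[of _ 1])
     (use policy_cost_bound[OF assms] policy_cost_meas[OF assms(2,3)] in auto)

text \<open>For a fixed context the independence of context and cost within a round splits the mean;
  equality in distribution then moves the cost to round 1, where \<open>w\<close> is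
  defined.\<close>

lemma integral_context_cost:
  assumes t: "t \<in> {1..T}" and k: "k \<in> {1..K}" and c: "c \<in> C" and j: "j \<in> {1..J}"
  shows "integrable M (\<lambda>\<omega>. indicator {\<omega>. ctx t \<omega> = c} \<omega> * W t k c j \<omega>)"
    and "(\<integral>\<omega>. indicator {\<omega>. ctx t \<omega> = c} \<omega> * W t k c j \<omega> \<partial>M) = p c * w k c j"
proof -
  let ?F = "vimage_algebra (space M) (ctx t) (count_space C)"
  let ?G = "vimage_algebra (space M) (W t k c j) borel"
  have F: "ctx t \<in> measurable ?F (count_space C)"
    using ctx_in[OF t] by (intro measurable_vimage_algebra1) auto
  have ind: "(\<lambda>\<omega>. indicator {\<omega>. ctx t \<omega> = c} \<omega> :: real) \<in> borel_measurable N"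
    if "ctx t \<in> measurable N (count_space C)" for N
    using measurable_compose[OF that, of "\<lambda>c'. if c' = c then 1 else 0 :: real" borel]
    by (simp add: indicator_def of_bool_def)
  have indM: "(\<lambda>\<omega>. indicator {\<omega>. ctx t \<omega> = c} \<omega> :: real) \<in> borel_measurable M"
    by (rule ind[OF ctx_meas[OF t]])
  have int1: "integrable M (\<lambda>\<omega>. indicator {\<omega>. ctx t \<omega> = c} \<omega> :: real)"
    by (rule integrable_const_bound[of _ 1]) (use indM in \<open>auto simp: indicator_def\<close>)
  have W: "W t k c j \<in> borel_measurable M" by (rule W_meas[OF t k c j])
  have int2: "integrable M (W t k c j)"
    by (rule integrable_const_bound[of _ 1]) (use W W_bound[OF t k c j] in auto)
  show "integrable M (\<lambda>\<omega>. indicator {\<omega>. ctx t \<omega> = c} \<omega> * W t k c j \<omega>)"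
    by (rule integrable_const_bound[of _ 1]) (use W indM W_bound[OF t k c j] in \<open>auto simp: indicator_def\<close>)
  have "(\<integral>\<omega>. indicator {\<omega>. ctx t \<omega> = c} \<omega> * W t k c j \<omega> \<partial>M)
      = (\<integral>\<omega>. indicator {\<omega>. ctx t \<omega> = c} \<omega> \<partial>M) * (\<integral>\<omega>. W t k c j \<omega> \<partial>M)"
    by (rule indep_set_integral_mult[OF W_ctx_indep[OF t k c j] _ _ ind[OF F] int1 _ int2])
       (auto intro: measurable_vimage_algebra1)
  also have "(\<integral>\<omega>. W t k c j \<omega> \<partial>M) = w k c j"
  proof -
    have T1: "1 \<in> {1..T}" using T_pos by simp
    have "(\<integral>\<omega>. W t k c j \<omega> \<partial>M) = (\<integral>y. y \<partial>distr M borel (W t k c j))"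
      using W by (subst integral_distr) auto
    also have "\<dots> = (\<integral>\<omega>. W 1 k c j \<omega> \<partial>M)"
      unfolding W_ident[OF t k c j] using W_meas[OF T1 k c j] by (subst integral_distr) auto
    finally show ?thesis by (simp add: w_eq)
  qed
  also have "(\<integral>\<omega>. indicator {\<omega>. ctx t \<omega> = c} \<omega> \<partial>M) = p c"
  proof -
    have "(\<integral>\<omega>. indicator {\<omega>. ctx t \<omega> = c} \<omega> \<partial>M) = (\<integral>\<omega>. indicator {\<omega>\<in>space M. ctx t \<omega> = c} \<omega> \<partial>M :: real)"
      by (intro Bochner_Integration.integral_cong) (auto simp: indicator_def)
    also have "\<dots> = p c" using ctx_law[OF t c] by (simp add: Int_def conj_commute)
    finally show ?thesis .
  qed
  finally show "(\<integral>\<omega>. indicator {\<omega>. ctx t \<omega> = c} \<omega> * W t k c j \<omega> \<partial>M) = p c * w k c j" .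
qed

text \<open>The table entries are selected by the random context, hence the decomposition over the
  countably many contexts before each piece is factorized.\<close>

lemma integral_policy_cost:
  assumes x: "is_policy C J x" and k: "k \<in> {1..K}" and t: "t \<in> {1..T}"
  shows "(\<integral>\<omega>. policy_cost x k t \<omega> \<partial>M) = policy_avg C J p (w k) x"
proof -
  let ?f = "\<lambda>c \<omega>. \<Sum>j\<in>{1..J}. x c j * W t k c j \<omega>"
  have "((\<lambda>c. \<integral>\<omega>. indicator {\<omega>. ctx t \<omega> = c} \<omega> * ?f c \<omega> \<partial>M) has_sum (\<integral>\<omega>. ?f (ctx t \<omega>) \<omega> \<partial>M)) C"
  proof (rule has_sum_integral_countable[OF ctx_meas[OF t] countable_C])
    show "?f c \<in> borel_measurable M" if "c \<in> C" for c
      using that by (intro borel_measurable_sum borel_measurable_times borel_measurable_const W_meas k t)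
    show "\<bar>?f c \<omega>\<bar> \<le> 1" if "c \<in> C" "\<omega> \<in> space M" for c \<omega>
      using that by (intro sum_policy_bound[OF x] W_bound k t)
  qed
  moreover have "(\<integral>\<omega>. indicator {\<omega>. ctx t \<omega> = c} \<omega> * ?f c \<omega> \<partial>M) = (\<Sum>j\<in>{1..J}. p c * w k c j * x c j)"
    if c: "c \<in> C" for c
  proof -
    have "(\<integral>\<omega>. indicator {\<omega>. ctx t \<omega> = c} \<omega> * ?f c \<omega> \<partial>M)
        = (\<integral>\<omega>. (\<Sum>j\<in>{1..J}. x c j * (indicator {\<omega>. ctx t \<omega> = c} \<omega> * W t k c j \<omega>)) \<partial>M)"
      by (simp add: sum_distrib_left mult_ac)
    also have "\<dots> = (\<Sum>j\<in>{1..J}. \<integral>\<omega>. x c j * (indicator {\<omega>. ctx t \<omega> = c} \<omega> * W t k c j \<omega>) \<partial>M)"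
      by (intro Bochner_Integration.integral_sum integrable_mult_right integral_context_cost(1) t k c)
    also have "\<dots> = (\<Sum>j\<in>{1..J}. p c * w k c j * x c j)"
      by (intro sum.cong refl) (subst integral_mult_right_zero, simp add: integral_context_cost(2)[OF t k c])
    finally show ?thesis .
  qed
  ultimately have "((\<lambda>c. \<Sum>j\<in>{1..J}. p c * w k c j * x c j) has_sum (\<integral>\<omega>. policy_cost x k t \<omega> \<partial>M)) C"
    unfolding policy_cost_def by (subst has_sum_cong[symmetric]) auto
  then show ?thesis unfolding policy_avg_def by (simp add: infsumI)
qed

lemma policy_reward_range:
  assumes x: "is_policy C J x" and t: "t \<in> {1..T}" and \<omega>: "\<omega> \<in> space M"
  shows "policy_reward x t \<omega> \<in> {0..1}"
proof -
  have c: "ctx t \<omega> \<in> C" by (rule ctx_in[OF t \<omega>])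
  have "0 \<le> policy_reward x t \<omega>"
    unfolding policy_reward_def using policy_nonneg[OF x c] r_range[OF c]
    by (intro sum_nonneg mult_nonneg_nonneg) auto
  moreover have "\<bar>policy_reward x t \<omega>\<bar> \<le> 1"
    unfolding policy_reward_def using r_range[OF c] by (intro sum_policy_bound[OF x c]) auto
  ultimately show ?thesis by auto
qed

lemma policy_reward_meas: "t \<in> {1..T} \<Longrightarrow> policy_reward x t \<in> borel_measurable M"
  unfolding policy_reward_def
  by (rule measurable_compose_countable'[OF _ ctx_meas countable_C]) auto

lemma policy_reward_integrable:
  assumes "is_policy C J x" "t \<in> {1..T}"
  shows "integrable M (policy_reward x t)"
  by (rule integrable_const_bound[of _ 1])
     (use policy_reward_range[OF assms] policy_reward_meas[OF assms(2)] in \<open>auto simp: abs_le_iff\<close>)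

lemma integral_policy_reward:
  assumes x: "is_policy C J x" and t: "t \<in> {1..T}"
  shows "(\<integral>\<omega>. policy_reward x t \<omega> \<partial>M) = policy_avg C J p r x"
proof -
  let ?f = "\<lambda>c (\<omega>::'o). \<Sum>j\<in>{1..J}. x c j * r c j"
  have "((\<lambda>c. \<integral>\<omega>. indicator {\<omega>. ctx t \<omega> = c} \<omega> * ?f c \<omega> \<partial>M) has_sum (\<integral>\<omega>. ?f (ctx t \<omega>) \<omega> \<partial>M)) C"
  proof (rule has_sum_integral_countable[OF ctx_meas[OF t] countable_C])
    show "\<bar>?f c \<omega>\<bar> \<le> 1" if "c \<in> C" "\<omega> \<in> space M" for c \<omega>
      using that r_range by (intro sum_policy_bound[OF x]) auto
  qed auto
  moreover have "(\<integral>\<omega>. indicator {\<omega>. ctx t \<omega> = c} \<omega> * ?f c \<omega> \<partial>M) = (\<Sum>j\<in>{1..J}. p c * r c j * x c j)"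
    if c: "c \<in> C" for c
  proof -
    have "(\<integral>\<omega>. indicator {\<omega>. ctx t \<omega> = c} \<omega> * ?f c \<omega> \<partial>M)
        = (\<integral>\<omega>. indicator {\<omega>\<in>space M. ctx t \<omega> = c} \<omega> * (\<Sum>j\<in>{1..J}. x c j * r c j) \<partial>M)"
      by (intro Bochner_Integration.integral_cong) (auto simp: indicator_def)
    also have "\<dots> = p c * (\<Sum>j\<in>{1..J}. x c j * r c j)"
      using ctx_law[OF t c] by (simp add: Int_def conj_commute)
    finally show ?thesis by (simp add: sum_distrib_left mult_ac)
  qed
  ultimately have "((\<lambda>c. \<Sum>j\<in>{1..J}. p c * r c j * x c j) has_sum (\<integral>\<omega>. policy_reward x t \<omega> \<partial>M)) C"
    unfolding policy_reward_def by (subst has_sum_cong[symmetric]) auto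
  then show ?thesis unfolding policy_avg_def by (simp add: infsumI)
qed

text \<open>Freshness of the draw enters here. The weights \<open>Z\<close> used later are the
  queues and, for the drift of their norm, normalized queues times an exponential.\<close>

lemma fresh_policy_cost:
  assumes x: "is_policy C J x" and k: "k \<in> {1..K}" and t: "t \<in> {1..T}"
    and Z: "Z \<in> borel_measurable (H (t - 1))" "integrable M Z"
  shows "(\<integral>\<omega>. policy_cost x k t \<omega> * Z \<omega> \<partial>M) = policy_avg C J p (w k) x * (\<integral>\<omega>. Z \<omega> \<partial>M)"
proof -
  have int: "integrable M (policy_cost x k t)" by (rule policy_cost_integrable[OF x k t])
  have "t - 1 \<le> T" using t by auto
  then show ?thesis
    using indep_set_integral_mult[OF fresh[OF t] round_draw_meas(1)[OF t] space_H policy_cost_round_draw[OF k t] int Z]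
    by (simp add: integral_policy_cost[OF x k t])
qed

text \<open>Linearity is read off from expectations in round 1, which spares summability arguments
  for the unconditional sums.\<close>

lemma policy_avg_mix:
  assumes x: "is_policy C J x" and y: "is_policy C J y" and l: "0 \<le> l" "l \<le> 1"
  shows "is_policy C J (\<lambda>c j. (1 - l) * x c j + l * y c j)"
    and "k \<in> {1..K} \<Longrightarrow> policy_avg C J p (w k) (\<lambda>c j. (1 - l) * x c j + l * y c j)
           = (1 - l) * policy_avg C J p (w k) x + l * policy_avg C J p (w k) y"
    and "policy_avg C J p r (\<lambda>c j. (1 - l) * x c j + l * y c j)
           = (1 - l) * policy_avg C J p r x + l * policy_avg C J p r y"
proof -
  let ?z = "\<lambda>c j. (1 - l) * x c j + l * y c j"
  have T1: "1 \<in> {1..T}" using T_pos by simp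
  show z: "is_policy C J ?z"
    using x y l by (auto simp: is_policy_def sum.distrib sum_distrib_left[symmetric])
  show "policy_avg C J p (w k) ?z = (1 - l) * policy_avg C J p (w k) x + l * policy_avg C J p (w k) y"
    if k: "k \<in> {1..K}"
  proof -
    have "policy_cost ?z k 1 \<omega> = (1 - l) * policy_cost x k 1 \<omega> + l * policy_cost y k 1 \<omega>" for \<omega>
      by (simp add: policy_cost_def sum_distrib_left sum.distrib[symmetric] algebra_simps)
    then have "(\<integral>\<omega>. policy_cost ?z k 1 \<omega> \<partial>M) = (1 - l) * (\<integral>\<omega>. policy_cost x k 1 \<omega> \<partial>M) + l * (\<integral>\<omega>. policy_cost y k 1 \<omega> \<partial>M)"
      using policy_cost_integrable[OF x k T1] policy_cost_integrable[OF y k T1] by simp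
    then show ?thesis using integral_policy_cost[OF _ k T1] x y z by simp
  qed
  show "policy_avg C J p r ?z = (1 - l) * policy_avg C J p r x + l * policy_avg C J p r y"
  proof -
    have "policy_reward ?z 1 \<omega> = (1 - l) * policy_reward x 1 \<omega> + l * policy_reward y 1 \<omega>" for \<omega>
      by (simp add: policy_reward_def sum_distrib_left sum.distrib[symmetric] algebra_simps)
    then have "(\<integral>\<omega>. policy_reward ?z 1 \<omega> \<partial>M) = (1 - l) * (\<integral>\<omega>. policy_reward x 1 \<omega> \<partial>M) + l * (\<integral>\<omega>. policy_reward y 1 \<omega> \<partial>M)"
      using policy_reward_integrable[OF x T1] policy_reward_integrable[OF y T1] by simp
    then show ?thesis using integral_policy_reward[OF _ T1] x y z by simp
  qed
qed

lemma policy_avg_reward_range: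
  assumes x: "is_policy C J x"
  shows "policy_avg C J p r x \<in> {0..1}"
proof -
  have T1: "1 \<in> {1..T}" using T_pos by simp
  have int: "integrable M (policy_reward x 1)" by (rule policy_reward_integrable[OF x T1])
  have "0 \<le> (\<integral>\<omega>. policy_reward x 1 \<omega> \<partial>M)"
    using policy_reward_range[OF x T1] by (intro integral_nonneg_AE) auto
  moreover have "(\<integral>\<omega>. policy_reward x 1 \<omega> \<partial>M) \<le> 1"
    using policy_reward_range[OF x T1] int by (intro integral_le_const) auto
  ultimately show ?thesis unfolding integral_policy_reward[OF x T1] by simp
qed

end

subsection \<open>Elementary sums\<close>

lemma sum_inverse_sqrt_le: "(\<Sum>t\<in>{1..n}. 1 / sqrt (real t)) \<le> 2 * sqrt (real n)"
proof (induction n)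
  case (Suc n)
  define a b where "a = sqrt (real n)" and "b = sqrt (real (Suc n))"
  have ab: "0 \<le> a" "0 < b" "a\<^sup>2 = real n" "b\<^sup>2 = real n + 1" by (auto simp: a_def b_def)
  have "0 \<le> (b - a)\<^sup>2" by simp
  then have "2 * a * b + 1 \<le> 2 * b * b" using ab by (simp add: power2_eq_square algebra_simps)
  then have "2 * a + 1 / b \<le> 2 * b" using ab by (simp add: field_simps)
  then show ?case using Suc by (simp add: a_def b_def)
qed simp

lemma sum_inverse_sqrt_ge: "2 * sqrt (real n + 1) - 2 \<le> (\<Sum>t\<in>{1..n}. 1 / sqrt (real t))"
proof (induction n)
  case (Suc n)
  define a b where "a = sqrt (real n + 1)" and "b = sqrt (real n + 2)"
  have ab: "0 < a" "0 < b" "a\<^sup>2 = real n + 1" "b\<^sup>2 = real n + 2" by (auto simp: a_def b_def)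
  have "0 \<le> (b - a)\<^sup>2" by simp
  then have "2 * a * b \<le> 2 * a * a + 1" using ab by (simp add: power2_eq_square algebra_simps)
  then have "2 * b \<le> 2 * a + 1 / a" using ab by (simp add: field_simps)
  then show ?case using Suc by (simp add: a_def b_def add.commute)
qed simp

lemma sum_sqrt_ge: "2 / 3 * (real n * sqrt (real n)) \<le> (\<Sum>t\<in>{1..n}. sqrt (real t))"
proof (induction n)
  case (Suc n)
  define a b where "a = sqrt (real n)" and "b = sqrt (real (Suc n))"
  have ab: "0 \<le> a" "0 < b" "a\<^sup>2 = real n" "b\<^sup>2 = real n + 1" "a \<le> b" by (auto simp: a_def b_def)
  \<comment> \<open>Expanded, this is \<open>b\<^sup>3 - a\<^sup>3 \<le> 3 / 2 * b * (b\<^sup>2 -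
    a\<^sup>2)\<close>, and the last bracket is 1.\<close>
  have "0 \<le> (b - a)\<^sup>2 * (b + 2 * a)" using ab by (intro mult_nonneg_nonneg) auto
  then have "2 * (b\<^sup>2 * b) \<le> 2 * (a\<^sup>2 * a) + 3 * ((b\<^sup>2 - a\<^sup>2) * b)"
    by (simp add: power2_eq_square algebra_simps)
  moreover have "b\<^sup>2 - a\<^sup>2 = 1" using ab by simp
  ultimately have "2 / 3 * (real (Suc n) * b) \<le> 2 / 3 * (real n * a) + b" using ab by (simp add: algebra_simps)
  then show ?case using Suc by (simp add: a_def b_def)
qed simp

lemma sum_inverse_three_halves_le: "(\<Sum>t\<in>{1..n}. 1 / (real t * sqrt (real t))) \<le> 3"
proof -
  \<comment> \<open>The subtracted \<open>2 / sqrt n\<close> is the tail of the comparison integral;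
    it makes the bound inductive.\<close>
  have "n \<ge> 1 \<Longrightarrow> (\<Sum>t\<in>{1..n}. 1 / (real t * sqrt (real t))) \<le> 3 - 2 / sqrt (real n)"
  proof (induction n rule: nat_induct_at_least)
    case (Suc n)
    define a b where "a = sqrt (real n)" and "b = sqrt (real (Suc n))"
    have ab: "0 < a" "0 < b" "a\<^sup>2 = real n" "b\<^sup>2 = real n + 1" "a \<le> b" using Suc by (auto simp: a_def b_def)
    have "(a * b) * (a + b) \<le> (b * b) * (b + b)" using ab by (intro mult_mono) auto
    moreover have "(b - a) * (a + b) = 1" using ab by (simp add: power2_eq_square algebra_simps)
    ultimately have "1 / (b * b * b) \<le> 2 / a - 2 / b"
    proof -
      assume le: "(a * b) * (a + b) \<le> (b * b) * (b + b)" and one: "(b - a) * (a + b) = 1"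
      have "1 / (b * b * b) = 2 / ((b * b) * (b + b))" using ab by (simp add: field_simps)
      also have "\<dots> \<le> 2 / ((a * b) * (a + b))" using ab le by (intro divide_left_mono) auto
      also have "\<dots> = 2 * ((b - a) * (a + b)) / ((a * b) * (a + b))" by (simp add: one)
      also have "\<dots> = 2 * (b - a) / (a * b)" using ab by simp
      also have "\<dots> = 2 / a - 2 / b" using ab by (simp add: field_simps)
      finally show ?thesis .
    qed
    moreover have "b * b = real (Suc n)" using ab by (simp add: power2_eq_square)
    ultimately have "1 / (real (Suc n) * b) \<le> 2 / a - 2 / b" by metis
    then show ?case using Suc by (simp add: a_def b_def)
  qed simp
  then show ?thesis by (cases "n \<ge> 1") (force intro: order_trans)+
qed

text \<open>Summation by parts: since \<open>V\<close> increases, each nonnegative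
  \<open>a t\<close> is subtracted with at least the coefficient with which it returns, and the
  induction carries the term \<open>- a (Suc n) / V n\<close>. This copes with a penalty parameter
  that varies with the round.\<close>

lemma sum_telescope_weighted_le:
  fixes a V :: "nat \<Rightarrow> real"
  assumes a: "\<And>t. 0 \<le> a t" "a 1 = 0" and V: "\<And>t. t \<ge> 1 \<Longrightarrow> 0 < V t" "\<And>t. t \<ge> 1 \<Longrightarrow> V t \<le> V (Suc t)"
  shows "(\<Sum>t\<in>{1..n}. (a t - a (Suc t)) / V t) \<le> 0"
proof (cases "n \<ge> 1")
  case True
  then have "(\<Sum>t\<in>{1..n}. (a t - a (Suc t)) / V t) \<le> - a (Suc n) / V n"
  proof (induction n rule: nat_induct_at_least)
    case base
    then show ?case using a by simp
  next
    case (Suc n)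
    have "a (Suc n) / V (Suc n) \<le> a (Suc n) / V n"
      using a V[of n] V(1)[of "Suc n"] Suc by (intro divide_left_mono) auto
    then show ?case using Suc by (simp add: diff_divide_distrib)
  qed
  also have "\<dots> \<le> 0" using a V[of n] True by (simp add: divide_nonneg_pos)
  finally show ?thesis .
qed simp

text \<open>The rounds with \<open>a / sqrt t > \<delta>\<close>, in which the tightened problem need not be feasible.\<close>

lemma early_rounds_sum_le:
  fixes a \<delta> :: real
  assumes a: "a > 0" and \<delta>: "\<delta> > 0"
  shows "(\<Sum>t\<in>{1..n}. (sqrt (real t) + 2 * a) * max 0 (a / sqrt (real t) - \<delta>))
           \<le> a ^ 3 / (3 * \<delta>\<^sup>2) + 2 * a ^ 3 / \<delta>"
proof -
  \<comment> \<open>The last round with \<open>a / sqrt t \<ge> \<delta>\<close>, cut off at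
    \<open>n\<close>.\<close>
  define N where "N = min n (nat \<lfloor>(a / \<delta>)\<^sup>2\<rfloor>)"
  let ?f = "\<lambda>t. (sqrt (real t) + 2 * a) * max 0 (a / sqrt (real t) - \<delta>)"
  have N: "a / sqrt (real t) \<ge> \<delta> \<longleftrightarrow> t \<le> N" if "t \<in> {1..n}" for t
  proof -
    have "a / sqrt (real t) \<ge> \<delta> \<longleftrightarrow> sqrt (real t) \<le> a / \<delta>"
      using that \<delta> by (simp add: field_simps)
    also have "\<dots> \<longleftrightarrow> real t \<le> (a / \<delta>)\<^sup>2"
      using a \<delta> by (metis divide_pos_pos less_imp_le real_sqrt_abs real_sqrt_le_iff abs_of_nonneg)
    also have "\<dots> \<longleftrightarrow> t \<le> N"
      using that by (simp add: N_def le_nat_iff le_floor_iff)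
    finally show ?thesis .
  qed
  have "sum ?f {1..n} = sum ?f {1..N}"
  proof (rule sum.mono_neutral_right)
    show "\<forall>t\<in>{1..n} - {1..N}. ?f t = 0" using N by (auto simp: not_le max_def)
  qed (auto simp: N_def)
  also have "\<dots> = (\<Sum>t\<in>{1..N}. a - \<delta> * sqrt (real t) + 2 * a * (a * (1 / sqrt (real t)) - \<delta>))"
  proof (rule sum.cong)
    fix t assume t: "t \<in> {1..N}"
    then have "max 0 (a / sqrt (real t) - \<delta>) = a / sqrt (real t) - \<delta>" using N[of t] by (auto simp: N_def)
    then show "?f t = a - \<delta> * sqrt (real t) + 2 * a * (a * (1 / sqrt (real t)) - \<delta>)"
    proof -
      have "(s + 2 * a) * (a / s - \<delta>) = a - \<delta> * s + 2 * a * (a * (1 / s) - \<delta>)" if "s > 0" for s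
        using that by (simp add: field_simps)
      from this[of "sqrt (real t)"] \<open>max 0 (a / sqrt (real t) - \<delta>) = _\<close> t show ?thesis by simp
    qed
  qed simp
  also have "\<dots> = (a * real N - \<delta> * (\<Sum>t\<in>{1..N}. sqrt (real t)))
      + 2 * a * (a * (\<Sum>t\<in>{1..N}. 1 / sqrt (real t)) - \<delta> * real N)"
  proof -
    have "(\<Sum>t\<in>{1..N}. a - \<delta> * v t + 2 * a * (a * u t - \<delta>))
        = (a * real N - \<delta> * sum v {1..N}) + 2 * a * (a * sum u {1..N} - \<delta> * real N)" for u v :: "nat \<Rightarrow> real"
      by (simp add: sum.distrib sum_subtractf sum_distrib_left algebra_simps)
    then show ?thesis .
  qed
  also have "\<dots> \<le> (a * real N - \<delta> * (2 / 3 * (real N * sqrt (real N)))) + 2 * a * (a * (2 * sqrt (real N)) - \<delta> * real N)"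
    using a \<delta> sum_sqrt_ge[of N] sum_inverse_sqrt_le[of N]
    by (intro add_mono diff_mono mult_left_mono) auto
  also have "\<dots> \<le> a ^ 3 / (3 * \<delta>\<^sup>2) + 2 * a ^ 3 / \<delta>"
  proof (rule add_mono)
    define s where "s = sqrt (real N)"
    have s: "0 \<le> s" "real N = s\<^sup>2" by (auto simp: s_def)
    \<comment> \<open>As a function of \<open>s = sqrt N\<close> the first bracket is a cubic with
      maximum \<open>a ^ 3 / (3 * \<delta>\<^sup>2)\<close> at \<open>s = a / \<delta>\<close>; the
      nonnegative product has its double root there.\<close>
    have "0 \<le> (\<delta> * s - a)\<^sup>2 * (2 * (\<delta> * s) + a)" using a \<delta> s by (intro mult_nonneg_nonneg) auto
    also have "\<dots> = a ^ 3 - 3 * \<delta>\<^sup>2 * (a * s\<^sup>2 - \<delta> * (2 / 3 * (s\<^sup>2 * s)))"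
      by (simp add: power2_eq_square power3_eq_cube algebra_simps)
    finally show "a * real N - \<delta> * (2 / 3 * (real N * sqrt (real N))) \<le> a ^ 3 / (3 * \<delta>\<^sup>2)"
      using \<delta> by (simp add: s(2)[symmetric] s_def[symmetric] pos_le_divide_eq mult.commute)
    have "0 \<le> (a - \<delta> * s)\<^sup>2" by simp
    also have "\<dots> = a\<^sup>2 - \<delta> * (a * (2 * s) - \<delta> * s\<^sup>2)" by (simp add: power2_eq_square algebra_simps)
    finally have "a * (2 * s) - \<delta> * s\<^sup>2 \<le> a\<^sup>2 / \<delta>" using \<delta> by (simp add: pos_le_divide_eq mult.commute)
    then have "2 * a * (a * (2 * s) - \<delta> * s\<^sup>2) \<le> 2 * a * (a\<^sup>2 / \<delta>)" using a by (intro mult_left_mono) auto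
    then show "2 * a * (a * (2 * sqrt (real N)) - \<delta> * real N) \<le> 2 * a ^ 3 / \<delta>"
      by (simp only: s_def[symmetric]) (simp add: s power2_eq_square power3_eq_cube mult_ac)
  qed
  finally show ?thesis .
qed

context pess_opt_bandit
begin

subsection \<open>Expected confidence violations\<close>

definition sn :: "nat \<Rightarrow> 'o \<Rightarrow> real" where
  "sn t \<omega> = sn_process (\<lambda>s. feat s \<omega>) (\<lambda>s. \<eta> s \<omega>) t"

lemma sn_pos: "0 < sn t \<omega>"
  by (simp add: sn_def sn_process_pos)

lemma sn_H: "n \<le> T \<Longrightarrow> sn n \<in> borel_measurable (H n)"
  unfolding sn_def by (intro measurable_sn_process feat_H noise_H)

lemma sn_meas: "n \<le> T \<Longrightarrow> sn n \<in> borel_measurable M"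
  by (rule measurable_from_subalg[OF subalgebra_H sn_H])

text \<open>The features up to the current round and the noise of earlier rounds are known before
  the reward is realized; the weight comes from the earlier history.\<close>

lemma sn_step:
  assumes n: "Suc n \<le> T" and Z: "Z \<in> borel_measurable (H n)"
  shows "(\<integral>\<^sup>+\<omega>. Z \<omega> * ennreal (sn (Suc n) \<omega>) \<partial>M) \<le> (\<integral>\<^sup>+\<omega>. Z \<omega> * ennreal (sn n \<omega>) \<partial>M)"
proof -
  have t: "Suc n \<in> {1..T}" using n by simp
  have sub: "subalgebra (PR (Suc n)) (H n)"
    using subalgebra_PR_H[OF t] by (simp only: diff_Suc_1)
  have H_PR: "f \<in> borel_measurable (H n) \<Longrightarrow> f \<in> borel_measurable (PR (Suc n))"
    for f :: "'o \<Rightarrow> 'z::topological_space"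
    by (rule measurable_from_subalg[OF sub])
  show ?thesis
    unfolding sn_def
  proof (rule sn_process_supermartingale[OF subalgebra_PR[OF t]])
    show "feat s \<in> borel_measurable (PR (Suc n))" if "s \<in> {1..Suc n}" for s
    proof (cases "s = Suc n")
      case False
      then show ?thesis using that n by (intro H_PR feat_H) auto
    qed (simp add: feat_PR[OF t])
    show "\<eta> s \<in> borel_measurable (PR (Suc n))" if "s \<in> {1..n}" for s
      using that n by (intro H_PR noise_H) auto
    show "\<eta> (Suc n) \<in> borel_measurable M" by (rule \<eta>_meas[OF t])
    show "cond_subgaussian 1 M (PR (Suc n)) (\<eta> (Suc n))" by (rule \<eta>_subgaussian[OF t])
    show "Z \<in> borel_measurable (PR (Suc n))" by (rule H_PR[OF Z])
  qed
qed

lemma nn_integral_sn_le: "n \<le> T \<Longrightarrow> (\<integral>\<^sup>+\<omega>. ennreal (sn n \<omega>) \<partial>M) \<le> 1"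
proof (induction n)
  case 0
  then show ?case by (simp add: sn_def emeasure_space_1)
next
  case (Suc n)
  then show ?case using sn_step[of n "\<lambda>_. 1"] by simp
qed

lemma integral_sn:
  assumes "n \<le> T"
  shows "integrable M (sn n)" "(\<integral>\<omega>. sn n \<omega> \<partial>M) \<le> 1"
proof -
  have "(\<integral>\<^sup>+\<omega>. ennreal (sn n \<omega>) \<partial>M) < \<infinity>"
    using order_le_less_trans[OF nn_integral_sn_le[OF assms]] by simp
  then show int: "integrable M (sn n)"
    using sn_meas[OF assms] sn_pos by (intro integrableI_nonneg) (auto simp: less_imp_le)
  have "ennreal (\<integral>\<omega>. sn n \<omega> \<partial>M) = (\<integral>\<^sup>+\<omega>. ennreal (sn n \<omega>) \<partial>M)"
    using int sn_pos by (intro nn_integral_eq_integral[symmetric]) (auto simp: less_imp_le)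
  also have "\<dots> \<le> 1" by (rule nn_integral_sn_le[OF assms])
  finally show "(\<integral>\<omega>. sn n \<omega> \<partial>M) \<le> 1" by simp
qed

lemma excess_le_sn:
  assumes t: "t \<in> {1..T}" and \<omega>: "\<omega> \<in> space M"
  shows "excess t \<omega> \<le> sn (t - 1) \<omega> / real T" "sn (t - 1) \<omega> \<le> real T \<Longrightarrow> excess t \<omega> = 0"
proof -
  have x: "norm (feat s \<omega>) \<le> 1" if "s \<in> {1..t-1}" for s using that t by (intro feat_norm \<omega>) auto
  have t1: "1 \<le> t" using t by simp
  note c = conf_excess_le[of T t "\<lambda>s. feat s \<omega>" "\<lambda>s. rew s \<omega>" \<theta>star "\<lambda>s. \<eta> s \<omega>" m, OF T_pos t1 x rew_eq \<theta>_bound]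
  show "excess t \<omega> \<le> sn (t - 1) \<omega> / real T" unfolding excess_def sn_def by (rule c(1))
  show "excess t \<omega> = 0" if "sn (t - 1) \<omega> \<le> real T"
    using c(2) that excess_nonneg[of t \<omega>] unfolding excess_def sn_def by linarith
qed

subsection \<open>Regret\<close>

definition Lyap :: "nat \<Rightarrow> 'o \<Rightarrow> real" where
  "Lyap t \<omega> = (\<Sum>k\<in>{1..K}. (Q k t \<omega>)\<^sup>2) / 2"

lemma Lyap_drift:
  assumes t: "t \<in> {1..T}" and \<omega>: "\<omega> \<in> space M"
  shows "Lyap (Suc t) \<omega> \<le> Lyap t \<omega> + (\<Sum>k\<in>{1..K}. cost k t \<omega> * Q k t \<omega>)
    + eps t * (\<Sum>k\<in>{1..K}. Q k t \<omega>) + K * (1 + eps t)\<^sup>2 / 2"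
proof -
  have "(\<Sum>k\<in>{1..K}. (Q k (Suc t) \<omega>)\<^sup>2)
      \<le> (\<Sum>k\<in>{1..K}. (Q k t \<omega>)\<^sup>2 + 2 * Q k t \<omega> * (cost k t \<omega> + eps t) + (1 + eps t)\<^sup>2)"
    by (intro sum_mono Q_change_le(2) t \<omega>)
  also have "\<dots> = 2 * (Lyap t \<omega> + (\<Sum>k\<in>{1..K}. cost k t \<omega> * Q k t \<omega>)
      + eps t * (\<Sum>k\<in>{1..K}. Q k t \<omega>) + K * (1 + eps t)\<^sup>2 / 2)"
    by (simp add: Lyap_def sum.distrib sum_distrib_left algebra_simps)
  finally show ?thesis by (simp add: Lyap_def)
qed

lemma Q_meas: "k \<in> {1..K} \<Longrightarrow> n \<le> T \<Longrightarrow> Q k (Suc n) \<in> borel_measurable M"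
  by (rule measurable_from_subalg[OF subalgebra_H Q_H])

lemma Q_integrable:
  assumes "k \<in> {1..K}" "n \<le> T"
  shows "integrable M (Q k (Suc n))"
  by (rule integrable_const_bound[of _ "\<Sum>s\<in>{1..n}. 1 + eps s"])
     (use Q_le[OF assms(1) _ assms(2)] Q_nonneg Q_meas[OF assms] in auto)

lemma Lyap_integrable:
  assumes "n \<le> T"
  shows "integrable M (Lyap (Suc n))"
proof -
  have "integrable M (\<lambda>\<omega>. (Q k (Suc n) \<omega>)\<^sup>2)" if k: "k \<in> {1..K}" for k
    by (rule integrable_const_bound[of _ "(\<Sum>s\<in>{1..n}. 1 + eps s)\<^sup>2"])
       (use Q_le[OF k _ assms] Q_nonneg Q_meas[OF k assms] in \<open>auto intro!: power_mono\<close>)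
  then show ?thesis
    unfolding Lyap_def by (intro integrable_divide Bochner_Integration.integrable_sum)
qed

lemma width_integrable:
  assumes "t \<in> {1..T}"
  shows "integrable M (width t)"
  by (rule integrable_const_bound[of _ 1]) (use width_le_1[OF assms] width_meas[OF assms] in auto)

lemma mean_reward_integrable:
  assumes t: "t \<in> {1..T}"
  shows "integrable M (\<lambda>\<omega>. \<theta>star \<bullet> feat t \<omega>)"
  by (rule integrable_const_bound[of _ 1])
     (use mean_reward_range[OF t] feat_meas[OF ctx_meas A_meas, OF t t] in \<open>auto simp: abs_le_iff\<close>)

text \<open>The drift of the squared queues, divided by \<open>V t\<close>, replaces the incurred
  costs in \<open>optimism\<close>. The excess enters twice, once for the competing actions and once
  for the chosen one, which gives \<open>2 / T\<close>. The queues of the current round are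
  history-measurable, so the policy costs may be averaged.\<close>

lemma round_regret_le:
  assumes x: "is_policy C J x" and t: "t \<in> {1..T}"
  shows "policy_avg C J p r x - (\<integral>\<omega>. \<theta>star \<bullet> feat t \<omega> \<partial>M)
     \<le> 2 * radius t * (\<integral>\<omega>. width t \<omega> \<partial>M) + 2 / T
       + ((\<integral>\<omega>. Lyap t \<omega> \<partial>M) - (\<integral>\<omega>. Lyap (Suc t) \<omega> \<partial>M)) / V t
       + (\<Sum>k\<in>{1..K}. (\<integral>\<omega>. Q k t \<omega> \<partial>M) * (eps t + policy_avg C J p (w k) x)) / V t
       + K * (1 + eps t)\<^sup>2 / (2 * V t)"
proof -
  obtain n where n: "t = Suc n" "n \<le> T" "Suc n \<le> T" using t by (cases t) auto
  have V: "V t > 0" using t by (intro V_pos) auto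
  let ?b = "\<lambda>\<omega>. 2 * radius t * width t \<omega> + 2 / T * sn n \<omega> + (Lyap t \<omega> - Lyap (Suc t) \<omega>) / V t
       + (\<Sum>k\<in>{1..K}. eps t * Q k t \<omega> + policy_cost x k t \<omega> * Q k t \<omega>) / V t + K * (1 + eps t)\<^sup>2 / (2 * V t)"
  have path: "policy_reward x t \<omega> - \<theta>star \<bullet> feat t \<omega> \<le> ?b \<omega>" if \<omega>: "\<omega> \<in> space M" for \<omega>
  proof -
    define cq pq q where "cq = (\<Sum>k\<in>{1..K}. cost k t \<omega> * Q k t \<omega>)"
      and "pq = (\<Sum>k\<in>{1..K}. policy_cost x k t \<omega> * Q k t \<omega>)"
      and "q = (\<Sum>k\<in>{1..K}. Q k t \<omega>)"
    have "cq / V t \<le> min 1 (\<theta>star \<bullet> feat t \<omega> + 2 * radius t * width t \<omega> + excess t \<omega>) + excess t \<omega>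
        - policy_reward x t \<omega> + pq / V t"
      using optimism[OF t \<omega> x] unfolding policy_cost_def policy_reward_def cq_def pq_def .
    then have 1: "cq / V t \<le> \<theta>star \<bullet> feat t \<omega> + 2 * radius t * width t \<omega> + 2 * excess t \<omega>
        - policy_reward x t \<omega> + pq / V t"
      using min.cobounded2[of 1 "\<theta>star \<bullet> feat t \<omega> + 2 * radius t * width t \<omega> + excess t \<omega>"] by linarith
    have 2: "excess t \<omega> \<le> sn n \<omega> / T" using excess_le_sn(1)[OF t \<omega>] n by simp
    have "Lyap (Suc t) \<omega> \<le> Lyap t \<omega> + cq + eps t * q + K * (1 + eps t)\<^sup>2 / 2"
      using Lyap_drift[OF t \<omega>] by (simp add: cq_def q_def)
    then have "- cq \<le> (Lyap t \<omega> - Lyap (Suc t) \<omega>) + eps t * q + K * (1 + eps t)\<^sup>2 / 2" by simp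
    then have "- cq / V t \<le> ((Lyap t \<omega> - Lyap (Suc t) \<omega>) + eps t * q + K * (1 + eps t)\<^sup>2 / 2) / V t"
      using V by (intro divide_right_mono) auto
    then have 3: "- (cq / V t) \<le> (Lyap t \<omega> - Lyap (Suc t) \<omega>) / V t + eps t * q / V t + K * (1 + eps t)\<^sup>2 / (2 * V t)"
      by (simp add: add_divide_distrib)
    have "(\<Sum>k\<in>{1..K}. eps t * Q k t \<omega> + policy_cost x k t \<omega> * Q k t \<omega>) / V t = eps t * q / V t + pq / V t"
      by (simp add: q_def pq_def sum.distrib sum_distrib_left add_divide_distrib)
    then show ?thesis using 1 2 3 by (simp add: algebra_simps)
  qed
  have Qi: "integrable M (Q k t)" if "k \<in> {1..K}" for k using Q_integrable[OF that n(2)] n by simp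
  have QH: "Q k t \<in> borel_measurable (H (t - 1))" if "k \<in> {1..K}" for k using Q_H[OF that n(2)] n by simp
  have Li: "integrable M (Lyap t)" "integrable M (Lyap (Suc t))"
    using Lyap_integrable[OF n(2)] Lyap_integrable[OF n(3)] n by simp_all
  have pi: "integrable M (\<lambda>\<omega>. policy_cost x k t \<omega> * Q k t \<omega>)" if k: "k \<in> {1..K}" for k
  proof (rule Bochner_Integration.integrable_bound[OF Qi[OF k]])
    show "(\<lambda>\<omega>. policy_cost x k t \<omega> * Q k t \<omega>) \<in> borel_measurable M"
      using policy_cost_meas[OF k t] Qi[OF k] by measurable
    show "AE \<omega> in M. norm (policy_cost x k t \<omega> * Q k t \<omega>) \<le> norm (Q k t \<omega>)"
      using policy_cost_bound[OF x k t] by (auto simp: abs_mult intro!: mult_left_le_one_le)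
  qed
  have si: "integrable M (\<lambda>\<omega>. \<Sum>k\<in>{1..K}. eps t * Q k t \<omega> + policy_cost x k t \<omega> * Q k t \<omega>)"
    using Qi pi by (intro Bochner_Integration.integrable_sum Bochner_Integration.integrable_add integrable_mult_right)
  have ri: "integrable M (policy_reward x t)" by (rule policy_reward_integrable[OF x t])
  have "policy_avg C J p r x - (\<integral>\<omega>. \<theta>star \<bullet> feat t \<omega> \<partial>M) = (\<integral>\<omega>. policy_reward x t \<omega> - \<theta>star \<bullet> feat t \<omega> \<partial>M)"
    using ri mean_reward_integrable[OF t] by (simp add: integral_policy_reward[OF x t])
  also have "\<dots> \<le> (\<integral>\<omega>. ?b \<omega> \<partial>M)"
    by (intro integral_mono path Bochner_Integration.integrable_add Bochner_Integration.integrable_diff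
        integrable_divide integrable_mult_right integrable_const ri mean_reward_integrable t width_integrable
        integral_sn(1) n Li si)
  also have "\<dots> = 2 * radius t * (\<integral>\<omega>. width t \<omega> \<partial>M) + 2 / T * (\<integral>\<omega>. sn n \<omega> \<partial>M)
       + ((\<integral>\<omega>. Lyap t \<omega> \<partial>M) - (\<integral>\<omega>. Lyap (Suc t) \<omega> \<partial>M)) / V t
       + (\<integral>\<omega>. (\<Sum>k\<in>{1..K}. eps t * Q k t \<omega> + policy_cost x k t \<omega> * Q k t \<omega>) \<partial>M) / V t
       + K * (1 + eps t)\<^sup>2 / (2 * V t)"
    using width_integrable[OF t] integral_sn(1)[OF n(2)] Li si by (simp add: prob_space)
  also have "(\<integral>\<omega>. (\<Sum>k\<in>{1..K}. eps t * Q k t \<omega> + policy_cost x k t \<omega> * Q k t \<omega>) \<partial>M)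
      = (\<Sum>k\<in>{1..K}. \<integral>\<omega>. eps t * Q k t \<omega> + policy_cost x k t \<omega> * Q k t \<omega> \<partial>M)"
    using Qi pi by (intro Bochner_Integration.integral_sum Bochner_Integration.integrable_add integrable_mult_right)
  also have "\<dots> = (\<Sum>k\<in>{1..K}. (\<integral>\<omega>. Q k t \<omega> \<partial>M) * (eps t + policy_avg C J p (w k) x))"
  proof (rule sum.cong)
    fix k assume k: "k \<in> {1..K}"
    show "(\<integral>\<omega>. eps t * Q k t \<omega> + policy_cost x k t \<omega> * Q k t \<omega> \<partial>M)
        = (\<integral>\<omega>. Q k t \<omega> \<partial>M) * (eps t + policy_avg C J p (w k) x)"
      using Qi[OF k] pi[OF k] fresh_policy_cost[OF x k t QH[OF k] Qi[OF k]] by (simp add: algebra_simps)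
  qed simp
  also have "2 / T * (\<integral>\<omega>. sn n \<omega> \<partial>M) \<le> 2 / T * 1"
    using integral_sn(2)[OF n(2)] by (intro mult_left_mono) auto
  finally show ?thesis by simp
qed

section \<open>The parameters of the algorithm in terms of \<open>a0\<close>\<close>

definition a0 :: real where "a0 = sqrt 6 * real K powr (3/4)"

lemma a0_ge_2: "a0 \<ge> 2"
proof -
  have "2 \<le> sqrt 6" by (rule real_le_rsqrt) simp
  moreover have "1 \<le> real K powr (3/4)" using K_pos by (intro ge_one_powr_ge_zero) auto
  ultimately have "2 * 1 \<le> sqrt 6 * real K powr (3/4)" by (intro mult_mono) auto
  then show ?thesis by (simp add: a0_def)
qed

lemma a0_sq: "a0\<^sup>2 = 6 * real K powr (3/2)"
proof -
  have "(real K powr (3/4))\<^sup>2 = real K powr (3/2)" by (simp add: power2_eq_square powr_add[symmetric])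
  then show ?thesis by (simp add: a0_def power_mult_distrib)
qed

lemma a0_pow4: "a0 ^ 4 = 36 * real K ^ 3"
proof -
  have "a0 ^ 4 = (a0\<^sup>2)\<^sup>2" by simp
  also have "\<dots> = 36 * real K powr 3"
    unfolding a0_sq power_mult_distrib by (simp add: power2_eq_square powr_add[symmetric])
  also have "real K powr 3 = real K ^ 3" using K_pos by (subst powr_numeral) auto
  finally show ?thesis .
qed

lemma eps_eq: "eps t = a0 / sqrt (real t)"
  by (simp add: eps_param_def a0_def real_sqrt_divide)

text \<open>Together with \<open>eps_eq\<close> this says
  \<open>K / V t = eps t / (2 * \<delta>)\<close>: pessimism and inverse penalty parameter are two
  scalings of one sequence.\<close>

lemma K_div_V: "real K / V t = a0 / (2 * \<delta> * sqrt (real t))"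
proof -
  have K: "real K = real K powr (1/4) * real K powr (3/4)" using K_pos by (simp add: powr_add[symmetric])
  have "sqrt (2 * real t / 3) * sqrt 6 = 2 * sqrt (real t)"
    by (simp add: real_sqrt_mult[symmetric]) (simp add: real_sqrt_mult)
  moreover have "sqrt 6 > 0" "real K powr (1/4) > 0" using K_pos by auto
  ultimately have s: "sqrt (2 * real t / 3) = 2 * sqrt (real t) / sqrt 6" by (simp add: field_simps)
  have "real K / V t = (real K powr (1/4) * real K powr (3/4)) / (\<delta> * real K powr (1/4) * (2 * sqrt (real t) / sqrt 6))"
    unfolding V_param_def s using K by simp
  also have "\<dots> = a0 / (2 * \<delta> * sqrt (real t))"
    using \<open>real K powr (1/4) > 0\<close> by (simp add: a0_def mult_ac)
  finally show ?thesis .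
qed

lemma V_mono: "V t \<le> V (Suc t)"
  unfolding V_param_def using \<delta>_range by (intro mult_left_mono) auto

lemma sum_eps_le: "(\<Sum>s\<in>{1..n}. eps s) \<le> 2 * a0 * sqrt (real n)"
proof -
  have "(\<Sum>s\<in>{1..n}. eps s) = a0 * (\<Sum>s\<in>{1..n}. 1 / sqrt (real s))"
    by (simp add: eps_eq sum_distrib_left)
  also have "\<dots> \<le> a0 * (2 * sqrt (real n))"
    using a0_ge_2 sum_inverse_sqrt_le by (intro mult_left_mono) auto
  finally show ?thesis by simp
qed

lemma sum_eps_ge: "2 * a0 * (sqrt (real n + 1) - 1) \<le> (\<Sum>s\<in>{1..n}. eps s)"
proof -
  have "a0 * (2 * sqrt (real n + 1) - 2) \<le> a0 * (\<Sum>s\<in>{1..n}. 1 / sqrt (real s))"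
    using a0_ge_2 sum_inverse_sqrt_ge by (intro mult_left_mono) auto
  also have "\<dots> = (\<Sum>s\<in>{1..n}. eps s)"
    by (simp add: eps_eq sum_distrib_left)
  finally show ?thesis by (simp add: algebra_simps)
qed

lemma round_regret_slater:
  assumes xo: "optimal_policy C J K p r w xo"
    and xs: "is_policy C J xs" "\<And>k. k \<in> {1..K} \<Longrightarrow> policy_avg C J p (w k) xs \<le> - \<delta>"
    and t: "t \<in> {1..T}"
  shows "policy_avg C J p r xo - (\<integral>\<omega>. \<theta>star \<bullet> feat t \<omega> \<partial>M)
     \<le> eps t / \<delta> + 2 * radius t * (\<integral>\<omega>. width t \<omega> \<partial>M) + 2 / T
       + ((\<integral>\<omega>. Lyap t \<omega> \<partial>M) - (\<integral>\<omega>. Lyap (Suc t) \<omega> \<partial>M)) / V t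
       + a0 / (2 * \<delta>) * ((sqrt (real t) + 2 * a0) * max 0 (a0 / sqrt (real t) - \<delta>))
       + (a0 / \<delta> * (1 / sqrt (real t)) + a0 ^ 3 / (3 * \<delta>) * (1 / (real t * sqrt (real t))))"
proof -
  obtain n where n: "t = Suc n" "n \<le> T" using t by (cases t) auto
  have V: "V t > 0" using t by (intro V_pos) auto
  have st: "sqrt (real t) > 0" using t by simp
  have xo': "is_policy C J xo" "\<And>k. k \<in> {1..K} \<Longrightarrow> policy_avg C J p (w k) xo \<le> 0"
    using xo by (auto simp: optimal_policy_def is_arg_max_def feasible_policy_def)
  \<comment> \<open>The cap is for rounds with \<open>eps t > \<delta>\<close>; there the Slater
    policy itself is used and a constraint residual of at most \<open>eps t - \<delta>\<close> is
    left over.\<close>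
  define l where "l = min 1 (eps t / \<delta>)"
  have l: "0 \<le> l" "l \<le> 1" "l \<le> eps t / \<delta>" using eps_nonneg[of t] \<delta>_range by (auto simp: l_def)
  define x where "x = (\<lambda>c j. (1 - l) * xo c j + l * xs c j)"
  note mix = policy_avg_mix[OF xo'(1) xs(1) l(1,2), folded x_def]
  have rew: "policy_avg C J p r xo - policy_avg C J p r x \<le> eps t / \<delta>"
  proof -
    have "policy_avg C J p r xo - policy_avg C J p r x = l * (policy_avg C J p r xo - policy_avg C J p r xs)"
      by (simp add: mix(3) algebra_simps)
    also have "\<dots> \<le> l * 1"
      using policy_avg_reward_range[OF xo'(1)] policy_avg_reward_range[OF xs(1)] l(1)
      by (intro mult_left_mono) auto
    finally show ?thesis using l(3) by simp
  qed
  have cst: "eps t + policy_avg C J p (w k) x \<le> max 0 (eps t - \<delta>)" if k: "k \<in> {1..K}" for k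
  proof -
    have "policy_avg C J p (w k) x \<le> (1 - l) * 0 + l * (- \<delta>)"
      unfolding mix(2)[OF k] using xo'(2)[OF k] xs(2)[OF k] l by (intro add_mono mult_left_mono) auto
    moreover have "eps t - l * \<delta> \<le> max 0 (eps t - \<delta>)"
      using \<delta>_range by (auto simp: l_def min_def)
    ultimately show ?thesis by simp
  qed
  have EQ: "0 \<le> (\<integral>\<omega>. Q k t \<omega> \<partial>M)" "(\<integral>\<omega>. Q k t \<omega> \<partial>M) \<le> real t + 2 * a0 * sqrt (real t)" if k: "k \<in> {1..K}" for k
  proof -
    show "0 \<le> (\<integral>\<omega>. Q k t \<omega> \<partial>M)" using Q_nonneg by (intro integral_nonneg_AE) auto
    have "(\<integral>\<omega>. Q k t \<omega> \<partial>M) \<le> (\<Sum>s\<in>{1..n}. 1 + eps s)"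
      using Q_integrable[OF k n(2)] Q_le[OF k _ n(2)] n by (intro integral_le_const) auto
    also have "\<dots> \<le> real n + 2 * a0 * sqrt (real n)" using sum_eps_le[of n] by (simp add: sum.distrib)
    also have "\<dots> \<le> real t + 2 * a0 * sqrt (real t)"
      using n a0_ge_2 by (intro add_mono mult_left_mono) auto
    finally show "(\<integral>\<omega>. Q k t \<omega> \<partial>M) \<le> real t + 2 * a0 * sqrt (real t)" .
  qed
  have "(\<Sum>k\<in>{1..K}. (\<integral>\<omega>. Q k t \<omega> \<partial>M) * (eps t + policy_avg C J p (w k) x))
      \<le> (\<Sum>k\<in>{1..K}. (real t + 2 * a0 * sqrt (real t)) * max 0 (eps t - \<delta>))"
  proof (rule sum_mono)
    fix k assume k: "k \<in> {1..K}"
    have "(\<integral>\<omega>. Q k t \<omega> \<partial>M) * (eps t + policy_avg C J p (w k) x) \<le> (\<integral>\<omega>. Q k t \<omega> \<partial>M) * max 0 (eps t - \<delta>)"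
      using cst[OF k] EQ(1)[OF k] by (rule mult_left_mono)
    also have "\<dots> \<le> (real t + 2 * a0 * sqrt (real t)) * max 0 (eps t - \<delta>)"
      using EQ(2)[OF k] by (rule mult_right_mono) simp
    finally show "(\<integral>\<omega>. Q k t \<omega> \<partial>M) * (eps t + policy_avg C J p (w k) x)
        \<le> (real t + 2 * a0 * sqrt (real t)) * max 0 (eps t - \<delta>)" .
  qed
  then have "(\<Sum>k\<in>{1..K}. (\<integral>\<omega>. Q k t \<omega> \<partial>M) * (eps t + policy_avg C J p (w k) x)) / V t
      \<le> (real K / V t) * ((real t + 2 * a0 * sqrt (real t)) * max 0 (eps t - \<delta>))"
    using V by (simp add: divide_right_mono)
  also have "\<dots> = a0 / (2 * \<delta>) * ((sqrt (real t) + 2 * a0) * max 0 (a0 / sqrt (real t) - \<delta>))"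
  proof -
    have "real t = sqrt (real t) * sqrt (real t)" by simp
    then have "real t + 2 * a0 * sqrt (real t) = sqrt (real t) * (sqrt (real t) + 2 * a0)"
      by (simp add: distrib_left)
    then show ?thesis unfolding K_div_V eps_eq using st \<delta>_range by simp
  qed
  finally have S: "(\<Sum>k\<in>{1..K}. (\<integral>\<omega>. Q k t \<omega> \<partial>M) * (eps t + policy_avg C J p (w k) x)) / V t
      \<le> a0 / (2 * \<delta>) * ((sqrt (real t) + 2 * a0) * max 0 (a0 / sqrt (real t) - \<delta>))" .
  have "K * (1 + eps t)\<^sup>2 / (2 * V t) = (real K / V t) * ((1 + eps t)\<^sup>2 / 2)" by simp
  \<comment> \<open>The split is tuned so that the constant 2 contributes at most
    \<open>2 * a0 * sqrt \<tau> / \<delta>\<close> in total, the same as the bound for the sum of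
    \<open>eps t / \<delta>\<close>, and the rest is summable. The two sides differ by the factor
    times \<open>(3 - eps t)\<^sup>2 / 6\<close>.\<close>
  also have "\<dots> \<le> (real K / V t) * (2 + 2 / 3 * (eps t)\<^sup>2)"
  proof (rule mult_left_mono)
    have "0 \<le> (3 - eps t)\<^sup>2" by simp
    then show "(1 + eps t)\<^sup>2 / 2 \<le> 2 + 2 / 3 * (eps t)\<^sup>2" by (simp add: power2_eq_square algebra_simps)
  qed (use V in simp)
  also have "\<dots> = a0 / \<delta> * (1 / sqrt (real t)) + a0 ^ 3 / (3 * \<delta>) * (1 / (real t * sqrt (real t)))"
    unfolding K_div_V eps_eq using st \<delta>_range
    by (simp add: field_simps power2_eq_square power3_eq_cube)
  finally have D: "K * (1 + eps t)\<^sup>2 / (2 * V t)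
      \<le> a0 / \<delta> * (1 / sqrt (real t)) + a0 ^ 3 / (3 * \<delta>) * (1 / (real t * sqrt (real t)))" .
  show ?thesis using round_regret_le[OF mix(1) t] rew S D by linarith
qed

text \<open>Cauchy-Schwarz over the rounds, then \<open>y \<le> 2 * ln (1 + y)\<close> on the unit
  interval and the logarithmic potential. The factor 8 is the 2 of that inequality times the square
  of the 2 in front of the radius. All radii are replaced by a common bound, formed with
  \<open>\<tau>\<close> observations instead of \<open>t - 1\<close>.\<close>

lemma sum_width_le:
  assumes \<tau>: "\<tau> \<in> {1..T}"
  defines "B \<equiv> m + sqrt (2 * ln (real T) + real d * ln (1 + real \<tau> / real d))"
  shows "(\<Sum>t\<in>{1..\<tau>}. 2 * radius t * (\<integral>\<omega>. width t \<omega> \<partial>M))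
     \<le> sqrt (8 * real d * real \<tau> * B\<^sup>2 * ln ((real d + real \<tau>) / real d))"
proof -
  have d: "real d > 0" by (simp add: d_eq)
  have B0: "B \<ge> 0"
    unfolding B_def using m_nonneg T_pos d by (intro add_nonneg_nonneg real_sqrt_ge_zero mult_nonneg_nonneg ln_ge_zero) auto
  have rad: "radius t \<le> B" if "t \<in> {1..\<tau>}" for t
    unfolding sqrt_beta_def B_def using d that T_pos
    by (intro add_left_mono real_sqrt_le_mono mult_left_mono)
       (auto simp: ln_le_cancel_iff divide_pos_pos add_pos_nonneg add_divide_distrib intro!: divide_right_mono)
  let ?L = "real d * ln ((real d + real \<tau>) / real d)"
  have tT: "t \<in> {1..T}" if "t \<in> {1..\<tau>}" for t using that \<tau> by auto
  have path: "(\<Sum>t\<in>{1..\<tau>}. width t \<omega>) \<le> sqrt (real \<tau> * (2 * ?L))" if \<omega>: "\<omega> \<in> space M" for \<omega>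
  proof -
    have "(\<Sum>t\<in>{1..\<tau>}. width t \<omega>)\<^sup>2 \<le> real \<tau> * (\<Sum>t\<in>{1..\<tau>}. (width t \<omega>)\<^sup>2)"
      using Cauchy_Schwarz_ineq_sum[of "\<lambda>_. 1" "\<lambda>t. width t \<omega>" "{1..\<tau>}"] by simp
    also have "\<dots> \<le> real \<tau> * (\<Sum>t\<in>{1..\<tau>}. 2 * ln (1 + (width t \<omega>)\<^sup>2))"
    proof (intro mult_left_mono sum_mono)
      fix t assume t: "t \<in> {1..\<tau>}"
      define y where "y = (width t \<omega>)\<^sup>2"
      have y: "0 \<le> y" "y \<le> 1" using width_le_1[OF tT[OF t] \<omega>] by (auto simp: y_def power_le_one)
      have "y / 2 \<le> ln (1 + y)"
      proof -
        have "y / 2 \<le> y / (1 + y)" using y by (intro divide_left_mono) auto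
        also have "\<dots> \<le> ln (1 + y)" using y ln_add1_ge[of y] by (simp add: field_simps)
        finally show ?thesis .
      qed
      then show "(width t \<omega>)\<^sup>2 \<le> 2 * ln (1 + (width t \<omega>)\<^sup>2)" by (simp add: y_def)
    qed simp
    also have "\<dots> = real \<tau> * (2 * (\<Sum>t\<in>{1..\<tau>}. ln (1 + (width t \<omega>)\<^sup>2)))" by (simp add: sum_distrib_left)
    also have "\<dots> \<le> real \<tau> * (2 * ?L)"
    proof (intro mult_left_mono)
      show "(\<Sum>t\<in>{1..\<tau>}. ln (1 + (width t \<omega>)\<^sup>2)) \<le> ?L"
        unfolding d_eq by (rule sum_ln_potential) (rule feat_norm[OF tT \<omega>])
    qed auto
    finally show ?thesis by (rule real_le_rsqrt)
  qed
  have "(\<Sum>t\<in>{1..\<tau>}. 2 * radius t * (\<integral>\<omega>. width t \<omega> \<partial>M)) \<le> (\<Sum>t\<in>{1..\<tau>}. 2 * B * (\<integral>\<omega>. width t \<omega> \<partial>M))"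
    using rad by (intro sum_mono mult_right_mono integral_nonneg_AE) auto
  also have "\<dots> = 2 * B * (\<integral>\<omega>. (\<Sum>t\<in>{1..\<tau>}. width t \<omega>) \<partial>M)"
  proof -
    have "(\<integral>\<omega>. (\<Sum>t\<in>{1..\<tau>}. width t \<omega>) \<partial>M) = (\<Sum>t\<in>{1..\<tau>}. \<integral>\<omega>. width t \<omega> \<partial>M)"
      by (rule Bochner_Integration.integral_sum) (rule width_integrable[OF tT])
    then show ?thesis by (simp add: sum_distrib_left)
  qed
  also have "\<dots> \<le> 2 * B * sqrt (real \<tau> * (2 * ?L))"
  proof (intro mult_left_mono integral_le_const)
    show "integrable M (\<lambda>\<omega>. \<Sum>t\<in>{1..\<tau>}. width t \<omega>)"
      by (intro Bochner_Integration.integrable_sum width_integrable tT)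
  qed (use path B0 in auto)
  also have "\<dots> = sqrt (8 * real d * real \<tau> * B\<^sup>2 * ln ((real d + real \<tau>) / real d))"
  proof -
    have "2 * B = sqrt (4 * B\<^sup>2)" using B0 by (simp add: real_sqrt_mult)
    then show ?thesis by (simp add: real_sqrt_mult[symmetric] mult_ac)
  qed
  finally show ?thesis .
qed

text \<open>The noise has mean zero, so only the mean rewards of the features played remain.\<close>

lemma regret_eq:
  assumes \<tau>: "\<tau> \<in> {1..T}"
  shows "regret M C J p r A R xo \<tau> = (\<Sum>t\<in>{1..\<tau>}. policy_avg C J p r xo - (\<integral>\<omega>. \<theta>star \<bullet> feat t \<omega> \<partial>M))"
proof -
  have tT: "t \<in> {1..T}" if "t \<in> {1..\<tau>}" for t using that \<tau> by auto
  have "(\<integral>\<omega>. (\<Sum>t\<in>{1..\<tau>}. \<Sum>j\<in>{1..J}. R t j \<omega> * of_bool (A t \<omega> = j)) \<partial>M)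
      = (\<integral>\<omega>. (\<Sum>t\<in>{1..\<tau>}. \<theta>star \<bullet> feat t \<omega> + \<eta> t \<omega>) \<partial>M)"
  proof (intro Bochner_Integration.integral_cong sum.cong refl)
    fix \<omega> t assume \<omega>: "\<omega> \<in> space M" and t: "t \<in> {1..\<tau>}"
    show "(\<Sum>j\<in>{1..J}. R t j \<omega> * of_bool (A t \<omega> = j)) = \<theta>star \<bullet> feat t \<omega> + \<eta> t \<omega>"
      unfolding sum_action[OF tT[OF t] \<omega>] rew_eq[symmetric] rew_def ..
  qed
  also have "\<dots> = (\<Sum>t\<in>{1..\<tau>}. \<integral>\<omega>. \<theta>star \<bullet> feat t \<omega> + \<eta> t \<omega> \<partial>M)"
    by (intro Bochner_Integration.integral_sum Bochner_Integration.integrable_add mean_reward_integrable noise_integral tT)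
  also have "\<dots> = (\<Sum>t\<in>{1..\<tau>}. \<integral>\<omega>. \<theta>star \<bullet> feat t \<omega> \<partial>M)"
    using mean_reward_integrable noise_integral tT by (intro sum.cong) auto
  finally show ?thesis by (simp add: regret_def sum_subtractf)
qed

lemma regret_bound:
  assumes xo: "optimal_policy C J K p r w xo"
    and xs: "is_policy C J xs" "\<And>k. k \<in> {1..K} \<Longrightarrow> policy_avg C J p (w k) xs \<le> - \<delta>"
    and \<tau>: "\<tau> \<in> {1..T}"
  shows "regret M C J p r A R xo \<tau> \<le>
       60 * real K ^ 3 / \<delta> ^ 3 + 4 * sqrt 6 * real K powr (3/4) * sqrt (real \<tau>) / \<delta> + 2
       + sqrt (8 * real d * real \<tau>
               * (m + sqrt (2 * ln (real T) + real d * ln (1 + real \<tau> / real d)))\<^sup>2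
               * ln ((real d + real \<tau>) / real d))"
proof -
  let ?W = "sqrt (8 * real d * real \<tau>
               * (m + sqrt (2 * ln (real T) + real d * ln (1 + real \<tau> / real d)))\<^sup>2
               * ln ((real d + real \<tau>) / real d))"
  have tT: "t \<in> {1..T}" if "t \<in> {1..\<tau>}" for t using that \<tau> by auto
  have a: "a0 > 0" using a0_ge_2 by simp
  have \<delta>: "\<delta> > 0" by (rule \<delta>_range)
  have "regret M C J p r A R xo \<tau> \<le> (\<Sum>t\<in>{1..\<tau>}. eps t / \<delta> + 2 * radius t * (\<integral>\<omega>. width t \<omega> \<partial>M) + 2 / T
       + ((\<integral>\<omega>. Lyap t \<omega> \<partial>M) - (\<integral>\<omega>. Lyap (Suc t) \<omega> \<partial>M)) / V t
       + a0 / (2 * \<delta>) * ((sqrt (real t) + 2 * a0) * max 0 (a0 / sqrt (real t) - \<delta>))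
       + (a0 / \<delta> * (1 / sqrt (real t)) + a0 ^ 3 / (3 * \<delta>) * (1 / (real t * sqrt (real t)))))"
    unfolding regret_eq[OF \<tau>] by (intro sum_mono round_regret_slater[OF xo xs] tT)
  also have "\<dots> = (\<Sum>t\<in>{1..\<tau>}. eps t) / \<delta> + (\<Sum>t\<in>{1..\<tau>}. 2 * radius t * (\<integral>\<omega>. width t \<omega> \<partial>M)) + real \<tau> * (2 / T)
       + (\<Sum>t\<in>{1..\<tau>}. ((\<integral>\<omega>. Lyap t \<omega> \<partial>M) - (\<integral>\<omega>. Lyap (Suc t) \<omega> \<partial>M)) / V t)
       + a0 / (2 * \<delta>) * (\<Sum>t\<in>{1..\<tau>}. (sqrt (real t) + 2 * a0) * max 0 (a0 / sqrt (real t) - \<delta>))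
       + (a0 / \<delta> * (\<Sum>t\<in>{1..\<tau>}. 1 / sqrt (real t)) + a0 ^ 3 / (3 * \<delta>) * (\<Sum>t\<in>{1..\<tau>}. 1 / (real t * sqrt (real t))))"
    by (simp only: sum.distrib sum_distrib_left sum_divide_distrib sum_constant card_atLeastAtMost) simp
  also have "\<dots> \<le> 2 * a0 * sqrt (real \<tau>) / \<delta> + ?W + 2 + 0
       + a0 / (2 * \<delta>) * (a0 ^ 3 / (3 * \<delta>\<^sup>2) + 2 * a0 ^ 3 / \<delta>)
       + (a0 / \<delta> * (2 * sqrt (real \<tau>)) + a0 ^ 3 / (3 * \<delta>) * 3)"
  proof (intro add_mono mult_left_mono divide_right_mono)
    show "(\<Sum>t\<in>{1..\<tau>}. 2 * radius t * (\<integral>\<omega>. width t \<omega> \<partial>M)) \<le> ?W" by (rule sum_width_le[OF \<tau>])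
    show "real \<tau> * (2 / T) \<le> 2" using \<tau> by (simp add: field_simps)
    show "(\<Sum>t\<in>{1..\<tau>}. ((\<integral>\<omega>. Lyap t \<omega> \<partial>M) - (\<integral>\<omega>. Lyap (Suc t) \<omega> \<partial>M)) / V t) \<le> 0"
    proof (rule sum_telescope_weighted_le)
      show "0 \<le> (\<integral>\<omega>. Lyap t \<omega> \<partial>M)" for t
        by (intro integral_nonneg_AE) (auto simp: Lyap_def intro!: sum_nonneg)
      show "(\<integral>\<omega>. Lyap 1 \<omega> \<partial>M) = 0" by (simp add: Lyap_def)
    qed (auto simp: V_pos V_mono)
    show "(\<Sum>t\<in>{1..\<tau>}. (sqrt (real t) + 2 * a0) * max 0 (a0 / sqrt (real t) - \<delta>))
        \<le> a0 ^ 3 / (3 * \<delta>\<^sup>2) + 2 * a0 ^ 3 / \<delta>" by (rule early_rounds_sum_le[OF a \<delta>])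
  qed (use a \<delta> sum_eps_le sum_inverse_sqrt_le sum_inverse_three_halves_le in auto)
  also have "\<dots> = 4 * a0 * sqrt (real \<tau>) / \<delta> + ?W + 2 + (a0 ^ 4 / (6 * \<delta> ^ 3) + a0 ^ 4 / \<delta>\<^sup>2 + a0 ^ 3 / \<delta>)"
    using \<delta> by (simp add: field_simps power2_eq_square power3_eq_cube power4_eq_xxxx)
  \<comment> \<open>All constant terms are brought to the denominator \<open>\<delta> ^ 3\<close>,
    with \<open>a0 \<ge> 2\<close> raising the cubic one to fourth power. Since
    \<open>a0 ^ 4 = 36 * K ^ 3\<close>, the factor \<open>1/6 + 1 + 1/2\<close> gives the constant
    60.\<close>
  also have "\<dots> \<le> 4 * a0 * sqrt (real \<tau>) / \<delta> + ?W + 2 + (a0 ^ 4 / (6 * \<delta> ^ 3) + a0 ^ 4 / \<delta> ^ 3 + a0 ^ 4 / 2 / \<delta> ^ 3)"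
  proof (intro add_mono order_refl frac_le)
    show "\<delta> ^ 3 \<le> \<delta>\<^sup>2" "\<delta> ^ 3 \<le> \<delta>"
      using \<delta>_range power_decreasing[of 2 3 \<delta>] power_decreasing[of 1 3 \<delta>] by simp_all
    have "2 * a0 ^ 3 \<le> a0 * a0 ^ 3" using a0_ge_2 by (intro mult_right_mono) auto
    then show "a0 ^ 3 \<le> a0 ^ 4 / 2" by (simp add: power4_eq_xxxx power3_eq_cube mult_ac)
  qed (use a \<delta> in auto)
  also have "a0 ^ 4 / (6 * \<delta> ^ 3) + a0 ^ 4 / \<delta> ^ 3 + a0 ^ 4 / 2 / \<delta> ^ 3 = 60 * real K ^ 3 / \<delta> ^ 3"
    unfolding a0_pow4 using \<delta> by (simp add: field_simps)
  finally show ?thesis by (simp add: a0_def mult_ac)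
qed

end

lemma exp_le_quadratic:
  fixes x :: real
  assumes "\<bar>x\<bar> \<le> 1"
  shows "exp x \<le> 1 + x + x\<^sup>2"
proof (cases "x \<ge> 0")
  case True
  then show ?thesis using assms exp_bound[of x] by simp
next
  case False
  define y where "y = - x"
  have y: "y > 0" using False by (simp add: y_def)
  have p: "0 < 1 - y + y\<^sup>2"
  proof -
    have "1 - y + y\<^sup>2 = (1 / 2 - y)\<^sup>2 + 3 / 4" by (simp add: power2_eq_square algebra_simps)
    then show ?thesis by (simp add: add_nonneg_pos)
  qed
  \<comment> \<open>The second-order lower bound for \<open>exp y\<close> times
    \<open>1 - y + y\<^sup>2\<close> is at least 1, because all negative terms cancel in the
    product.\<close>
  have "1 \<le> 1 + y\<^sup>2 / 2 + y ^ 3 / 2 + y ^ 4 / 2" using y by simp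
  also have "\<dots> = (1 - y + y\<^sup>2) * (1 + y + y\<^sup>2 / 2)"
    by (simp add: power2_eq_square power3_eq_cube power4_eq_xxxx field_simps)
  also have "\<dots> \<le> (1 - y + y\<^sup>2) * exp y"
    using exp_lower_Taylor_quadratic[of y] y p by (intro mult_left_mono) auto
  finally have "exp (- y) \<le> 1 - y + y\<^sup>2" by (simp add: exp_minus field_simps)
  then show ?thesis by (simp add: y_def)
qed

context pess_opt_bandit
begin

subsection \<open>All confidence sets are valid with high probability\<close>

text \<open>Controls the process only up to \<open>n\<close>, so that the set is
  \<open>H n\<close>-measurable and may weight the fresh draw of round \<open>n + 1\<close>. On it
  the excess vanishes in every round up to \<open>n + 1\<close>; the sets decrease in
  \<open>n\<close>.\<close>

definition good :: "nat \<Rightarrow> 'o set" where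
  "good n = {\<omega> \<in> space M. \<forall>i\<le>n. sn i \<omega> \<le> real T}"

lemma good_H:
  assumes n: "n \<le> T"
  shows "good n \<in> sets (H n)"
proof -
  have "sn i \<in> borel_measurable (H n)" if "i \<le> n" for i
    unfolding sn_def using n that by (intro measurable_sn_process feat_H noise_H) auto
  then have "{\<omega> \<in> space (H n). sn i \<omega> \<le> real T} \<in> sets (H n)" if "i \<in> {..n}" for i
    using that by (simp add: borel_measurable_iff_le)
  then have "{\<omega> \<in> space (H n). \<forall>i\<in>{..n}. sn i \<omega> \<le> real T} \<in> sets (H n)"
    by (rule sets.sets_Collect_finite_All) simp_all
  then show ?thesis unfolding space_H[OF n] good_def by (simp only: Ball_def atMost_iff)
qed

lemma good_sets: "n \<le> T \<Longrightarrow> good n \<in> sets M"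
  by (rule subsetD[OF conjunct2[OF subalgebra_H[unfolded subalgebra_def]] good_H])

text \<open>Ville's inequality: the integrand is \<open>sn\<close>, replaced for good by \<open>T\<close> once it has exceeded \<open>T\<close>.\<close>

lemma emeasure_not_good:
  "n \<le> T \<Longrightarrow> (\<integral>\<^sup>+\<omega>. ennreal (real T) * indicator (space M - good n) \<omega> + indicator (good n) \<omega> * ennreal (sn n \<omega>) \<partial>M) \<le> 1"
proof (induction n)
  case 0
  have "good 0 = space M" using T_pos by (auto simp: good_def sn_def)
  then have "(\<integral>\<^sup>+\<omega>. ennreal (real T) * indicator (space M - good 0) \<omega> + indicator (good 0) \<omega> * ennreal (sn 0 \<omega>) \<partial>M)
      = (\<integral>\<^sup>+\<omega>. 1 \<partial>M)"
    by (intro nn_integral_cong) (auto simp: sn_def)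
  then show ?case by (simp add: emeasure_space_1)
next
  case (Suc n)
  have n: "n \<le> T" using Suc.prems by simp
  have [measurable]: "good n \<in> sets M" "sn n \<in> borel_measurable M" "sn (Suc n) \<in> borel_measurable M"
    using good_sets[OF n] sn_meas[OF n] sn_meas[OF Suc.prems] by auto
  have goodH: "(indicator (good n) :: 'o \<Rightarrow> ennreal) \<in> borel_measurable (H n)"
    using good_H[OF n] by (rule borel_measurable_indicator)
  let ?b = "\<lambda>\<omega>. ennreal (real T) * indicator (space M - good n) \<omega>"
  have "(\<integral>\<^sup>+\<omega>. ennreal (real T) * indicator (space M - good (Suc n)) \<omega> + indicator (good (Suc n)) \<omega> * ennreal (sn (Suc n) \<omega>) \<partial>M)
      \<le> (\<integral>\<^sup>+\<omega>. ?b \<omega> + indicator (good n) \<omega> * ennreal (sn (Suc n) \<omega>) \<partial>M)"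
  \<comment> \<open>A path that leaves the good set in this step has
    \<open>sn (Suc n) \<omega> > T\<close>, so lowering its contribution to \<open>T\<close> only
    decreases the integrand.\<close>
  proof (rule nn_integral_mono)
    fix \<omega> assume \<omega>: "\<omega> \<in> space M"
    have g: "\<omega> \<in> good (Suc n) \<longleftrightarrow> \<omega> \<in> good n \<and> sn (Suc n) \<omega> \<le> real T"
      using \<omega> by (auto simp: good_def le_Suc_eq)
    show "ennreal (real T) * indicator (space M - good (Suc n)) \<omega> + indicator (good (Suc n)) \<omega> * ennreal (sn (Suc n) \<omega>)
        \<le> ?b \<omega> + indicator (good n) \<omega> * ennreal (sn (Suc n) \<omega>)"
      using g \<omega> by (cases "\<omega> \<in> good n"; cases "sn (Suc n) \<omega> \<le> real T") (auto intro!: ennreal_leI)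
  qed
  also have "\<dots> = (\<integral>\<^sup>+\<omega>. ?b \<omega> \<partial>M) + (\<integral>\<^sup>+\<omega>. indicator (good n) \<omega> * ennreal (sn (Suc n) \<omega>) \<partial>M)"
    by (rule nn_integral_add) measurable
  also have "\<dots> \<le> (\<integral>\<^sup>+\<omega>. ?b \<omega> \<partial>M) + (\<integral>\<^sup>+\<omega>. indicator (good n) \<omega> * ennreal (sn n \<omega>) \<partial>M)"
    by (intro add_left_mono sn_step Suc.prems goodH)
  also have "\<dots> = (\<integral>\<^sup>+\<omega>. ?b \<omega> + indicator (good n) \<omega> * ennreal (sn n \<omega>) \<partial>M)"
    by (rule nn_integral_add[symmetric]) measurable
  also have "\<dots> \<le> 1" by (rule Suc.IH[OF n])
  finally show ?case .
qed

lemma prob_not_good: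
  assumes n: "n \<le> T"
  shows "prob (space M - good n) \<le> 1 / real T"
proof -
  have [measurable]: "good n \<in> sets M" by (rule good_sets[OF n])
  have "ennreal (real T * prob (space M - good n)) = (\<integral>\<^sup>+\<omega>. ennreal (real T) * indicator (space M - good n) \<omega> \<partial>M)"
    by (subst nn_integral_cmult_indicator) (auto simp: emeasure_eq_measure ennreal_mult'')
  also have "\<dots> \<le> (\<integral>\<^sup>+\<omega>. ennreal (real T) * indicator (space M - good n) \<omega> + indicator (good n) \<omega> * ennreal (sn n \<omega>) \<partial>M)"
    by (intro nn_integral_mono) simp
  also have "\<dots> \<le> 1" by (rule emeasure_not_good[OF n])
  finally have "real T * prob (space M - good n) \<le> 1" by simp
  then show ?thesis using T_pos by (simp add: field_simps)
qed

subsection \<open>The queue length\<close>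

text \<open>The norm instead of its square: whatever the queues are, its increments are at most
  \<open>sqrt K * (1 + eps t)\<close>, which the exponential moments require.\<close>

definition qnorm :: "nat \<Rightarrow> 'o \<Rightarrow> real" where
  "qnorm t \<omega> = L2_set (\<lambda>k. Q k t \<omega>) {1..K}"

lemma qnorm_nonneg: "0 \<le> qnorm t \<omega>"
  by (simp add: qnorm_def L2_set_nonneg)

lemma qnorm_sq: "(qnorm t \<omega>)\<^sup>2 = 2 * Lyap t \<omega>"
  by (simp add: qnorm_def Lyap_def L2_set_def sum_nonneg)

lemma Q_le_qnorm: "k \<in> {1..K} \<Longrightarrow> Q k t \<omega> \<le> qnorm t \<omega>"
  unfolding qnorm_def by (rule member_le_L2_set) auto

lemma qnorm_le_sum: "qnorm t \<omega> \<le> (\<Sum>k\<in>{1..K}. Q k t \<omega>)"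
  unfolding qnorm_def using Q_nonneg by (intro L2_set_le_sum) auto

lemma L2_set_le_sqrt_card:
  assumes "\<And>k. k \<in> {1..K} \<Longrightarrow> \<bar>f k\<bar> \<le> (b::real)" "0 \<le> b"
  shows "L2_set f {1..K} \<le> sqrt (real K) * b"
proof -
  have "(\<Sum>k\<in>{1..K}. (f k)\<^sup>2) \<le> (\<Sum>k\<in>{1..K}. b\<^sup>2)"
    using assms by (intro sum_mono) (metis abs_ge_zero power2_abs power_mono)
  then have "sqrt (\<Sum>k\<in>{1..K}. (f k)\<^sup>2) \<le> sqrt (real K * b\<^sup>2)" by (intro real_sqrt_le_mono) simp
  then show ?thesis using assms(2) by (simp add: L2_set_def real_sqrt_mult)
qed

lemma qnorm_le:
  assumes "\<omega> \<in> space M" "n \<le> T"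
  shows "qnorm (Suc n) \<omega> \<le> sqrt (real K) * (real n + 2 * a0 * sqrt (real n))"
  unfolding qnorm_def
proof (rule L2_set_le_sqrt_card)
  fix k assume "k \<in> {1..K}"
  from Q_le[OF this assms] have "Q k (Suc n) \<omega> \<le> real n + 2 * a0 * sqrt (real n)"
    using sum_eps_le[of n] by (simp add: sum.distrib)
  then show "\<bar>Q k (Suc n) \<omega>\<bar> \<le> real n + 2 * a0 * sqrt (real n)" using Q_nonneg by simp
qed (use a0_ge_2 in simp)

lemma qnorm_change:
  assumes t: "t \<in> {1..T}" and \<omega>: "\<omega> \<in> space M"
  shows "\<bar>qnorm (Suc t) \<omega> - qnorm t \<omega>\<bar> \<le> sqrt (real K) * (1 + eps t)"
proof -
  let ?D = "\<lambda>k. Q k (Suc t) \<omega> - Q k t \<omega>"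
  have "L2_set (\<lambda>k. Q k t \<omega> + ?D k) {1..K} \<le> L2_set (\<lambda>k. Q k t \<omega>) {1..K} + L2_set ?D {1..K}"
    by (rule L2_set_triangle_ineq)
  moreover have "L2_set (\<lambda>k. Q k (Suc t) \<omega> + - ?D k) {1..K} \<le> L2_set (\<lambda>k. Q k (Suc t) \<omega>) {1..K} + L2_set (\<lambda>k. - ?D k) {1..K}"
    by (rule L2_set_triangle_ineq)
  moreover have "L2_set (\<lambda>k. - ?D k) {1..K} = L2_set ?D {1..K}"
    by (simp add: L2_set_def power2_commute)
  moreover have "L2_set ?D {1..K} \<le> sqrt (real K) * (1 + eps t)"
    using eps_nonneg[of t] by (intro L2_set_le_sqrt_card Q_change_le(1) t \<omega>) auto
  ultimately show ?thesis by (simp add: qnorm_def)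
qed

lemma qnorm_H:
  assumes "n \<le> T"
  shows "qnorm (Suc n) \<in> borel_measurable (H n)"
proof -
  have [measurable]: "(\<lambda>\<omega>. \<Sum>k\<in>{1..K}. (Q k (Suc n) \<omega>)\<^sup>2) \<in> borel_measurable (H n)"
    by (intro borel_measurable_sum borel_measurable_power Q_H assms)
  show ?thesis unfolding qnorm_def L2_set_def by measurable
qed

lemma qnorm_meas: "n \<le> T \<Longrightarrow> qnorm (Suc n) \<in> borel_measurable M"
  by (rule measurable_from_subalg[OF subalgebra_H qnorm_H])

text \<open>Once \<open>eps t \<le> \<delta> / 2\<close>, the increments of \<open>qnorm\<close> are at most \<open>\<nu>\<close>, and above the level \<open>\<Theta> t\<close>
  its drift is at most \<open>- \<delta> / 4\<close>; \<open>\<zeta>\<close> makes the second-order term of \<open>exp (\<zeta> * qnorm t)\<close>, at most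
  \<open>(\<zeta> * \<nu>)\<^sup>2\<close>, half of \<open>\<zeta> * \<delta> / 4\<close>.\<close>

definition \<zeta> :: real where "\<zeta> = \<delta> / (18 * real K)"
definition \<nu> :: real where "\<nu> = 3 / 2 * sqrt (real K)"
definition \<Theta> :: "nat \<Rightarrow> real" where "\<Theta> t = (4 * V t + 9 / 2 * real K) / \<delta>"

lemma \<zeta>_pos: "0 < \<zeta>"
  using \<delta>_range K_pos by (simp add: \<zeta>_def)

lemma \<zeta>\<nu>: "\<zeta> * \<nu> \<le> 1" "\<zeta>\<^sup>2 * \<nu>\<^sup>2 = \<zeta> * \<delta> / 8" "\<zeta> * \<delta> / 8 = \<delta>\<^sup>2 / (144 * real K)" "\<delta>\<^sup>2 / (144 * real K) \<le> 1"
proof -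
  have K: "real K > 0" "real K \<ge> 1" using K_pos by auto
  have "sqrt (real K) \<le> real K" using K by (simp add: real_le_lsqrt power2_eq_square)
  then have "\<delta> * (3 / 2 * sqrt (real K)) \<le> 1 * (3 / 2 * real K)"
    using \<delta>_range by (intro mult_mono) auto
  then show "\<zeta> * \<nu> \<le> 1" using K by (simp add: \<zeta>_def \<nu>_def field_simps)
  show "\<zeta>\<^sup>2 * \<nu>\<^sup>2 = \<zeta> * \<delta> / 8"
    using K by (simp add: \<zeta>_def \<nu>_def power_mult_distrib power_divide) (simp add: power2_eq_square field_simps)
  show "\<zeta> * \<delta> / 8 = \<delta>\<^sup>2 / (144 * real K)" by (simp add: \<zeta>_def power2_eq_square)
  have "\<delta>\<^sup>2 \<le> 1" using \<delta>_range by (simp add: power_le_one)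
  then show "\<delta>\<^sup>2 / (144 * real K) \<le> 1" using K by simp
qed

lemma \<Theta>_mono: "\<Theta> t \<le> \<Theta> (Suc t)"
  unfolding \<Theta>_def using V_mono[of t] \<delta>_range by (intro divide_right_mono) auto

lemma \<Theta>_pos: "0 < \<Theta> t"
proof -
  have "0 \<le> V t" using \<delta>_range by (simp add: V_param_def)
  then show ?thesis using \<delta>_range K_pos by (simp add: \<Theta>_def add_nonneg_pos)
qed

text \<open>The inequality \<open>2 * f * (f' - f) \<le> f'\<^sup>2 - f\<^sup>2\<close> turns drift
  of the square into drift of the norm. The policy costs are known to be negative only on average
  and cannot be estimated on a path; they are carried along linearly, with weights that depend on
  the past.\<close>

lemma exp_drift_path:
  assumes x: "is_policy C J x" and t: "t \<in> {1..T}" and small: "eps t \<le> \<delta> / 2"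
    and \<omega>: "\<omega> \<in> good (t - 1)" and large: "\<Theta> t \<le> qnorm t \<omega>"
  shows "exp (\<zeta> * qnorm (Suc t) \<omega>) \<le> exp (\<zeta> * qnorm t \<omega>) * (1 + 3 / 8 * (\<zeta> * \<delta>))
    + (\<Sum>k\<in>{1..K}. (exp (\<zeta> * qnorm t \<omega>) * (\<zeta> * Q k t \<omega> / qnorm t \<omega>)) * (eps t + policy_cost x k t \<omega>))"
proof -
  have \<omega>M: "\<omega> \<in> space M" using \<omega> by (simp add: good_def)
  have V: "V t > 0" using t by (intro V_pos) auto
  define f f' S where "f = qnorm t \<omega>" and "f' = qnorm (Suc t) \<omega>"
    and "S = (\<Sum>k\<in>{1..K}. Q k t \<omega> * (eps t + policy_cost x k t \<omega>))"
  define cq pq where "cq = (\<Sum>k\<in>{1..K}. cost k t \<omega> * Q k t \<omega>)"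
    and "pq = (\<Sum>k\<in>{1..K}. policy_cost x k t \<omega> * Q k t \<omega>)"
  have f: "f \<ge> \<Theta> t" "f > 0" using large \<Theta>_pos[of t] by (auto simp: f_def)
  have "excess t \<omega> = 0" using excess_le_sn(2)[OF t \<omega>M] \<omega> by (simp add: good_def)
  then have "cq / V t \<le> min 1 (\<theta>star \<bullet> feat t \<omega> + 2 * radius t * width t \<omega> + 0) + 0
        - policy_reward x t \<omega> + pq / V t"
    using optimism[OF t \<omega>M x] unfolding policy_cost_def policy_reward_def cq_def pq_def by simp
  also have "\<dots> \<le> 1 + pq / V t" using policy_reward_range[OF x t \<omega>M] by auto
  finally have cq: "cq \<le> V t + pq" using V by (simp add: field_simps)
  have e: "0 \<le> eps t" "eps t \<le> 1 / 2" using eps_nonneg small \<delta>_range by auto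
  have e2: "(1 + eps t)\<^sup>2 \<le> 9 / 4" using e power_mono[of "1 + eps t" "3 / 2" 2] by (simp add: power2_eq_square)
  have "f'\<^sup>2 \<le> f\<^sup>2 + 2 * cq + 2 * (eps t * (\<Sum>k\<in>{1..K}. Q k t \<omega>)) + real K * (1 + eps t)\<^sup>2"
    using Lyap_drift[OF t \<omega>M] by (simp add: f_def f'_def qnorm_sq cq_def)
  also have "\<dots> \<le> f\<^sup>2 + (2 * V t + 9 / 4 * real K) + 2 * S"
  proof -
    have "S = eps t * (\<Sum>k\<in>{1..K}. Q k t \<omega>) + pq"
      by (simp add: S_def pq_def sum.distrib sum_distrib_left algebra_simps)
    moreover have "real K * (1 + eps t)\<^sup>2 \<le> real K * (9 / 4)" using e2 by (intro mult_left_mono) auto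
    ultimately show ?thesis using cq by linarith
  qed
  finally have sq: "f'\<^sup>2 - f\<^sup>2 \<le> (2 * V t + 9 / 4 * real K) + 2 * S" by simp
  have "(f' - f) * (2 * f) \<le> f'\<^sup>2 - f\<^sup>2"
    using zero_le_power2[of "f' - f"] by (simp add: power2_eq_square algebra_simps)
  also have "\<dots> \<le> (2 * V t + 9 / 4 * real K) + 2 * S" by (rule sq)
  \<comment> \<open>This fixes \<open>\<Theta> t\<close>: half of
    \<open>\<delta> * \<Theta> t\<close> is exactly the left-hand side.\<close>
  also have "2 * V t + 9 / 4 * real K \<le> \<delta> / 4 * (2 * f)"
    using f(1) \<delta>_range by (simp add: \<Theta>_def field_simps)
  finally have "f' - f \<le> \<delta> / 4 + S / f" using f(2) by (simp add: field_simps)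
  then have lin: "\<zeta> * (f' - f) \<le> \<zeta> * \<delta> / 4 + \<zeta> * S / f"
    using \<zeta>_pos mult_left_mono[of "f' - f" "\<delta> / 4 + S / f" \<zeta>] by (simp add: distrib_left)
  have "sqrt (real K) * (1 + eps t) \<le> \<nu>"
    using e mult_left_mono[of "1 + eps t" "3 / 2" "sqrt (real K)"] by (simp add: \<nu>_def)
  then have ch: "\<bar>f' - f\<bar> \<le> \<nu>" using qnorm_change[OF t \<omega>M] by (simp add: f_def f'_def)
  have abs: "\<bar>\<zeta> * (f' - f)\<bar> \<le> \<zeta> * \<nu>" using ch \<zeta>_pos by (simp add: abs_mult)
  have "(\<zeta> * (f' - f))\<^sup>2 \<le> (\<zeta> * \<nu>)\<^sup>2" using abs by (metis abs_ge_zero power2_abs power_mono)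
  also have "\<dots> = \<zeta> * \<delta> / 8" by (simp add: power_mult_distrib \<zeta>\<nu>)
  finally have quad: "(\<zeta> * (f' - f))\<^sup>2 \<le> \<zeta> * \<delta> / 8" .
  have "exp (\<zeta> * f') = exp (\<zeta> * f) * exp (\<zeta> * (f' - f))" by (simp add: exp_add[symmetric] algebra_simps)
  also have "\<dots> \<le> exp (\<zeta> * f) * ((1 + 3 / 8 * (\<zeta> * \<delta>)) + \<zeta> * S / f)"
  proof (rule mult_left_mono)
    \<comment> \<open>The coefficient 3/8 is 1/4 from the linear term plus 1/8 from the quadratic
      one.\<close>
    show "exp (\<zeta> * (f' - f)) \<le> (1 + 3 / 8 * (\<zeta> * \<delta>)) + \<zeta> * S / f"
      using exp_le_quadratic[of "\<zeta> * (f' - f)"] abs \<zeta>\<nu>(1) lin quad by linarith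
  qed simp
  also have "\<dots> = exp (\<zeta> * f) * (1 + 3 / 8 * (\<zeta> * \<delta>))
    + (\<Sum>k\<in>{1..K}. (exp (\<zeta> * f) * (\<zeta> * Q k t \<omega> / f)) * (eps t + policy_cost x k t \<omega>))"
    by (simp add: S_def sum_distrib_left sum_divide_distrib distrib_left mult_ac)
  finally show ?thesis by (simp add: f_def f'_def)
qed

lemma integrable_bounded_on_space:
  fixes g :: "'o \<Rightarrow> real"
  assumes "g \<in> borel_measurable M" "\<And>\<omega>. \<omega> \<in> space M \<Longrightarrow> \<bar>g \<omega>\<bar> \<le> b"
  shows "integrable M g"
  by (rule integrable_const_bound[of _ b]) (use assms in auto)

lemma exp_qnorm_integrable:
  assumes n: "n \<le> T" and S: "S \<in> sets M"
  shows "integrable M (\<lambda>\<omega>. indicator S \<omega> * exp (\<zeta> * qnorm (Suc n) \<omega>))"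
proof (rule integrable_bounded_on_space)
  show "(\<lambda>\<omega>. indicator S \<omega> * exp (\<zeta> * qnorm (Suc n) \<omega>)) \<in> borel_measurable M"
    using qnorm_meas[OF n] S by measurable
  show "\<bar>indicator S \<omega> * exp (\<zeta> * qnorm (Suc n) \<omega>)\<bar> \<le> exp (\<zeta> * (sqrt (real K) * (real n + 2 * a0 * sqrt (real n))))"
    if "\<omega> \<in> space M" for \<omega>
    using qnorm_le[OF that n] \<zeta>_pos by (auto simp: indicator_def)
qed

lemma good_qnorm_integrable:
  assumes n: "n \<le> T"
  shows "integrable M (\<lambda>\<omega>. indicator (good n) \<omega> * qnorm (Suc n) \<omega>)"
proof (rule integrable_bounded_on_space)
  show "(\<lambda>\<omega>. indicator (good n) \<omega> * qnorm (Suc n) \<omega>) \<in> borel_measurable M"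
    using qnorm_meas[OF n] good_sets[OF n] by measurable
  show "\<bar>indicator (good n) \<omega> * qnorm (Suc n) \<omega>\<bar> \<le> sqrt (real K) * (real n + 2 * a0 * sqrt (real n))"
    if "\<omega> \<in> space M" for \<omega>
    using qnorm_le[OF that n] qnorm_nonneg[of "Suc n" \<omega>] by (auto simp: indicator_def)
qed

text \<open>Averaging over the fresh draw replaces pessimism plus policy cost by at most
  \<open>- \<delta> / 2\<close>, as the pessimism uses up at most half of the Slater slack. Paths
  below the level are not contracted; after one bounded increment they contribute at most the
  additive constant.\<close>

lemma exp_drift:
  assumes xs: "is_policy C J x" "\<And>k. k \<in> {1..K} \<Longrightarrow> policy_avg C J p (w k) x \<le> - \<delta>"
    and n: "Suc n \<le> T" and small: "eps (Suc n) \<le> \<delta> / 2"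
  shows "(\<integral>\<omega>. indicator (good n) \<omega> * exp (\<zeta> * qnorm (Suc (Suc n)) \<omega>) \<partial>M)
    \<le> (1 - \<delta>\<^sup>2 / (144 * real K)) * (\<integral>\<omega>. indicator (good n) \<omega> * exp (\<zeta> * qnorm (Suc n) \<omega>) \<partial>M)
       + exp (\<zeta> * (\<Theta> (Suc n) + \<nu>))"
proof -
  let ?t = "Suc n"
  have t: "?t \<in> {1..T}" and nT: "n \<le> T" using n by auto
  define S where "S = {\<omega> \<in> good n. \<Theta> ?t \<le> qnorm ?t \<omega>}"
  have SH: "S \<in> sets (H n)"
  proof -
    have "{\<omega> \<in> space (H n). \<Theta> ?t \<le> qnorm ?t \<omega>} \<in> sets (H n)"
      using qnorm_H[OF nT] by measurable
    moreover have "S = good n \<inter> {\<omega> \<in> space (H n). \<Theta> ?t \<le> qnorm ?t \<omega>}"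
      using space_H[OF nT] by (auto simp: S_def good_def)
    ultimately show ?thesis using good_H[OF nT] by auto
  qed
  have S: "S \<in> sets M" by (rule subsetD[OF conjunct2[OF subalgebra_H[OF nT, unfolded subalgebra_def]] SH])
  define E where "E \<omega> = indicator S \<omega> * exp (\<zeta> * qnorm ?t \<omega>)" for \<omega>
  define Z where "Z k \<omega> = E \<omega> * (\<zeta> * Q k ?t \<omega> / qnorm ?t \<omega>)" for k \<omega>
  define X where "X = exp (\<zeta> * (\<Theta> ?t + \<nu>))"
  have Ei: "integrable M E" unfolding E_def by (rule exp_qnorm_integrable[OF nT S])
  have E0: "0 \<le> E \<omega>" for \<omega> by (simp add: E_def)
  have EH: "E \<in> borel_measurable (H n)" unfolding E_def using qnorm_H[OF nT] SH by measurable
  have ZH: "Z k \<in> borel_measurable (H n)" if "k \<in> {1..K}" for k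
    unfolding Z_def using EH qnorm_H[OF nT] Q_H[OF that nT] by measurable
  have ZM: "Z k \<in> borel_measurable M" if "k \<in> {1..K}" for k
    by (rule measurable_from_subalg[OF subalgebra_H[OF nT] ZH[OF that]])
  have Z0: "0 \<le> Z k \<omega>" for k \<omega>
    unfolding Z_def using E0 \<zeta>_pos Q_nonneg qnorm_nonneg by (intro mult_nonneg_nonneg divide_nonneg_nonneg) auto
  have ratio: "Q k ?t \<omega> / qnorm ?t \<omega> \<le> 1" if "k \<in> {1..K}" for k \<omega>
    using Q_le_qnorm[OF that, of ?t \<omega>] qnorm_nonneg[of ?t \<omega>] by (auto simp: divide_le_eq_1)
  have Zi: "integrable M (Z k)" if k: "k \<in> {1..K}" for k
  proof (rule Bochner_Integration.integrable_bound[of _ "\<lambda>\<omega>. \<zeta> * E \<omega>"])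
    show "AE \<omega> in M. norm (Z k \<omega>) \<le> norm (\<zeta> * E \<omega>)"
    proof (rule AE_I2)
      fix \<omega>
      have "Z k \<omega> = (\<zeta> * E \<omega>) * (Q k ?t \<omega> / qnorm ?t \<omega>)" by (simp add: Z_def)
      also have "\<dots> \<le> (\<zeta> * E \<omega>) * 1" using ratio[OF k] \<zeta>_pos E0 by (intro mult_left_mono) auto
      finally show "norm (Z k \<omega>) \<le> norm (\<zeta> * E \<omega>)" using Z0 E0 \<zeta>_pos by simp
    qed
  qed (use Ei ZM[OF k] in auto)
  have ZPi: "integrable M (\<lambda>\<omega>. policy_cost x k ?t \<omega> * Z k \<omega>)" if k: "k \<in> {1..K}" for k
  proof (rule Bochner_Integration.integrable_bound[OF Zi[OF k]])
    show "(\<lambda>\<omega>. policy_cost x k ?t \<omega> * Z k \<omega>) \<in> borel_measurable M"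
      using policy_cost_meas[OF k t] ZM[OF k] by measurable
    show "AE \<omega> in M. norm (policy_cost x k ?t \<omega> * Z k \<omega>) \<le> norm (Z k \<omega>)"
      using policy_cost_bound[OF xs(1) k t] by (auto simp: abs_mult intro!: mult_left_le_one_le)
  qed
  have terms: "integrable M (\<lambda>\<omega>. eps ?t * Z k \<omega> + policy_cost x k ?t \<omega> * Z k \<omega>)" if k: "k \<in> {1..K}" for k
    using Zi[OF k] ZPi[OF k] by (intro Bochner_Integration.integrable_add integrable_mult_right)
  have sumi: "integrable M (\<lambda>\<omega>. \<Sum>k\<in>{1..K}. eps ?t * Z k \<omega> + policy_cost x k ?t \<omega> * Z k \<omega>)"
    using terms by (rule Bochner_Integration.integrable_sum)
  have gi: "integrable M (\<lambda>\<omega>. indicator (good n) \<omega> * exp (\<zeta> * qnorm ?t \<omega>))"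
    by (rule exp_qnorm_integrable[OF nT good_sets[OF nT]])
  have gi': "integrable M (\<lambda>\<omega>. indicator (good n) \<omega> * exp (\<zeta> * qnorm (Suc ?t) \<omega>))"
    by (rule exp_qnorm_integrable[OF n good_sets[OF nT]])
  have path: "indicator (good n) \<omega> * exp (\<zeta> * qnorm (Suc ?t) \<omega>)
      \<le> (1 + 3 / 8 * (\<zeta> * \<delta>)) * E \<omega> + (\<Sum>k\<in>{1..K}. eps ?t * Z k \<omega> + policy_cost x k ?t \<omega> * Z k \<omega>) + X"
    if \<omega>: "\<omega> \<in> space M" for \<omega>
  proof (cases "\<omega> \<in> S")
    case True
    then have g: "\<omega> \<in> good (?t - 1)" "\<Theta> ?t \<le> qnorm ?t \<omega>" by (auto simp: S_def)
    have "exp (\<zeta> * qnorm (Suc ?t) \<omega>) \<le> (1 + 3 / 8 * (\<zeta> * \<delta>)) * E \<omega> + (\<Sum>k\<in>{1..K}. eps ?t * Z k \<omega> + policy_cost x k ?t \<omega> * Z k \<omega>)"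
    proof -
      have e: "exp (\<zeta> * qnorm ?t \<omega>) = E \<omega>" using True by (simp add: E_def)
      show ?thesis
        using exp_drift_path[OF xs(1) t small g] unfolding e Z_def[symmetric]
        by (simp add: distrib_left mult.commute)
    qed
    moreover have "0 \<le> X" by (simp add: X_def)
    ultimately show ?thesis using g by simp
  next
    case False
    have z: "(1 + 3 / 8 * (\<zeta> * \<delta>)) * E \<omega> + (\<Sum>k\<in>{1..K}. eps ?t * Z k \<omega> + policy_cost x k ?t \<omega> * Z k \<omega>) = 0"
      using False by (simp add: E_def Z_def)
    show ?thesis
    proof (cases "\<omega> \<in> good n")
      case True
      then have "qnorm ?t \<omega> \<le> \<Theta> ?t" using False by (auto simp: S_def)
      moreover have "sqrt (real K) * (1 + eps ?t) \<le> \<nu>"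
        using small \<delta>_range mult_left_mono[of "1 + eps ?t" "3 / 2" "sqrt (real K)"] by (simp add: \<nu>_def)
      ultimately have "qnorm (Suc ?t) \<omega> \<le> \<Theta> ?t + \<nu>" using qnorm_change[OF t \<omega>] by linarith
      then show ?thesis unfolding z using True \<zeta>_pos by (simp add: X_def)
    next
      case False
      then show ?thesis unfolding z by (simp add: X_def)
    qed
  qed
  have "(\<integral>\<omega>. indicator (good n) \<omega> * exp (\<zeta> * qnorm (Suc ?t) \<omega>) \<partial>M)
      \<le> (\<integral>\<omega>. (1 + 3 / 8 * (\<zeta> * \<delta>)) * E \<omega> + (\<Sum>k\<in>{1..K}. eps ?t * Z k \<omega> + policy_cost x k ?t \<omega> * Z k \<omega>) + X \<partial>M)"
    by (intro integral_mono path Bochner_Integration.integrable_add integrable_mult_right integrable_const gi' Ei sumi)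
  also have "\<dots> = (1 + 3 / 8 * (\<zeta> * \<delta>)) * (\<integral>\<omega>. E \<omega> \<partial>M)
      + (\<integral>\<omega>. (\<Sum>k\<in>{1..K}. eps ?t * Z k \<omega> + policy_cost x k ?t \<omega> * Z k \<omega>) \<partial>M) + X"
    using Ei sumi by (simp add: prob_space)
  also have "(\<integral>\<omega>. (\<Sum>k\<in>{1..K}. eps ?t * Z k \<omega> + policy_cost x k ?t \<omega> * Z k \<omega>) \<partial>M)
      = (\<Sum>k\<in>{1..K}. \<integral>\<omega>. eps ?t * Z k \<omega> + policy_cost x k ?t \<omega> * Z k \<omega> \<partial>M)"
    using terms by (rule Bochner_Integration.integral_sum)
  also have "\<dots> \<le> (\<Sum>k\<in>{1..K}. - (\<delta> / 2) * (\<integral>\<omega>. Z k \<omega> \<partial>M))"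
  proof (rule sum_mono)
    fix k assume k: "k \<in> {1..K}"
    have Zt: "Z k \<in> borel_measurable (H (?t - 1))" using ZH[OF k] by simp
    have "(\<integral>\<omega>. eps ?t * Z k \<omega> + policy_cost x k ?t \<omega> * Z k \<omega> \<partial>M)
        = (eps ?t + policy_avg C J p (w k) x) * (\<integral>\<omega>. Z k \<omega> \<partial>M)"
      using Zi[OF k] ZPi[OF k] fresh_policy_cost[OF xs(1) k t Zt Zi[OF k]] by (simp add: distrib_right)
    also have "\<dots> \<le> - (\<delta> / 2) * (\<integral>\<omega>. Z k \<omega> \<partial>M)"
      using small xs(2)[OF k] Z0 by (intro mult_right_mono integral_nonneg_AE) auto
    finally show "(\<integral>\<omega>. eps ?t * Z k \<omega> + policy_cost x k ?t \<omega> * Z k \<omega> \<partial>M) \<le> - (\<delta> / 2) * (\<integral>\<omega>. Z k \<omega> \<partial>M)" .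
  qed
  also have "\<dots> = - (\<delta> / 2) * (\<integral>\<omega>. (\<Sum>k\<in>{1..K}. Z k \<omega>) \<partial>M)"
  proof -
    have "(\<integral>\<omega>. (\<Sum>k\<in>{1..K}. Z k \<omega>) \<partial>M) = (\<Sum>k\<in>{1..K}. \<integral>\<omega>. Z k \<omega> \<partial>M)"
      by (rule Bochner_Integration.integral_sum) (rule Zi)
    then show ?thesis by (simp only: sum_distrib_left)
  qed
  \<comment> \<open>The sum of nonnegative queues is at least their Euclidean norm, so the
    normalized queues add up to at least 1 on \<open>S\<close>.\<close>
  also have "\<dots> \<le> - (\<delta> / 2) * (\<integral>\<omega>. \<zeta> * E \<omega> \<partial>M)"
  proof (rule mult_left_mono_neg)
    show "(\<integral>\<omega>. \<zeta> * E \<omega> \<partial>M) \<le> (\<integral>\<omega>. (\<Sum>k\<in>{1..K}. Z k \<omega>) \<partial>M)"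
    proof (rule integral_mono)
      fix \<omega> assume "\<omega> \<in> space M"
      show "\<zeta> * E \<omega> \<le> (\<Sum>k\<in>{1..K}. Z k \<omega>)"
      proof (cases "\<omega> \<in> S")
        case True
        then have q: "qnorm ?t \<omega> > 0" using \<Theta>_pos[of ?t] by (auto simp: S_def)
        have "(\<zeta> * E \<omega>) * 1 \<le> (\<zeta> * E \<omega>) * ((\<Sum>k\<in>{1..K}. Q k ?t \<omega>) / qnorm ?t \<omega>)"
          using q qnorm_le_sum[of ?t \<omega>] E0 \<zeta>_pos by (intro mult_left_mono) (auto simp: le_divide_eq)
        also have "\<dots> = (\<Sum>k\<in>{1..K}. Z k \<omega>)"
          by (simp add: Z_def sum_distrib_left sum_divide_distrib mult_ac)
        finally show ?thesis by simp
      qed (simp add: E_def Z_def)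
    next
      show "integrable M (\<lambda>\<omega>. \<Sum>k\<in>{1..K}. Z k \<omega>)"
        by (rule Bochner_Integration.integrable_sum) (rule Zi)
    qed (use Ei in simp)
  qed (use \<delta>_range in simp)
  \<comment> \<open>The net rate in units of \<open>\<zeta> * \<delta>\<close> is
    \<open>3/8 - 1/2 = - 1/8\<close>.\<close>
  also have "(1 + 3 / 8 * (\<zeta> * \<delta>)) * (\<integral>\<omega>. E \<omega> \<partial>M) + - (\<delta> / 2) * (\<integral>\<omega>. \<zeta> * E \<omega> \<partial>M) + X
      = (1 - \<zeta> * \<delta> / 8) * (\<integral>\<omega>. E \<omega> \<partial>M) + X"
    by (simp add: algebra_simps)
  also have "\<dots> \<le> (1 - \<zeta> * \<delta> / 8) * (\<integral>\<omega>. indicator (good n) \<omega> * exp (\<zeta> * qnorm ?t \<omega>) \<partial>M) + X"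
  proof (intro add_right_mono mult_left_mono integral_mono Ei gi)
    show "E \<omega> \<le> indicator (good n) \<omega> * exp (\<zeta> * qnorm ?t \<omega>)" for \<omega>
      by (auto simp: E_def S_def indicator_def)
    show "0 \<le> 1 - \<zeta> * \<delta> / 8" using \<zeta>\<nu>(3,4) by simp
  qed
  finally show ?thesis by (simp add: \<zeta>\<nu>(3) X_def)
qed

section \<open>Moments of the queue norm\<close>

definition F0 :: real where "F0 = 24 * (real K)\<^sup>2 / \<delta>\<^sup>2 + 24 * (real K)\<^sup>2 / \<delta>"

text \<open>Rounds with \<open>eps n > \<delta> / 2\<close> satisfy
  \<open>sqrt n < 2 * a0 / \<delta>\<close>, and the trivial growth bound up to that time gives
  \<open>F0\<close>, with \<open>sqrt K * a0\<^sup>2 = 6 * K\<^sup>2\<close>. The case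
  \<open>n = 0\<close> is listed separately because division by zero makes
  \<open>eps 0 = 0\<close>.\<close>

lemma qnorm_early:
  assumes n: "n \<le> T" and \<omega>: "\<omega> \<in> space M" and early: "n = 0 \<or> eps n > \<delta> / 2"
  shows "qnorm (Suc n) \<omega> \<le> F0"
proof -
  have K: "sqrt (real K) * a0\<^sup>2 = 6 * (real K)\<^sup>2"
  proof -
    have "sqrt (real K) * real K powr (3/2) = real K powr 2"
      using K_pos by (simp add: powr_half_sqrt[symmetric] powr_add[symmetric])
    also have "\<dots> = (real K)\<^sup>2" using K_pos by (subst powr_numeral) auto
    finally show ?thesis by (simp add: a0_sq)
  qed
  have s: "sqrt (real n) \<le> 2 * a0 / \<delta>"
  proof (cases "n = 0")
    case False
    then have "a0 / sqrt (real n) > \<delta> / 2" using early by (simp add: eps_eq)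
    then show ?thesis using False \<delta>_range by (simp add: field_simps)
  qed (use a0_ge_2 \<delta>_range in simp)
  have "real n = (sqrt (real n))\<^sup>2" by simp
  also have "\<dots> \<le> (2 * a0 / \<delta>)\<^sup>2" using s by (intro power_mono) auto
  finally have n2: "real n \<le> 4 * a0\<^sup>2 / \<delta>\<^sup>2" by (simp add: power_divide power_mult_distrib)
  have "qnorm (Suc n) \<omega> \<le> sqrt (real K) * (real n + 2 * a0 * sqrt (real n))" by (rule qnorm_le[OF \<omega> n])
  also have "\<dots> \<le> sqrt (real K) * (4 * a0\<^sup>2 / \<delta>\<^sup>2 + 2 * a0 * (2 * a0 / \<delta>))"
    using n2 s a0_ge_2 by (intro mult_left_mono add_mono) auto
  also have "\<dots> = 4 * (sqrt (real K) * a0\<^sup>2) / \<delta>\<^sup>2 + 4 * (sqrt (real K) * a0\<^sup>2) / \<delta>"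
    by (simp add: power2_eq_square algebra_simps)
  also have "\<dots> = F0" unfolding K by (simp add: F0_def)
  finally show ?thesis .
qed

lemma exp_moment:
  assumes xs: "is_policy C J x" "\<And>k. k \<in> {1..K} \<Longrightarrow> policy_avg C J p (w k) x \<le> - \<delta>"
  shows "n \<le> T \<Longrightarrow> (\<integral>\<omega>. indicator (good n) \<omega> * exp (\<zeta> * qnorm (Suc n) \<omega>) \<partial>M)
    \<le> exp (\<zeta> * F0) + exp (\<zeta> * (\<Theta> n + \<nu>)) * (144 * real K / \<delta>\<^sup>2)"
proof (induction n)
  case 0
  have c: "144 * real K / \<delta>\<^sup>2 \<ge> 0" by simp
  have "(\<integral>\<omega>. indicator (good 0) \<omega> * exp (\<zeta> * qnorm (Suc 0) \<omega>) \<partial>M) \<le> exp (\<zeta> * F0)"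
    using qnorm_early[of 0] \<zeta>_pos exp_qnorm_integrable[of 0 "good 0"] good_sets[of 0]
    by (intro integral_le_const) (auto simp: indicator_def)
  then show ?case using c by (simp add: add_increasing2)
next
  case (Suc n)
  have n: "n \<le> T" using Suc.prems by simp
  define c where "c = 144 * real K / \<delta>\<^sup>2"
  have c: "c > 0" using K_pos \<delta>_range by (simp add: c_def)
  have rho: "\<delta>\<^sup>2 / (144 * real K) = 1 / c" by (simp add: c_def)
  let ?u = "\<integral>\<omega>. indicator (good (Suc n)) \<omega> * exp (\<zeta> * qnorm (Suc (Suc n)) \<omega>) \<partial>M"
  show ?case
  proof (cases "eps (Suc n) \<le> \<delta> / 2")
    case False
    then have "?u \<le> exp (\<zeta> * F0)"
      using qnorm_early[OF Suc.prems] \<zeta>_pos exp_qnorm_integrable[OF Suc.prems good_sets[OF Suc.prems]]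
      by (intro integral_le_const) (auto simp: indicator_def)
    also have "\<dots> \<le> exp (\<zeta> * F0) + exp (\<zeta> * (\<Theta> (Suc n) + \<nu>)) * c" using c by simp
    finally show ?thesis unfolding c_def .
  next
    case True
    define X where "X = exp (\<zeta> * (\<Theta> (Suc n) + \<nu>))"
    have "?u \<le> (\<integral>\<omega>. indicator (good n) \<omega> * exp (\<zeta> * qnorm (Suc (Suc n)) \<omega>) \<partial>M)"
      by (intro integral_mono exp_qnorm_integrable Suc.prems good_sets n)
         (auto simp: indicator_def good_def)
    also have "\<dots> \<le> (1 - 1 / c) * (\<integral>\<omega>. indicator (good n) \<omega> * exp (\<zeta> * qnorm (Suc n) \<omega>) \<partial>M) + X"
      using exp_drift[OF xs Suc.prems True] by (simp add: rho X_def)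
    also have "\<dots> \<le> (1 - 1 / c) * (exp (\<zeta> * F0) + X * c) + X"
    proof (intro add_right_mono mult_left_mono)
      show "0 \<le> 1 - 1 / c" using \<zeta>\<nu>(4) by (simp add: rho)
      have "exp (\<zeta> * (\<Theta> n + \<nu>)) \<le> X" unfolding X_def using \<Theta>_mono[of n] \<zeta>_pos by simp
      then show "(\<integral>\<omega>. indicator (good n) \<omega> * exp (\<zeta> * qnorm (Suc n) \<omega>) \<partial>M) \<le> exp (\<zeta> * F0) + X * c"
        using Suc.IH[OF n] c mult_right_mono[of "exp (\<zeta> * (\<Theta> n + \<nu>))" X c] unfolding c_def[symmetric] by linarith
    qed
    also have "\<dots> \<le> exp (\<zeta> * F0) + X * c" using c by (simp add: field_simps)
    finally show ?thesis unfolding X_def c_def .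
  qed
qed

lemma expected_qnorm_le:
  assumes xs: "is_policy C J x" "\<And>k. k \<in> {1..K} \<Longrightarrow> policy_avg C J p (w k) x \<le> - \<delta>"
    and n: "n \<le> T"
  shows "(\<integral>\<omega>. indicator (good n) \<omega> * qnorm (Suc n) \<omega> \<partial>M)
    \<le> F0 + \<Theta> n + \<nu> + 18 * real K / \<delta> * ln (1 + 144 * real K / \<delta>\<^sup>2)"
proof -
  define c N l where "c = 144 * real K / \<delta>\<^sup>2" and "N = exp (\<zeta> * (F0 + \<Theta> n + \<nu>)) * (1 + c)"
    and "l = \<zeta> * (F0 + \<Theta> n + \<nu>) + ln (1 + c)"
  have K: "real K \<ge> 1" using K_pos by simp
  have "\<delta>\<^sup>2 \<le> 1" using \<delta>_range by (simp add: power_le_one)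
  then have "144 * 1 / 1 \<le> c" unfolding c_def using K \<delta>_range by (intro frac_le) auto
  then have c: "c \<ge> 144" by simp
  have F0: "F0 \<ge> 0" using \<delta>_range by (simp add: F0_def)
  have \<nu>: "\<nu> \<ge> 0" by (simp add: \<nu>_def)
  have N: "N > 0" "N = exp l" using c by (auto simp: N_def l_def exp_add)
  have "ln (exp 1) \<le> ln (1 + c)" using c exp_le by (subst ln_le_cancel_iff) auto
  then have l: "l \<ge> 1" using \<zeta>_pos F0 \<nu> \<Theta>_pos[of n] by (simp add: l_def add_increasing)
  let ?u = "\<integral>\<omega>. indicator (good n) \<omega> * exp (\<zeta> * qnorm (Suc n) \<omega>) \<partial>M"
  have "?u \<le> exp (\<zeta> * F0) + exp (\<zeta> * (\<Theta> n + \<nu>)) * c"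
    using exp_moment[OF xs n] by (simp add: c_def)
  also have "\<dots> \<le> exp (\<zeta> * (F0 + \<Theta> n + \<nu>)) + exp (\<zeta> * (F0 + \<Theta> n + \<nu>)) * c"
    using F0 \<nu> \<Theta>_pos[of n] \<zeta>_pos c by (intro add_mono mult_right_mono) auto
  also have "\<dots> = N" by (simp add: N_def distrib_left)
  finally have u: "?u \<le> N" .
  have gi: "integrable M (\<lambda>\<omega>. indicator (good n) \<omega> * exp (\<zeta> * qnorm (Suc n) \<omega>))"
    by (rule exp_qnorm_integrable[OF n good_sets[OF n]])
  have "\<zeta> * (\<integral>\<omega>. indicator (good n) \<omega> * qnorm (Suc n) \<omega> \<partial>M) = (\<integral>\<omega>. \<zeta> * (indicator (good n) \<omega> * qnorm (Suc n) \<omega>) \<partial>M)"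
    by simp
  also have "\<dots> \<le> (\<integral>\<omega>. (l - 1) + (indicator (good n) \<omega> * exp (\<zeta> * qnorm (Suc n) \<omega>)) / N \<partial>M)"
  proof (rule integral_mono)
    have "integrable M (\<lambda>\<omega>. indicator (good n) \<omega> * qnorm (Suc n) \<omega>)" by (rule good_qnorm_integrable[OF n])
    then show "integrable M (\<lambda>\<omega>. \<zeta> * (indicator (good n) \<omega> * qnorm (Suc n) \<omega>))" by simp
    show "integrable M (\<lambda>\<omega>. (l - 1) + (indicator (good n) \<omega> * exp (\<zeta> * qnorm (Suc n) \<omega>)) / N)"
      using gi by simp
    fix \<omega>
    \<comment> \<open>Jensen's inequality in tangent form: the exponential lies above its tangent at
      \<open>l = ln N\<close>. Off the good set the bound reads \<open>0 \<le> l - 1\<close>, which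
      is why \<open>l \<ge> 1\<close> was secured.\<close>
    have "1 + (\<zeta> * qnorm (Suc n) \<omega> - l) \<le> exp (\<zeta> * qnorm (Suc n) \<omega> - l)" by (rule exp_ge_add_one_self)
    also have "\<dots> = exp (\<zeta> * qnorm (Suc n) \<omega>) / N" by (simp add: N(2) exp_diff)
    finally show "\<zeta> * (indicator (good n) \<omega> * qnorm (Suc n) \<omega>)
        \<le> (l - 1) + (indicator (good n) \<omega> * exp (\<zeta> * qnorm (Suc n) \<omega>)) / N"
      using l by (simp add: indicator_def)
  qed
  also have "\<dots> = (l - 1) + ?u / N" using gi by (simp add: prob_space)
  also have "\<dots> \<le> l" using u N by (simp add: divide_le_eq_1)
  finally have "(\<integral>\<omega>. indicator (good n) \<omega> * qnorm (Suc n) \<omega> \<partial>M) \<le> l / \<zeta>"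
    using \<zeta>_pos by (simp add: pos_le_divide_eq mult.commute)
  also have "l / \<zeta> = F0 + \<Theta> n + \<nu> + ln (1 + c) / \<zeta>"
    using \<zeta>_pos by (simp add: l_def add_divide_distrib)
  also have "ln (1 + c) / \<zeta> = 18 * real K / \<delta> * ln (1 + c)" by (simp add: \<zeta>_def)
  finally show ?thesis by (simp add: c_def)
qed

text \<open>Off the good set only the trivial bound \<open>b\<close> is available, but
  \<open>b \<le> T * (1 + 2 * a0)\<close> and the complement has probability at most
  \<open>1 / T\<close>; this costs the summand \<open>1 + 2 * a0\<close>.\<close>

lemma expected_queue_le:
  assumes xs: "is_policy C J x" "\<And>k. k \<in> {1..K} \<Longrightarrow> policy_avg C J p (w k) x \<le> - \<delta>"
    and \<tau>: "\<tau> \<in> {1..T}" and k: "k \<in> {1..K}"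
  shows "(\<integral>\<omega>. Q k (Suc \<tau>) \<omega> \<partial>M)
    \<le> F0 + \<Theta> \<tau> + \<nu> + 18 * real K / \<delta> * ln (1 + 144 * real K / \<delta>\<^sup>2) + 1 + 2 * a0"
proof -
  have n: "\<tau> \<le> T" "1 \<le> T" using \<tau> by auto
  define b where "b = real \<tau> + 2 * a0 * sqrt (real \<tau>)"
  have b0: "0 \<le> b" using a0_ge_2 by (simp add: b_def)
  have Qb: "Q k (Suc \<tau>) \<omega> \<le> b" if "\<omega> \<in> space M" for \<omega>
    using Q_le[OF k that n(1)] sum_eps_le[of \<tau>] by (simp add: b_def sum.distrib)
  have qi: "integrable M (\<lambda>\<omega>. indicator (good \<tau>) \<omega> * qnorm (Suc \<tau>) \<omega>)"
    by (rule good_qnorm_integrable[OF n(1)])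
  have ii: "integrable M (\<lambda>\<omega>. b * indicator (space M - good \<tau>) \<omega>)"
    using good_sets[OF n(1)] by (intro integrable_mult_right integrable_real_indicator) (auto simp: less_top[symmetric])
  have "(\<integral>\<omega>. Q k (Suc \<tau>) \<omega> \<partial>M) \<le> (\<integral>\<omega>. indicator (good \<tau>) \<omega> * qnorm (Suc \<tau>) \<omega> + b * indicator (space M - good \<tau>) \<omega> \<partial>M)"
  proof (rule integral_mono)
    show "Q k (Suc \<tau>) \<omega> \<le> indicator (good \<tau>) \<omega> * qnorm (Suc \<tau>) \<omega> + b * indicator (space M - good \<tau>) \<omega>"
      if "\<omega> \<in> space M" for \<omega>
      using Qb[OF that] Q_le_qnorm[OF k, of "Suc \<tau>" \<omega>] that by (auto simp: indicator_def)
  qed (use Q_integrable[OF k n(1)] qi ii in auto)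
  also have "\<dots> = (\<integral>\<omega>. indicator (good \<tau>) \<omega> * qnorm (Suc \<tau>) \<omega> \<partial>M) + b * prob (space M - good \<tau>)"
    using qi ii good_sets[OF n(1)] by simp
  also have "b * prob (space M - good \<tau>) \<le> b * (1 / real T)"
    using prob_not_good[OF n(1)] b0 by (rule mult_left_mono)
  also have "b * (1 / real T) \<le> 1 + 2 * a0"
  proof -
    have "sqrt (real \<tau>) \<le> real \<tau>" using \<tau> by (intro real_le_lsqrt) (auto simp: power2_eq_square)
    then have "b \<le> real T + 2 * a0 * real T"
      unfolding b_def using n a0_ge_2 by (intro add_mono mult_left_mono) auto
    then show ?thesis using n by (simp add: field_simps)
  qed
  finally show ?thesis using expected_qnorm_le[OF xs n(1)] by linarith
qed

lemma expected_cost_le: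
  assumes xs: "is_policy C J x" "\<And>k. k \<in> {1..K} \<Longrightarrow> policy_avg C J p (w k) x \<le> - \<delta>"
    and \<tau>: "\<tau> \<in> {1..T}" and k: "k \<in> {1..K}"
  shows "(\<integral>\<omega>. (\<Sum>t\<in>{1..\<tau>}. cost k t \<omega>) \<partial>M)
    \<le> sqrt (real K) * (48 * (real K)\<^sup>2 / \<delta> * ln (16 / \<delta>) + 24 * real K powr (3/2) / \<delta>\<^sup>2
        + 30 * real K powr (3/2) / \<delta> + 8 * real K - sqrt (real \<tau>))"
proof -
  have n: "\<tau> \<le> T" using \<tau> by auto
  have tT: "t \<in> {1..T}" if "t \<in> {1..\<tau>}" for t using that \<tau> by auto
  define \<kappa> L s where "\<kappa> = real K" and "L = ln (16 / \<delta>)" and "s = sqrt (real \<tau>)"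
  have \<kappa>: "\<kappa> \<ge> 1" using K_pos by (simp add: \<kappa>_def)
  have \<delta>: "\<delta> > 0" "\<delta> \<le> 1" by (rule \<delta>_range)+
  have s: "s \<ge> 0" by (simp add: s_def)
  have ci: "integrable M (cost k t)" if "t \<in> {1..T}" for t
    using cost_bound[OF k that] cost_meas[OF that k] by (rule integrable_bounded_on_space[rotated])
  have "(\<integral>\<omega>. (\<Sum>t\<in>{1..\<tau>}. cost k t \<omega>) \<partial>M) \<le> (\<integral>\<omega>. Q k (Suc \<tau>) \<omega> - (\<Sum>t\<in>{1..\<tau>}. eps t) \<partial>M)"
  proof (rule integral_mono)
    show "integrable M (\<lambda>\<omega>. \<Sum>t\<in>{1..\<tau>}. cost k t \<omega>)"
      by (intro Bochner_Integration.integrable_sum ci tT)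
    show "integrable M (\<lambda>\<omega>. Q k (Suc \<tau>) \<omega> - (\<Sum>t\<in>{1..\<tau>}. eps t))"
      using Q_integrable[OF k n] by simp
    show "(\<Sum>t\<in>{1..\<tau>}. cost k t \<omega>) \<le> Q k (Suc \<tau>) \<omega> - (\<Sum>t\<in>{1..\<tau>}. eps t)" if "\<omega> \<in> space M" for \<omega>
      using Q_ge[OF k that n] by (simp add: sum.distrib)
  qed
  also have "\<dots> = (\<integral>\<omega>. Q k (Suc \<tau>) \<omega> \<partial>M) - (\<Sum>t\<in>{1..\<tau>}. eps t)"
    using Q_integrable[OF k n] by (simp add: prob_space)
  \<comment> \<open>One \<open>2 * a0\<close> is the price of failed confidence sets, the other
    bounds the gap between \<open>2 * a0 * s\<close> and the sum of \<open>eps\<close>.\<close>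
  also have "\<dots> \<le> F0 + \<Theta> \<tau> + \<nu> + 18 * \<kappa> / \<delta> * ln (1 + 144 * \<kappa> / \<delta>\<^sup>2) + 1 + 2 * a0 - (2 * a0 * s - 2 * a0)"
  proof -
    have "s \<le> sqrt (real \<tau> + 1)" by (simp add: s_def)
    then have "2 * a0 * (s - 1) \<le> 2 * a0 * (sqrt (real \<tau> + 1) - 1)" using a0_ge_2 by (intro mult_left_mono) auto
    then show ?thesis
      using expected_queue_le[OF xs \<tau> k] sum_eps_ge[of \<tau>] unfolding \<kappa>_def by (simp add: algebra_simps)
  qed
  also have "\<dots> = F0 + 4 * V \<tau> / \<delta> + 9 / 2 * \<kappa> / \<delta> + 3 / 2 * sqrt \<kappa> + 18 * \<kappa> / \<delta> * ln (1 + 144 * \<kappa> / \<delta>\<^sup>2) + 1 + 4 * a0 - 2 * a0 * s"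
    by (simp add: \<Theta>_def \<nu>_def \<kappa>_def add_divide_distrib)
  also have "\<dots> \<le> F0 + (2 * a0 * s - sqrt \<kappa> * s) + 9 / 2 * \<kappa> / \<delta> + 3 / 2 * \<kappa> / \<delta>
      + 18 * \<kappa> / \<delta> * (2 * L + \<kappa> - 1) + \<kappa> / \<delta> + 4 * (49 / 20 * \<kappa> / \<delta>) - 2 * a0 * s"
  proof (intro diff_right_mono add_mono mult_left_mono order_refl)
    show "4 * V \<tau> / \<delta> \<le> 2 * a0 * s - sqrt \<kappa> * s"
    proof -
      have V: "V \<tau> > 0" using \<tau> by (intro V_pos) auto
      have s0: "s > 0" using \<tau> by (simp add: s_def)
      have "\<kappa> / V \<tau> = a0 / (2 * \<delta> * s)" unfolding \<kappa>_def s_def by (rule K_div_V)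
      then have Veq: "4 * V \<tau> / \<delta> = 8 * \<kappa> / a0 * s" using V s0 \<delta> a0_ge_2 by (simp add: field_simps)
      \<comment> \<open>The decisive comparison of constants, \<open>8 + 4 \<le> 12\<close> in units
        of \<open>\<kappa> powr (3/2)\<close>: it leaves at least \<open>sqrt \<kappa> * s\<close>
        of the pessimism above the drift level.\<close>
      have "8 * \<kappa> + sqrt \<kappa> * a0 \<le> 2 * a0\<^sup>2"
      proof -
        have k32: "\<kappa> \<le> \<kappa> powr (3/2)" using \<kappa> powr_mono[of 1 "3/2" \<kappa>] by simp
        have "sqrt \<kappa> * \<kappa> powr (3/4) = \<kappa> powr (5/4)" using \<kappa> by (simp add: powr_half_sqrt[symmetric] powr_add[symmetric])
        also have "\<dots> \<le> \<kappa> powr (3/2)" using \<kappa> by (intro powr_mono) auto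
        finally have "sqrt 6 * (sqrt \<kappa> * \<kappa> powr (3/4)) \<le> 4 * \<kappa> powr (3/2)"
          using \<kappa> by (intro mult_mono) (auto intro: real_le_lsqrt)
        then have "sqrt \<kappa> * a0 \<le> 4 * \<kappa> powr (3/2)" by (simp add: a0_def \<kappa>_def mult_ac)
        then show ?thesis using k32 unfolding a0_sq \<kappa>_def[symmetric] by linarith
      qed
      then have "8 * \<kappa> / a0 + sqrt \<kappa> \<le> 2 * a0" using a0_ge_2 by (simp add: field_simps power2_eq_square)
      then have "(8 * \<kappa> / a0 + sqrt \<kappa>) * s \<le> 2 * a0 * s" using s by (rule mult_right_mono)
      then show ?thesis unfolding Veq by (simp add: distrib_right)
    qed
    have \<kappa>\<delta>: "\<kappa> \<le> \<kappa> / \<delta>" using \<kappa> \<delta> by (simp add: field_simps mult_left_le)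
    have "sqrt \<kappa> \<le> \<kappa>" using \<kappa> by (intro real_le_lsqrt) (auto simp: power2_eq_square)
    then have "sqrt \<kappa> \<le> \<kappa> / \<delta>" using \<kappa>\<delta> by linarith
    then show "3 / 2 * sqrt \<kappa> \<le> 3 / 2 * \<kappa> / \<delta>" by simp
    show "1 \<le> \<kappa> / \<delta>" using \<kappa> \<kappa>\<delta> by linarith
    show "a0 \<le> 49 / 20 * \<kappa> / \<delta>"
    proof -
      have "sqrt 6 * \<kappa> powr (3/4) \<le> 49 / 20 * \<kappa>"
      proof (rule mult_mono)
        show "sqrt 6 \<le> 49 / 20" by (rule real_le_lsqrt) (auto simp: power2_eq_square)
        show "\<kappa> powr (3/4) \<le> \<kappa>" using \<kappa> powr_mono[of "3/4" 1 \<kappa>] by simp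
      qed auto
      then have "a0 \<le> 49 / 20 * \<kappa>" by (simp add: a0_def \<kappa>_def)
      also have "\<dots> \<le> 49 / 20 * (\<kappa> / \<delta>)" using \<kappa>\<delta> by (intro mult_left_mono) auto
      finally show ?thesis by simp
    qed
    show "ln (1 + 144 * \<kappa> / \<delta>\<^sup>2) \<le> 2 * L + \<kappa> - 1"
    proof -
      have d2: "\<delta>\<^sup>2 \<le> 1" "\<delta>\<^sup>2 > 0" using \<delta> by (auto simp: power_le_one)
      have "1 \<le> \<kappa> / \<delta>\<^sup>2" using d2 \<kappa> by (simp add: le_divide_eq)
      \<comment> \<open>Rounding up to the square 256 produces \<open>ln (16 / \<delta>)\<close>;
        the extra factor \<kappa> is paid by \<open>ln \<kappa> \<le> \<kappa> - 1\<close>, whose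
        \<open>- 1\<close> is spent in the collection of terms below.\<close>
      then have "1 + 144 * (\<kappa> / \<delta>\<^sup>2) \<le> 256 * (\<kappa> / \<delta>\<^sup>2)" by linarith
      then have "1 + 144 * \<kappa> / \<delta>\<^sup>2 \<le> 256 * \<kappa> / \<delta>\<^sup>2" by simp
      then have "ln (1 + 144 * \<kappa> / \<delta>\<^sup>2) \<le> ln (256 * \<kappa> / \<delta>\<^sup>2)"
        using d2 \<kappa> by (subst ln_le_cancel_iff) (auto intro!: add_pos_nonneg)
      also have "256 * \<kappa> / \<delta>\<^sup>2 = (16 / \<delta>)\<^sup>2 * \<kappa>" by (simp add: power_divide)
      also have "ln \<dots> = 2 * L + ln \<kappa>"
        using \<delta> \<kappa> by (simp add: ln_mult ln_realpow L_def)
      also have "ln \<kappa> \<le> \<kappa> - 1" using \<kappa> by (intro ln_le_minus_one) auto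
      finally show ?thesis by simp
    qed
    show "0 \<le> 18 * \<kappa> / \<delta>" using \<kappa> \<delta> by simp
  qed simp
  \<comment> \<open>The terms linear in \<open>\<kappa> / \<delta>\<close> have total coefficient
    \<open>9/2 + 3/2 + 1 + 49/5 = 84/5\<close>, covered by the \<open>- 18\<close> that comes from
    \<open>\<kappa> - 1\<close>.\<close>
  also have "\<dots> \<le> F0 - sqrt \<kappa> * s + 36 * (\<kappa>\<^sup>2 / \<delta>) * L + 18 * (\<kappa>\<^sup>2 / \<delta>)"
  proof -
    define y where "y = \<kappa> / \<delta>"
    have y: "0 \<le> y" using \<kappa> \<delta> by (simp add: y_def)
    have L: "0 \<le> L" using \<delta> by (simp add: L_def ln_ge_zero)
    have "y * L \<le> (\<kappa> * y) * L" using y L \<kappa> by (intro mult_right_mono) (auto simp: mult_le_cancel_right1)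
    moreover have "\<kappa>\<^sup>2 / \<delta> = \<kappa> * y" by (simp add: y_def power2_eq_square)
    moreover have "18 * \<kappa> / \<delta> * (2 * L + \<kappa> - 1) = 36 * (y * L) + 18 * (\<kappa> * y) - 18 * y"
      by (simp add: y_def algebra_simps diff_divide_distrib add_divide_distrib)
    moreover have "9 / 2 * \<kappa> / \<delta> = 9 / 2 * y" "3 / 2 * \<kappa> / \<delta> = 3 / 2 * y" "49 / 20 * \<kappa> / \<delta> = 49 / 20 * y" "\<kappa> / \<delta> = y"
      by (simp_all add: y_def)
    ultimately show ?thesis using y by (simp only:)
  qed
  \<comment> \<open>As \<open>16 / \<delta> \<ge> exp 1\<close>, the logarithm is at least 1 and
    takes over 12 of the 18; the remaining 6 joins the 24 of \<open>F0\<close> to give 30.\<close>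
  also have "\<dots> \<le> F0 - sqrt \<kappa> * s + 48 * (\<kappa>\<^sup>2 / \<delta>) * L + 6 * (\<kappa>\<^sup>2 / \<delta>)"
  proof -
    have "ln (exp 1) \<le> L" unfolding L_def
    proof (subst ln_le_cancel_iff)
      have "16 \<le> 16 / \<delta>" using \<delta> by (simp add: field_simps)
      then show "exp 1 \<le> 16 / \<delta>" using exp_le by linarith
    qed (use \<delta> in auto)
    then have gen: "D + 36 * z * L + 18 * z \<le> D + 48 * z * L + 6 * z" if "0 \<le> z" for z D
      using that mult_left_mono[of 1 L "12 * z"] by (simp add: mult.commute)
    show ?thesis by (rule gen) (use \<delta> in simp)
  qed
  also have "\<dots> \<le> sqrt \<kappa> * (48 * \<kappa>\<^sup>2 / \<delta> * L + 24 * \<kappa> powr (3/2) / \<delta>\<^sup>2 + 30 * \<kappa> powr (3/2) / \<delta> + 8 * \<kappa> - s)"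
  proof -
    have k2: "sqrt \<kappa> * \<kappa> powr (3/2) = \<kappa>\<^sup>2"
    proof -
      have "sqrt \<kappa> * \<kappa> powr (3/2) = \<kappa> powr 2"
        using \<kappa> by (simp add: powr_half_sqrt[symmetric] powr_add[symmetric])
      also have "\<dots> = \<kappa>\<^sup>2" using \<kappa> by (subst powr_numeral) auto
      finally show ?thesis .
    qed
    have "1 \<le> sqrt \<kappa>" using \<kappa> by simp
    moreover have L: "0 \<le> 48 * (\<kappa>\<^sup>2 / \<delta>) * L" using \<delta> by (simp add: L_def ln_ge_zero)
    ultimately have "1 * (48 * (\<kappa>\<^sup>2 / \<delta>) * L) \<le> sqrt \<kappa> * (48 * (\<kappa>\<^sup>2 / \<delta>) * L)" by (rule mult_right_mono)
    moreover have "0 \<le> sqrt \<kappa> * (8 * \<kappa>)" using \<kappa> by simp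
    ultimately have "48 * (\<kappa>\<^sup>2 / \<delta>) * L \<le> sqrt \<kappa> * (48 * (\<kappa>\<^sup>2 / \<delta>) * L) + sqrt \<kappa> * (8 * \<kappa>)" by linarith
    then have "F0 - sqrt \<kappa> * s + 48 * (\<kappa>\<^sup>2 / \<delta>) * L + 6 * (\<kappa>\<^sup>2 / \<delta>)
        \<le> F0 - sqrt \<kappa> * s + (sqrt \<kappa> * (48 * (\<kappa>\<^sup>2 / \<delta>) * L) + sqrt \<kappa> * (8 * \<kappa>)) + 6 * (\<kappa>\<^sup>2 / \<delta>)"
      by (intro add_mono order_refl)
    also have "\<dots> = sqrt \<kappa> * (48 * (\<kappa>\<^sup>2 / \<delta>) * L) + 24 * (sqrt \<kappa> * \<kappa> powr (3/2)) / \<delta>\<^sup>2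
        + 30 * (sqrt \<kappa> * \<kappa> powr (3/2)) / \<delta> + sqrt \<kappa> * (8 * \<kappa>) - sqrt \<kappa> * s"
      unfolding k2 by (simp add: F0_def \<kappa>_def)
    also have "\<dots> = sqrt \<kappa> * (48 * \<kappa>\<^sup>2 / \<delta> * L + 24 * \<kappa> powr (3/2) / \<delta>\<^sup>2 + 30 * \<kappa> powr (3/2) / \<delta> + 8 * \<kappa> - s)"
      by (simp add: algebra_simps)
    finally show ?thesis .
  qed
  finally show ?thesis unfolding \<kappa>_def L_def s_def .
qed

text \<open>Each of the \<open>K\<close> constraints contributes \<open>sqrt K\<close> times the
  same bracket, whence the exponent 3/2.\<close>

lemma violation_bound:
  assumes xs: "is_policy C J x" "\<And>k. k \<in> {1..K} \<Longrightarrow> policy_avg C J p (w k) x \<le> - \<delta>"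
    and \<tau>: "\<tau> \<in> {1..T}"
  shows "violation M J K ctx A W \<tau> \<le> real K powr (3/2) *
      max 0 (48 * real K ^ 2 / \<delta> * ln (16 / \<delta>) + 24 * real K powr (3/2) / \<delta>\<^sup>2
                + 30 * real K powr (3/2) / \<delta> + 8 * real K - sqrt (real \<tau>))"
proof -
  define B where "B = 48 * real K ^ 2 / \<delta> * ln (16 / \<delta>) + 24 * real K powr (3/2) / \<delta>\<^sup>2
                + 30 * real K powr (3/2) / \<delta> + 8 * real K - sqrt (real \<tau>)"
  have tT: "t \<in> {1..T}" if "t \<in> {1..\<tau>}" for t using that \<tau> by auto
  have "violation M J K ctx A W \<tau> \<le> (\<Sum>k\<in>{1..K}. sqrt (real K) * max 0 B)"
    unfolding violation_def
  proof (rule sum_mono)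
    fix k assume k: "k \<in> {1..K}"
    have "(\<integral>\<omega>. (\<Sum>t\<in>{1..\<tau>}. \<Sum>j\<in>{1..J}. W t k (ctx t \<omega>) j \<omega> * of_bool (A t \<omega> = j)) \<partial>M)
        = (\<integral>\<omega>. (\<Sum>t\<in>{1..\<tau>}. cost k t \<omega>) \<partial>M)"
      by (intro Bochner_Integration.integral_cong sum.cong refl) (simp only: sum_action[OF tT] cost_def)
    also have "\<dots> \<le> sqrt (real K) * B" unfolding B_def by (rule expected_cost_le[OF xs \<tau> k])
    also have "\<dots> \<le> sqrt (real K) * max 0 B" by (intro mult_left_mono) auto
    finally show "max 0 (\<integral>\<omega>. (\<Sum>t\<in>{1..\<tau>}. \<Sum>j\<in>{1..J}. W t k (ctx t \<omega>) j \<omega> * of_bool (A t \<omega> = j)) \<partial>M)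
        \<le> sqrt (real K) * max 0 B" by simp
  qed
  also have "\<dots> = (real K * sqrt (real K)) * max 0 B" by simp
  also have "real K * sqrt (real K) = real K powr (3/2)"
  proof -
    have "real K * sqrt (real K) = real K powr 1 * real K powr (1/2)" using K_pos by (simp add: powr_half_sqrt)
    also have "\<dots> = real K powr (3/2)" by (simp only: powr_add[symmetric]) simp
    finally show ?thesis .
  qed
  finally show ?thesis by (simp only: B_def)
qed

end

theorem theorem1:
  fixes M :: "'o measure"
    and T J K :: nat
    and C :: "'c set"
    and p :: "'c \<Rightarrow> real"
    and \<phi> :: "'c \<Rightarrow> nat \<Rightarrow> real^'n"
    and \<theta>star :: "real^'n"
    and m \<delta> :: real
    and ctx :: "nat \<Rightarrow> 'o \<Rightarrow> 'c"
    and A :: "nat \<Rightarrow> 'o \<Rightarrow> nat"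
    and W :: "nat \<Rightarrow> nat \<Rightarrow> 'c \<Rightarrow> nat \<Rightarrow> 'o \<Rightarrow> real"
    and \<eta> :: "nat \<Rightarrow> 'o \<Rightarrow> real"
    and w :: "nat \<Rightarrow> 'c \<Rightarrow> nat \<Rightarrow> real"
    and r :: "'c \<Rightarrow> nat \<Rightarrow> real"
    and R :: "nat \<Rightarrow> nat \<Rightarrow> 'o \<Rightarrow> real"
    and xstar :: "'c \<Rightarrow> nat \<Rightarrow> real"
    and \<tau> :: nat
  assumes r_eq: "\<And>c j. r c j = \<theta>star \<bullet> \<phi> c j"
    and R_eq: "\<And>t j \<omega>. R t j \<omega> = r (ctx t \<omega>) j + \<eta> t \<omega>"
    and w_eq: "\<And>k c j. w k c j = (\<integral>\<omega>. W 1 k c j \<omega> \<partial>M)"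
    and prob: "prob_space M"
    and countable_C: "countable C"
    and K_pos: "K \<ge> 1"
    and ctx_meas: "\<And>t. t \<in> {1..T} \<Longrightarrow> ctx t \<in> measurable M (count_space C)"
    and A_meas: "\<And>t. t \<in> {1..T} \<Longrightarrow> A t \<in> measurable M (count_space {1..J})"
    and W_meas: "\<And>t k c j. t \<in> {1..T} \<Longrightarrow> k \<in> {1..K} \<Longrightarrow> c \<in> C \<Longrightarrow> j \<in> {1..J} \<Longrightarrow>
        W t k c j \<in> borel_measurable M"
    and \<eta>_meas: "\<And>t. t \<in> {1..T} \<Longrightarrow> \<eta> t \<in> borel_measurable M"
    and ctx_indep: "prob_space.indep_vars M (\<lambda>_. count_space C) ctx {1..T}"
    and ctx_law: "\<And>t c. t \<in> {1..T} \<Longrightarrow> c \<in> C \<Longrightarrow> measure M {\<omega>\<in>space M. ctx t \<omega> = c} = p c"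
    and r_range: "\<And>c j. c \<in> C \<Longrightarrow> j \<in> {1..J} \<Longrightarrow> r c j \<in> {0..1}"
    and \<phi>_bound: "\<And>c j. c \<in> C \<Longrightarrow> j \<in> {1..J} \<Longrightarrow> norm (\<phi> c j) \<le> 1"
    and \<theta>_bound: "norm \<theta>star \<le> m"
    and \<eta>_zero_mean: "\<And>t. t \<in> {1..T} \<Longrightarrow>
        cond_zero_mean M (pre_reward M C J K ctx A R W t) (\<eta> t)"
    and \<eta>_subgaussian: "\<And>t. t \<in> {1..T} \<Longrightarrow>
        cond_subgaussian 1 M (pre_reward M C J K ctx A R W t) (\<eta> t)"
    and W_bound: "\<And>t k c j \<omega>. t \<in> {1..T} \<Longrightarrow> k \<in> {1..K} \<Longrightarrow> c \<in> C \<Longrightarrow> j \<in> {1..J} \<Longrightarrow>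
        \<omega> \<in> space M \<Longrightarrow> \<bar>W t k c j \<omega>\<bar> \<le> 1"
    and W_indep: "\<And>k c j. k \<in> {1..K} \<Longrightarrow> c \<in> C \<Longrightarrow> j \<in> {1..J} \<Longrightarrow>
        prob_space.indep_vars M (\<lambda>_. borel) (\<lambda>t. W t k c j) {1..T}"
    and W_ident: "\<And>t k c j. t \<in> {1..T} \<Longrightarrow> k \<in> {1..K} \<Longrightarrow> c \<in> C \<Longrightarrow> j \<in> {1..J} \<Longrightarrow>
        distr M borel (W t k c j) = distr M borel (W 1 k c j)"
    \<comment> \<open>the draw of a round is fresh, and its costs are drawn independently of its context\<close>
    and fresh: "\<And>t. t \<in> {1..T} \<Longrightarrow>
        prob_space.indep_set M (sets (round_draw M C J K ctx W t))
          (sets (history M C J K ctx A R W (t - 1)))"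
    and W_ctx_indep: "\<And>t k c j. t \<in> {1..T} \<Longrightarrow> k \<in> {1..K} \<Longrightarrow> c \<in> C \<Longrightarrow> j \<in> {1..J} \<Longrightarrow>
        prob_space.indep_set M (gen_sets M (ctx t) (count_space C)) (gen_sets M (W t k c j) borel)"
    and \<delta>_range: "0 < \<delta>" "\<delta> \<le> 1"
    and slater: "\<exists>x. is_policy C J x \<and> (\<forall>k\<in>{1..K}. policy_avg C J p (w k) x \<le> - \<delta>)"
    and baseline: "optimal_policy C J K p r w xstar"
    and algorithm: "\<And>\<omega>. \<omega> \<in> space M \<Longrightarrow>
        pess_opt_run T J K m \<delta> \<phi> (\<lambda>t. ctx t \<omega>) (\<lambda>t. A t \<omega>) (\<lambda>t. R t (A t \<omega>) \<omega>)
          (\<lambda>t k c j. W t k c j \<omega>)"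
    and \<tau>_range: "\<tau> \<in> {1..T}"
  shows
    "regret M C J p r A R xstar \<tau> \<le>
       60 * real K ^ 3 / \<delta> ^ 3
       + 4 * sqrt 6 * real K powr (3/4) * sqrt (real \<tau>) / \<delta>
       + 2
       + sqrt (8 * real CARD('n) * real \<tau>
               * (m + sqrt (2 * ln (real T) + real CARD('n) * ln (1 + real \<tau> / real CARD('n))))\<^sup>2
               * ln ((real CARD('n) + real \<tau>) / real CARD('n)))
     \<and>
     violation M J K ctx A W \<tau> \<le>
       real K powr (3/2) *
         max 0 (48 * real K ^ 2 / \<delta> * ln (16 / \<delta>)
                + 24 * real K powr (3/2) / \<delta>\<^sup>2
                + 30 * real K powr (3/2) / \<delta>
                + 8 * real K
                - sqrt (real \<tau>))"
proof -
  interpret prob_space M by (rule prob)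
  interpret pess_opt_bandit M T J K C p \<phi> \<theta>star m \<delta> "CARD('n)" ctx A W \<eta> w r R
  proof unfold_locales
    show "1 \<le> T" using \<tau>_range by simp
  qed (fact r_eq R_eq w_eq countable_C K_pos ctx_meas A_meas W_meas \<eta>_meas ctx_law r_range \<phi>_bound
      \<theta>_bound \<eta>_zero_mean \<eta>_subgaussian W_bound W_ident fresh W_ctx_indep \<delta>_range algorithm refl)+
  obtain x where x: "is_policy C J x" "\<And>k. k \<in> {1..K} \<Longrightarrow> policy_avg C J p (w k) x \<le> - \<delta>"
    using slater by blast
  show ?thesis
    using regret_bound[OF baseline x \<tau>_range] violation_bound[OF x \<tau>_range] by blast
qed

end
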